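(* Let $d\ge 2$ and, for $i=2,\dots,d$, let $g_i(u)=c_iu^{\alpha_i}+r_i$ for $u\ge 0$, where $c_i\in(0,\infty)$ and $\alpha_i,r_i\in[0,\infty)$ (when $\alpha_i=0$, $g_i$ is the constant $c_i+r_i$). Let $\beta=1+\sum_{i=2}^d\alpha_i$ and $$a_t=\log\Big(\frac{t}{(2\pi)^{1/(2\beta)}(\log t)^{(\beta+1)/(2\beta)}}\Big),\qquad b_t=\Big(\frac{\beta t}{d\log t}\Big)^{1/2}.$$ Then for each $m=0,1,2,\dots$ and any $x\in\mathbb{R}$, $$\lim_{t\to\infty}\mathbb{P}_{\{g_i\}}\Big(\frac{X_t^{(m)}}{b_t}-a_t\le x\Big)=\sum_{k=0}^m\frac{(Me^{-\beta x})^k}{k!}\exp\big(-Me^{-\beta x}\big),$$ where $$M=\frac{\Gamma(\beta)}{d^{\beta/2}\beta^{(\beta+1)/2}}\Big(\prod_{i:\,\alpha_i=0}(2\lfloor c_i+r_i\rfloor+1)\Big)\Big(\prod_{i:\,\alpha_i>0}2c_i\Big).$$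
   Context: Exclusion process. $\{\eta_t\}_{t\ge0}$ is the symmetric simple exclusion process on $\mathbb{Z}^d$: the Markov process on $\{0,1\}^{\mathbb{Z}^d}$ with generator $\mathcal{L}_d f(\eta)=\frac{1}{2d}\sum_{x\in\mathbb{Z}^d}\sum_{|y-x|=1}\eta(x)(1-\eta(y))(f(\eta^{x,y})-f(\eta))$ for local functions $f$, where $\eta^{x,y}$ is $\eta$ with the values at $x$ and $y$ exchanged. Initial profiles. For $g_2,\dots,g_d:[0,\infty)\to[0,\infty)$, let $\mathcal{R}_{\{g_i\}}=\{x\in\mathbb{Z}^d: x_1\le 0,\ |x_i|\le g_i(-x_1)\text{ for } i=2,\dots,d\}$ and $\eta_{\{g_i\}}(x)=1(x\in\mathcal{R}_{\{g_i\}})$; $\mathbb{P}_{\{g_i\}}$ denotes the law of the process started from $\eta_{\{g_i\}}$. Order statistics. $\cdots\le X_t^{(2)}\le X_t^{(1)}\le X_t^{(0)}=X_t$ are the first coordinates $x_1$ of the occupied sites $x$ (those with $\eta_t(x)=1$) in decreasing order, counted with multiplicity (one entry per particle, so ties are possible). Thus $X_t=\max\{x_1:\eta_t(x)=1\}$, and for real $z$, $\{X_t^{(m)}\le z\}=\{N_t\le m\}$, where $N_t=\sum_{x\in\mathbb{Z}^d,\,x_1>z}\eta_t(x)$. Empty products equal $1$. *)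

theory Defs
  imports "HOL-Probability.Probability"
begin

(* Sites are the vectors of type int ^ 'n, so the dimension is d = CARD('n).
   A configuration is a predicate on sites, True standing for 1 (occupied) and False for 0. *)

type_synonym 'n config = "int ^ 'n \<Rightarrow> bool"

definition nbr :: "int ^ 'n::finite \<Rightarrow> int ^ 'n \<Rightarrow> bool" where
  "nbr x y \<longleftrightarrow> norm (\<chi> i. real_of_int (y $ i - x $ i)) = 1"

definition local_fun :: "('n::finite config \<Rightarrow> real) \<Rightarrow> bool" where
  "local_fun f \<longleftrightarrow>
     (\<exists>A. finite A \<and> (\<forall>\<eta> \<zeta>. (\<forall>x\<in>A. \<eta> x = \<zeta> x) \<longrightarrow> f \<eta> = f \<zeta>))"

definition exchange :: "int ^ 'n::finite \<Rightarrow> int ^ 'n \<Rightarrow> 'n config \<Rightarrow> 'n config" where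
  "exchange x y \<eta> = \<eta>(x := \<eta> y, y := \<eta> x)"

(* For local f only finitely many terms of the outer sum are nonzero. *)
definition ssep_op :: "('n::finite config \<Rightarrow> real) \<Rightarrow> 'n config \<Rightarrow> real" where
  "ssep_op f \<eta> = 1 / (2 * real CARD('n)) *
     (\<Sum>\<^sub>\<infinity>x. \<Sum>y | nbr x y.
        of_bool (\<eta> x) * (1 - of_bool (\<eta> y)) * (f (exchange x y \<eta>) - f \<eta>))"

(* Configurations carry the product topology, which is compact, so that the type of bounded
   continuous functions is the space of all continuous functions with the supremum norm.
   Only the values of the semigroup at times t \<ge> 0 matter. *)
definition markov_semigroup ::
    "(real \<Rightarrow> ('n::finite config \<Rightarrow>\<^sub>C real) \<Rightarrow> ('n config \<Rightarrow>\<^sub>C real)) \<Rightarrow> bool" where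
  "markov_semigroup S \<longleftrightarrow>
     (\<forall>t\<ge>0. linear (S t)) \<and>
     (\<forall>f. S 0 f = f) \<and>
     (\<forall>f. \<forall>t\<ge>0. continuous (at_right t) (\<lambda>s. S s f)) \<and>
     (\<forall>f. \<forall>s\<ge>0. \<forall>t\<ge>0. S (s + t) f = S s (S t f)) \<and>
     (\<forall>t\<ge>0. S t (const_bcontfun 1) = const_bcontfun 1) \<and>
     (\<forall>f. \<forall>t\<ge>0. (\<forall>\<eta>. 0 \<le> apply_bcontfun f \<eta>) \<longrightarrow> (\<forall>\<eta>. 0 \<le> apply_bcontfun (S t f) \<eta>))"

definition generator_graph ::
    "(real \<Rightarrow> ('n::finite config \<Rightarrow>\<^sub>C real) \<Rightarrow> ('n config \<Rightarrow>\<^sub>C real))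
       \<Rightarrow> (('n config \<Rightarrow>\<^sub>C real) \<times> ('n config \<Rightarrow>\<^sub>C real)) set" where
  "generator_graph S = {(f, h). ((\<lambda>t. (S t f - f) /\<^sub>R t) \<longlongrightarrow> h) (at_right 0)}"

(* That a Markov semigroup has the generator given by ssep_op on local functions means, as usual for
   interacting particle systems, that its generator is the closure of this operator. *)
definition ssep_semigroup ::
    "(real \<Rightarrow> ('n::finite config \<Rightarrow>\<^sub>C real) \<Rightarrow> ('n config \<Rightarrow>\<^sub>C real)) \<Rightarrow> bool" where
  "ssep_semigroup S \<longleftrightarrow> markov_semigroup S \<and>
     generator_graph S =
       closure {(f, h). local_fun (apply_bcontfun f) \<and>
                        apply_bcontfun h = ssep_op (apply_bcontfun f)}"

definition past :: "'w measure \<Rightarrow> (real \<Rightarrow> 'w \<Rightarrow> 'n::finite config) \<Rightarrow> real \<Rightarrow> 'w measure" where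
  "past P \<eta> s = sigma (space P) {\<eta> u -` B \<inter> space P |u B. 0 \<le> u \<and> u \<le> s \<and> B \<in> sets borel}"

definition ssep_from ::
    "'n::finite config \<Rightarrow> 'w measure \<Rightarrow> (real \<Rightarrow> 'w \<Rightarrow> 'n config) \<Rightarrow> bool" where
  "ssep_from \<eta>0 P \<eta> \<longleftrightarrow>
     prob_space P \<and>
     (\<forall>t\<ge>0. \<eta> t \<in> borel_measurable P) \<and>
     (\<forall>\<omega>\<in>space P. \<forall>t\<ge>0. continuous (at_right t) (\<lambda>s. \<eta> s \<omega>)) \<and>
     (\<forall>\<omega>\<in>space P. \<forall>t>0. \<exists>l. ((\<lambda>s. \<eta> s \<omega>) \<longlongrightarrow> l) (at_left t)) \<and>
     (AE \<omega> in P. \<eta> 0 \<omega> = \<eta>0) \<and>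
     (\<exists>S. ssep_semigroup S \<and>
        (\<forall>f s t. 0 \<le> s \<and> s \<le> t \<longrightarrow>
           (AE \<omega> in P. real_cond_exp P (past P \<eta> s) (\<lambda>\<omega>'. apply_bcontfun f (\<eta> t \<omega>')) \<omega>
                        = apply_bcontfun (S (t - s) f) (\<eta> s \<omega>))))"

(* The index j1 plays the role of the first coordinate, the other indices that of 2, ..., d. *)
definition init_config :: "'n::finite \<Rightarrow> ('n \<Rightarrow> real \<Rightarrow> real) \<Rightarrow> 'n config" where
  "init_config j1 g x \<longleftrightarrow>
     x $ j1 \<le> 0 \<and> (\<forall>i. i \<noteq> j1 \<longrightarrow> \<bar>real_of_int (x $ i)\<bar> \<le> g i (- real_of_int (x $ j1)))"

(* In contrast to the library's 0 powr 0 = 0, the value for exponent 0 is 1 also at u = 0. *)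
definition profile :: "real \<Rightarrow> real \<Rightarrow> real \<Rightarrow> real \<Rightarrow> real" where
  "profile c \<alpha> r u = c * (if \<alpha> = 0 then 1 else u powr \<alpha>) + r"

(* The (m+1)-st largest first coordinate of an occupied site, counted with multiplicity: the largest k
   such that m+1 different occupied sites have first coordinate at least k. As a supremum in the
   extended reals it is \<infinity> if every half-space {x. k \<le> x $ j1} contains more than m
   particles, and -\<infinity> if there are at most m particles in total. Both values have
   probability 0 for the process considered. *)
definition order_stat :: "'n::finite \<Rightarrow> nat \<Rightarrow> 'n config \<Rightarrow> ereal" where
  "order_stat j1 m \<eta> =
     Sup {ereal (real_of_int k) |k.
            \<exists>A. A \<subseteq> {x. \<eta> x} \<and> finite A \<and> card A = Suc m \<and> (\<forall>x\<in>A. k \<le> x $ j1)}"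

lemma order_stat_le_iff:
  "order_stat j1 m \<eta> \<le> ereal z \<longleftrightarrow>
     finite {x. \<eta> x \<and> z < real_of_int (x $ j1)} \<and>
     card {x. \<eta> x \<and> z < real_of_int (x $ j1)} \<le> m"
  (is "?L \<longleftrightarrow> finite ?N \<and> card ?N \<le> m")
proof
  assume L: ?L
  show "finite ?N \<and> card ?N \<le> m"
  proof (rule ccontr)
    assume "\<not> (finite ?N \<and> card ?N \<le> m)"
    then obtain A where A: "A \<subseteq> ?N" "finite A" "card A = Suc m"
    proof (cases "finite ?N")
      case True
      with \<open>\<not> (finite ?N \<and> card ?N \<le> m)\<close> have "Suc m \<le> card ?N" by simp
      then show ?thesis using that by (rule obtain_subset_with_card_n)
    next
      case False
      then show ?thesis using that infinite_arbitrarily_large by blast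
    qed
    define k where "k = Min ((\<lambda>x. x $ j1) ` A)"
    have ne: "A \<noteq> {}" using A by auto
    have "k \<in> (\<lambda>x. x $ j1) ` A" unfolding k_def using A ne by (intro Min_in) auto
    then have zk: "z < real_of_int k" using A by auto
    have "\<forall>x\<in>A. k \<le> x $ j1" unfolding k_def using A by auto
    then have "ereal (real_of_int k) \<le> order_stat j1 m \<eta>"
      unfolding order_stat_def using A
      by (intro Sup_upper CollectI exI[of _ k] conjI refl exI[of _ A]) auto
    with L have "ereal (real_of_int k) \<le> ereal z" by (rule order_trans[rotated])
    with zk show False by simp
  qed
next
  assume R: "finite ?N \<and> card ?N \<le> m"
  show ?L unfolding order_stat_def
  proof (rule Sup_least, clarify)
    fix k A assume A: "A \<subseteq> {x. \<eta> x}" "finite A" "card A = Suc m" "\<forall>x\<in>A. k \<le> x $ j1"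
    show "ereal (real_of_int k) \<le> ereal z"
    proof (rule ccontr)
      assume "\<not> ereal (real_of_int k) \<le> ereal z"
      then have "z < real_of_int k" by simp
      then have "z < real_of_int (x $ j1)" if "x \<in> A" for x
        using A(4) that by (meson less_le_trans of_int_le_iff)
      then have "A \<subseteq> ?N" using A(1) by blast
      then have "card A \<le> card ?N" using R by (intro card_mono) auto
      with A R show False by simp
    qed
  qed
qed

lemma order_stat_enumeration:
  assumes p: "bij_betw p UNIV {x. \<eta> x}" and mono: "antimono (\<lambda>k. p k $ j1)"
  shows "order_stat j1 m \<eta> = ereal (real_of_int (p m $ j1))"
proof (rule antisym)
  have sub: "{x. \<eta> x \<and> real_of_int (p m $ j1) < real_of_int (x $ j1)} \<subseteq> p ` {..<m}"
  proof
    fix x assume x: "x \<in> {x. \<eta> x \<and> real_of_int (p m $ j1) < real_of_int (x $ j1)}"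
    then obtain k where k: "x = p k" using p by (auto simp: bij_betw_def)
    have "k < m" using antimonoD[OF mono, of m k] x k by (cases "k < m") auto
    with k show "x \<in> p ` {..<m}" by auto
  qed
  have "card (p ` {..<m}) \<le> m" using card_image_le[of "{..<m}" p] by simp
  then show "order_stat j1 m \<eta> \<le> ereal (real_of_int (p m $ j1))"
    unfolding order_stat_le_iff
    using finite_subset[OF sub] card_mono[OF _ sub] by simp
next
  have "inj_on p {..m}" using p inj_on_subset unfolding bij_betw_def by blast
  then have "card (p ` {..m}) = Suc m" by (simp add: card_image)
  moreover have "p ` {..m} \<subseteq> {x. \<eta> x}" using p by (auto simp: bij_betw_def)
  moreover have "\<forall>x\<in>p ` {..m}. p m $ j1 \<le> x $ j1" using antimonoD[OF mono] by auto
  ultimately show "ereal (real_of_int (p m $ j1)) \<le> order_stat j1 m \<eta>"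
    unfolding order_stat_def by (intro Sup_upper CollectI exI[of _ "p m $ j1"] conjI refl exI[of _ "p ` {..m}"]) auto
qed

end

theory Submission
  imports Defs "HOL-Real_Asymp.Real_Asymp"
begin

text \<open>
Independent walkers started from the initial configuration are compared with the exclusion process by
Duhamel's formula applied to the products $\prod_{x}(1 - \theta\, p_{t-s}(x, B)\, \eta_s(x))$, whose
expectation at $s = t$ is the generating function of the number of particles in $B$ at time $t$. Two
exclusion particles on a common bond contribute an error of order
$(p_{t-s}(x, B) - p_{t-s}(y, B))^2$, weighted with the probability that both ends of the bond are
occupied; the generating function itself, taken for two sites, bounds this weight by the squares of the
occupation densities of the independent walkers. For $B$ the part of the half-space beyond $b_t (x + a_t)$ inside a large box, the
gradient of $p_{t-s}(\cdot, B)$ is concentrated near the bounding hyperplane, and exponential tilting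
together with a local central limit bound makes the accumulated error vanish. The expected number of
independent walkers in the half-space is a sum over the layers of the initial configuration; tilting
by $\rho_t$, the ratio of the level to the variance, turns it into a Gamma integral with limit
$M e^{-\beta x}$. The generating functions therefore converge to those of a Poisson variable, and
approximating the indicator of $\{0, \dots, m\}$ by polynomials in $2^{-N}$ gives the distribution
function.
\<close>

section \<open>Continuous-time simple random walk\<close>

text \<open>The proof does without negative dependence by closing a loop. The two-particle error in
  Duhamel's formula has a sign, so dropping it bounds the generating function from above at no cost.
  Together with a first-moment bound, this already controls the pair occupation, and that control
  bounds the dropped error itself. The error is small because one tilt serves both parts of the time
  interval: the Chernoff factor for reaching a site by time s and the one for going on to the
  hyperplane in time t - s multiply to \<open>Q t\<close>, whatever the site and s. Of two copies of
  (density times gradient), one is at most a constant times \<open>Q t / sqrt (t - s)\<close>; the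
  other is summed over all sites to the mass of one layer at time t, at most of order
  \<open>Q t * \<rho> t powr (- \<beta>) / sqrt t\<close>. Integration over s leaves
  \<open>(Q t)\<^sup>2 * \<rho> t powr (- \<beta>)\<close>. As \<open>Q t\<close> is of order sqrt t
  / b^(\<beta> + 1) and the tilt of order 1 / b, with b = b_t, this is of order t / b^(\<beta> + 2),
  that is ln t / b^\<beta>.\<close>

definition nbrs :: "(int ^ 'n::finite) set" where
  "nbrs = {e. nbr 0 e}"

lemma nbr_iff: "nbr x y \<longleftrightarrow> y - x \<in> nbrs"
  by (simp add: nbrs_def nbr_def)

text \<open>The squared coordinates are nonnegative integers with sum 1, so exactly one of them is
  1.\<close>

lemma nbrs_eq: "nbrs = (\<lambda>i. axis i 1) ` UNIV \<union> (\<lambda>i. axis i (-1)) ` (UNIV :: 'n::finite set)"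
proof (intro equalityI subsetI)
  fix e :: "int ^ 'n"
  assume "e \<in> nbrs"
  then have "norm (\<chi> i. real_of_int (e $ i)) = 1" by (simp add: nbrs_def nbr_def)
  then have "(norm (\<chi> i. real_of_int (e $ i)))\<^sup>2 = 1" by simp
  then have "(\<Sum>i\<in>UNIV. (real_of_int (e $ i))\<^sup>2) = 1"
    unfolding norm_vec_def L2_set_def by (simp add: sum_nonneg)
  then have "real_of_int (\<Sum>i\<in>UNIV. (e $ i)\<^sup>2) = real_of_int 1" by simp
  then have s: "(\<Sum>i\<in>UNIV. (e $ i)\<^sup>2) = 1" by (simp only: of_int_eq_iff)
  then obtain i where i: "e $ i \<noteq> 0" by (metis (no_types, lifting) power_zero_numeral sum.neutral zero_neq_one)
  have "(\<Sum>k\<in>UNIV. (e $ k)\<^sup>2) = (e $ i)\<^sup>2 + (\<Sum>k\<in>UNIV - {i}. (e $ k)\<^sup>2)"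
    by (simp add: sum.remove)
  moreover have "(\<Sum>k\<in>UNIV - {i}. (e $ k)\<^sup>2) \<ge> 0" by (simp add: sum_nonneg)
  moreover have "(e $ i)\<^sup>2 \<ge> 1"
    using i by (simp add: int_one_le_iff_zero_less)
  ultimately have 1: "(e $ i)\<^sup>2 = 1" and 0: "(\<Sum>k\<in>UNIV - {i}. (e $ k)\<^sup>2) = 0" using s by linarith+
  from 0 have z: "e $ k = 0" if "k \<noteq> i" for k using that by (subst (asm) sum_nonneg_eq_0_iff) auto
  from 1 have "e $ i = 1 \<or> e $ i = -1" by (simp add: power2_eq_1_iff)
  then have "e = axis i 1 \<or> e = axis i (-1)"
    using z by (auto simp: vec_eq_iff axis_def)
  then show "e \<in> (\<lambda>i. axis i 1) ` UNIV \<union> (\<lambda>i. axis i (-1)) ` UNIV" by auto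
next
  fix e :: "int ^ 'n"
  assume "e \<in> (\<lambda>i. axis i 1) ` UNIV \<union> (\<lambda>i. axis i (-1)) ` UNIV"
  then obtain i s where e: "e = axis i s" and s: "s = 1 \<or> s = -1" by auto
  have "(\<chi> k. real_of_int (e $ k)) = real_of_int s *\<^sub>R axis i 1"
    by (auto simp: e vec_eq_iff axis_def)
  then show "e \<in> nbrs" using s by (auto simp: nbrs_def nbr_def)
qed

lemma sum_nbrs: "(\<Sum>e\<in>nbrs. F e) = (\<Sum>i\<in>UNIV. F (axis (i::'n::finite) 1) + F (axis i (-1)))"
  for F :: "int ^ 'n \<Rightarrow> 'b::comm_monoid_add"
proof -
  have ne: "axis i 1 \<noteq> axis k (-1::int)" for i k :: 'n
    by (auto simp: axis_eq_axis)
  have inj: "inj (\<lambda>i::'n. axis i (c::int))" if "c \<noteq> 0" for c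
    using that by (auto simp: inj_def axis_eq_axis)
  have "(\<Sum>e\<in>nbrs. F e) = (\<Sum>e\<in>(\<lambda>i. axis i 1) ` UNIV. F e) + (\<Sum>e\<in>(\<lambda>i::'n. axis i (-1)) ` UNIV. F e)"
    unfolding nbrs_eq using ne by (intro sum.union_disjoint) (auto; blast)+
  also have "\<dots> = (\<Sum>i\<in>UNIV. F (axis (i::'n) 1)) + (\<Sum>i\<in>UNIV. F (axis i (-1)))"
    using inj[of 1] inj[of "-1"] by (simp add: sum.reindex)
  finally show ?thesis by (simp add: sum.distrib)
qed

lemma finite_nbrs [simp]: "finite nbrs"
  by (simp add: nbrs_eq)

lemma card_nbrs: "card (nbrs :: (int ^ 'n::finite) set) = 2 * CARD('n)"
proof -
  have "card (nbrs :: (int ^ 'n) set) = (\<Sum>e\<in>(nbrs :: (int ^ 'n) set). 1)" by simp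
  also have "\<dots> = 2 * CARD('n)" unfolding sum_nbrs by simp
  finally show ?thesis .
qed

lemma nbrs_nonempty [simp]: "nbrs \<noteq> {}"
  by (simp add: nbrs_eq)

lemma uminus_nbrs: "-e \<in> nbrs \<longleftrightarrow> e \<in> nbrs"
proof -
  have "norm (\<chi> i. - real_of_int (e $ i)) = norm (- (\<chi> i. real_of_int (e $ i)))"
    by (rule arg_cong[of _ _ norm]) (simp add: vec_eq_iff)
  then show ?thesis by (simp add: nbrs_def nbr_def)
qed

lemma zero_notin_nbrs [simp]: "0 \<notin> nbrs"
  by (auto simp: nbrs_eq axis_eq_0_iff)

lemma bij_uminus_nbrs: "bij_betw uminus nbrs nbrs"
  by (rule bij_betwI[where g = uminus]) (auto simp: uminus_nbrs)

section \<open>Steps, Poisson clock and semigroup property of the walk\<close>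

primrec rw :: "nat \<Rightarrow> (int ^ 'n::finite) pmf" where
  "rw 0 = return_pmf 0"
| "rw (Suc k) = bind_pmf (pmf_of_set nbrs) (\<lambda>e. map_pmf ((+) e) (rw k))"

text \<open>The parameter of \<open>poisson_pmf\<close> is positive, so time 0 gets the point mass
  at 0 as a case of its own; with it \<open>walk_add\<close> holds from time 0 on. Negative times
  share this default value.\<close>

definition pois :: "real \<Rightarrow> nat pmf" where
  "pois \<tau> = (if \<tau> > 0 then poisson_pmf \<tau> else return_pmf 0)"

text \<open>Jumps come at total rate 1, hence at rate 1 / (2 d) to each neighbour, as for a single
  particle under \<open>ssep_op\<close>.\<close>

definition walk :: "real \<Rightarrow> (int ^ 'n::finite) pmf" where
  "walk \<tau> = bind_pmf (pois \<tau>) rw"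

lemma pmf_pois: "\<tau> \<ge> 0 \<Longrightarrow> pmf (pois \<tau>) k = \<tau> ^ k / fact k * exp (-\<tau>)"
  by (cases k) (auto simp: pois_def indicator_def)

lemma walk_0 [simp]: "walk 0 = return_pmf 0"
  by (simp add: walk_def pois_def bind_return_pmf)

lemma rw_add:
  "rw (j + k) = bind_pmf (rw j) (\<lambda>x :: int ^ 'n::finite. map_pmf ((+) x) (rw k))"
proof (induction j)
  case 0
  have "(+) 0 = (\<lambda>x :: int ^ 'n. x)" by auto
  then show ?case by (simp add: bind_return_pmf)
next
  case (Suc j)
  show ?case
    by (simp add: Suc bind_assoc_pmf map_pmf_def bind_return_pmf add.assoc)
qed

lemma map_pmf_uminus_steps: "map_pmf uminus (pmf_of_set nbrs) = pmf_of_set nbrs"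
  by (rule map_pmf_of_set_bij_betw) (auto simp: bij_uminus_nbrs)

lemma rw_uminus: "map_pmf uminus (rw k) = (rw k :: (int ^ 'n::finite) pmf)"
proof (induction k)
  case (Suc k)
  have "map_pmf uminus (rw (Suc k) :: (int ^ 'n) pmf)
      = bind_pmf (map_pmf uminus (pmf_of_set nbrs)) (\<lambda>e. map_pmf ((+) e) (map_pmf uminus (rw k)))"
    by (simp add: map_bind_pmf bind_map_pmf pmf.map_comp o_def)
  also have "\<dots> = rw (Suc k)" unfolding map_pmf_uminus_steps by (simp add: Suc)
  finally show ?case .
qed simp

lemma walk_uminus: "map_pmf uminus (walk \<tau>) = walk \<tau>"
  by (simp add: walk_def map_bind_pmf rw_uminus)

text \<open>Up to the exponential factors this is the binomial theorem for
  \<open>(s + t) ^ n\<close>.\<close>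

lemma pois_add:
  assumes "s \<ge> 0" "t \<ge> 0"
  shows "pois (s + t) = bind_pmf (pois s) (\<lambda>j. map_pmf ((+) j) (pois t))"
proof (rule pmf_eqI)
  fix n
  have 1: "pmf (map_pmf ((+) j) (pois t)) n = (if j \<le> n then t ^ (n - j) / fact (n - j) * exp (-t) else 0)" for j
  proof (cases "j \<le> n")
    case True
    then have "pmf (map_pmf ((+) j) (pois t)) (j + (n - j)) = pmf (pois t) (n - j)"
      by (intro pmf_map_inj') auto
    with True show ?thesis using assms by (simp add: pmf_pois)
  next
    case False
    then show ?thesis by (auto intro!: pmf_map_outside)
  qed
  have "pmf (bind_pmf (pois s) (\<lambda>j. map_pmf ((+) j) (pois t))) n
     = (\<integral>j. (if j \<le> n then t ^ (n - j) / fact (n - j) * exp (-t) else 0) \<partial>pois s)"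
    by (simp add: pmf_bind 1)
  also have "\<dots> = (\<Sum>j\<le>n. (if j \<le> n then t ^ (n - j) / fact (n - j) * exp (-t) else 0) * pmf (pois s) j)"
    by (rule integral_measure_pmf_real) (auto split: if_splits)
  also have "\<dots> = (\<Sum>j\<le>n. (real (n choose j) * s ^ j * t ^ (n - j)) * (exp (-(s+t)) / fact n))"
    using assms by (intro sum.cong) (auto simp: pmf_pois binomial_fact mult_exp_exp field_simps)
  also have "\<dots> = (s + t) ^ n * (exp (-(s+t)) / fact n)"
    by (subst binomial_ring) (simp only: sum_distrib_right)
  also have "\<dots> = pmf (pois (s + t)) n" using assms by (simp add: pmf_pois)
  finally show "pmf (pois (s + t)) n = pmf (bind_pmf (pois s) (\<lambda>j. map_pmf ((+) j) (pois t))) n" by simp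
qed

text \<open>Given the two jump counts the displacements are independent; the Poisson draw of the
  second interval is commuted past the steps of the first.\<close>

lemma walk_add:
  assumes "s \<ge> 0" "t \<ge> 0"
  shows "walk (s + t) = bind_pmf (walk s) (\<lambda>x. map_pmf ((+) x) (walk t))"
proof -
  have "walk (s + t) = bind_pmf (pois s) (\<lambda>j. bind_pmf (pois t) (\<lambda>k. rw (j + k)))"
    unfolding walk_def pois_add[OF assms] by (simp add: bind_assoc_pmf bind_map_pmf)
  also have "\<dots> = bind_pmf (pois s) (\<lambda>j. bind_pmf (pois t) (\<lambda>k. bind_pmf (rw j) (\<lambda>x. map_pmf ((+) x) (rw k))))"
    by (simp add: rw_add)
  also have "\<dots> = bind_pmf (pois s) (\<lambda>j. bind_pmf (rw j) (\<lambda>x. bind_pmf (pois t) (\<lambda>k. map_pmf ((+) x) (rw k))))"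
    by (subst bind_commute_pmf) simp
  also have "\<dots> = bind_pmf (walk s) (\<lambda>x. map_pmf ((+) x) (walk t))"
    by (simp add: walk_def bind_assoc_pmf map_bind_pmf)
  finally show ?thesis .
qed

text \<open>No first hitting is meant: the walk from x is observed at the fixed time \<tau>. The
  kernel being symmetric, \<open>hit t A x\<close> is also the expected number of independent
  walkers at x at time t when one starts from each site of A. Both readings are used.\<close>

definition hit :: "real \<Rightarrow> (int ^ 'n::finite) set \<Rightarrow> int ^ 'n \<Rightarrow> real" where
  "hit \<tau> X x = measure (walk \<tau>) {v. x + v \<in> X}"

lemma hit_nonneg [simp]: "0 \<le> hit \<tau> X x" and hit_le_1 [simp]: "hit \<tau> X x \<le> 1"
  by (simp_all add: hit_def)

lemma hit_0: "hit 0 X x = indicator X x"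
  by (simp add: hit_def indicator_def measure_return_pmf)

lemma hit_mono: "X \<subseteq> Y \<Longrightarrow> hit \<tau> X x \<le> hit \<tau> Y x"
  unfolding hit_def by (intro measure_pmf.finite_measure_mono) auto

lemma hit_Un_le: "hit \<tau> (X \<union> Y) x \<le> hit \<tau> X x + hit \<tau> Y x"
proof -
  have "{v. x + v \<in> X \<union> Y} = {v. x + v \<in> X} \<union> {v. x + v \<in> Y}" by auto
  then show ?thesis unfolding hit_def by (simp add: measure_Un_le)
qed

lemma rw_measure_Suc:
  "measure (rw (Suc k)) X = (\<Sum>e\<in>nbrs. measure (rw k) {v. e + v \<in> X}) / (2 * CARD('n))"
  for X :: "(int ^ 'n::finite) set"
proof -
  have "emeasure (rw (Suc k)) X = (\<integral>\<^sup>+e. measure (rw k) {v. e + v \<in> X} \<partial>pmf_of_set nbrs)"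
    by (simp add: vimage_def flip: measure_pmf.emeasure_eq_measure)
  also have "\<dots> = ennreal ((\<Sum>e\<in>nbrs. measure (rw k) {v. e + v \<in> X}) / (2 * CARD('n)))"
    by (simp add: nn_integral_pmf_of_set card_nbrs sum_nonneg sum_ennreal flip: divide_ennreal)
       (simp add: ennreal_mult ennreal_of_nat_eq_real_of_nat)
  finally show ?thesis
    by (simp add: measure_pmf.emeasure_eq_measure sum_nonneg)
qed

lemma hit_sums:
  assumes "\<tau> \<ge> 0"
  shows "(\<lambda>k. \<tau> ^ k / fact k * exp (-\<tau>) * measure (rw k) {v. x + v \<in> X}) sums hit \<tau> X x"
proof -
  let ?f = "\<lambda>k. \<tau> ^ k / fact k * exp (-\<tau>) * measure (rw k) {v. x + v \<in> X}"
  have "ennreal (hit \<tau> X x) = (\<integral>\<^sup>+k. measure (rw k) {v. x + v \<in> X} \<partial>pois \<tau>)"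
    unfolding hit_def walk_def by (simp add: measure_pmf.emeasure_eq_measure flip: measure_pmf.emeasure_eq_measure)
  also have "\<dots> = (\<Sum>k. ennreal (?f k))"
    using assms
    by (simp add: nn_integral_measure_pmf nn_integral_count_space_nat pmf_pois flip: ennreal_mult)
  finally have eq: "(\<Sum>k. ennreal (?f k)) = ennreal (hit \<tau> X x)" ..
  show ?thesis
    using assms by (intro sums_ennreal[THEN iffD1]) (auto simp: eq[symmetric] intro!: summable_sums)
qed

text \<open>Kolmogorov's backward equation, by termwise differentiation of the Poisson series: the
  index shift made by \<open>diffs\<close> is one more step of the walk. The derivative is one-sided
  at 0 because the series represents \<open>hit\<close> for \<tau> \<ge> 0 only.\<close>

lemma hit_has_derivative:
  fixes X :: "(int ^ 'n::finite) set"
  assumes "\<tau> \<ge> 0"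
  shows "((\<lambda>\<tau>. hit \<tau> X x) has_real_derivative
           (\<Sum>e\<in>nbrs. hit \<tau> X (x + e)) / (2 * CARD('n)) - hit \<tau> X x) (at \<tau> within {0..})"
proof -
  define r where "r k = measure (rw k) {v. x + v \<in> X}" for k
  define c where "c k = r k / fact k" for k
  have r1: "\<bar>r k\<bar> \<le> 1" for k by (simp add: r_def)
  have sm: "summable (\<lambda>n. c n * y ^ n)" for y
  proof (rule summable_comparison_test')
    show "summable (\<lambda>n. \<bar>y\<bar> ^ n / fact n)" using summable_exp[of "\<bar>y\<bar>"] by (simp add: divide_inverse mult.commute)
    show "norm (c n * y ^ n) \<le> \<bar>y\<bar> ^ n / fact n" for n
      using mult_right_mono[OF r1[of n], of "\<bar>y\<bar> ^ n / fact n"] by (simp add: c_def abs_mult power_abs)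
  qed
  have eq: "hit y X x = exp (-y) * (\<Sum>n. c n * y ^ n)" if "y \<ge> 0" for y
  proof -
    have "(\<lambda>n. exp (-y) * (c n * y ^ n)) sums hit y X x"
      using hit_sums[OF that, of x X] by (simp add: c_def r_def mult_ac)
    moreover have "(\<lambda>n. exp (-y) * (c n * y ^ n)) sums (exp (-y) * (\<Sum>n. c n * y ^ n))"
      using sm by (intro sums_mult summable_sums)
    ultimately show ?thesis by (rule sums_unique2)
  qed
  have r_Suc: "r (Suc k) = (\<Sum>e\<in>nbrs. measure (rw k) {v. x + e + v \<in> X}) / (2 * CARD('n))" for k
    unfolding r_def rw_measure_Suc by (simp add: add_ac)
  have d: "diffs c n * \<tau> ^ n = r (Suc n) * (\<tau> ^ n / fact n)" for n
    by (simp add: diffs_def c_def field_simps del: of_nat_Suc)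
  have "(\<lambda>n. \<Sum>e\<in>nbrs. (\<tau> ^ n / fact n * exp (-\<tau>) * measure (rw n) {v. x + e + v \<in> X}) / (2 * CARD('n)))
        sums (\<Sum>e\<in>nbrs. hit \<tau> X (x + e) / (2 * CARD('n)))"
    using assms by (intro sums_sum sums_divide hit_sums)
  then have "(\<lambda>n. exp (-\<tau>) * (diffs c n * \<tau> ^ n)) sums ((\<Sum>e\<in>nbrs. hit \<tau> X (x + e)) / (2 * CARD('n)))"
    by (simp only: d r_Suc) (simp add: sum_divide_distrib sum_distrib_left sum_distrib_right mult_ac)
  then have s: "exp (-\<tau>) * (\<Sum>n. diffs c n * \<tau> ^ n) = (\<Sum>e\<in>nbrs. hit \<tau> X (x + e)) / (2 * CARD('n))"
    using sums_unique2 summable_sums[OF termdiff_converges_all[OF sm]] sums_mult by blast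
  have "((\<lambda>y. exp (-y) * (\<Sum>n. c n * y ^ n)) has_real_derivative
      exp (-\<tau>) * (\<Sum>n. diffs c n * \<tau> ^ n) + (exp (-\<tau>) * (-1)) * (\<Sum>n. c n * \<tau> ^ n)) (at \<tau> within {0..})"
    using sm
    by (auto intro!: derivative_eq_intros has_field_derivative_at_within[OF termdiffs_strong_converges_everywhere])
  then have "((\<lambda>y. exp (-y) * (\<Sum>n. c n * y ^ n)) has_real_derivative
      (\<Sum>e\<in>nbrs. hit \<tau> X (x + e)) / (2 * CARD('n)) - hit \<tau> X x) (at \<tau> within {0..})"
    using s eq[OF assms] by simp
  then show ?thesis
    by (rule has_field_derivative_transform_within[where d = 1]) (use assms in \<open>auto simp: eq\<close>)
qed

lemma finite_set_pmf_rw [simp]: "finite (set_pmf (rw k))"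
  by (induction k) (simp_all add: set_pmf_of_set)

text \<open>V collects the sites that fewer than K jumps can reach. Without the factor exp (-
  \<tau>) the Poisson tail is increasing in \<tau>, so one V serves all times up to t.\<close>

lemma walk_tight:
  assumes "\<epsilon> > 0" "t \<ge> 0"
  shows "\<exists>V :: (int ^ 'n::finite) set. finite V \<and> (\<forall>\<tau>\<in>{0..t}. measure (walk \<tau>) (- V) \<le> \<epsilon>)"
proof -
  have sm: "summable (\<lambda>n. t ^ n / fact n)"
    using summable_exp[of t] by (simp add: divide_inverse mult.commute)
  have "(\<lambda>K. \<Sum>n. t ^ (n + K) / fact (n + K)) \<longlonglongrightarrow> 0"
    by (rule suminf_exist_split2[OF sm])
  then have "eventually (\<lambda>K. (\<Sum>n. t ^ (n + K) / fact (n + K)) < \<epsilon>) sequentially"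
    using assms(1) by (rule order_tendstoD)
  then obtain K where K: "(\<Sum>n. t ^ (n + K) / fact (n + K)) < \<epsilon>"
    by (auto simp: eventually_sequentially)
  define V where "V = (\<Union>k<K. set_pmf (rw k :: (int ^ 'n) pmf))"
  have "measure (walk \<tau>) (- V) \<le> \<epsilon>" if \<tau>: "\<tau> \<in> {0..t}" for \<tau>
  proof -
    let ?f = "\<lambda>k. \<tau> ^ k / fact k * exp (-\<tau>) * measure (rw k) {v :: int ^ 'n. 0 + v \<in> - V}"
    have s: "?f sums hit \<tau> (- V) 0"
      using \<tau> by (intro hit_sums) auto
    have z: "?f k = 0" if "k < K" for k
    proof -
      have "measure (rw k) {v :: int ^ 'n. 0 + v \<in> - V} = 0"
        using that by (auto simp: measure_pmf_zero_iff V_def)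
      then show ?thesis by simp
    qed
    have *: "(\<lambda>n. ?f (n + K)) sums (hit \<tau> (- V) 0 - (\<Sum>i<K. ?f i))"
      using s by (rule sums_split_initial_segment)
    have s': "(\<lambda>n. ?f (n + K)) sums hit \<tau> (- V) 0"
    proof -
      have "(\<Sum>i<K. ?f i) = 0" using z by (intro sum.neutral) blast
      then show ?thesis using * by (simp only: diff_0_right)
    qed
    have "hit \<tau> (- V) 0 \<le> (\<Sum>n. t ^ (n + K) / fact (n + K))"
    proof (rule sums_le[OF _ s' summable_sums])
      show "summable (\<lambda>n. t ^ (n + K) / fact (n + K))"
        using sm by (rule summable_ignore_initial_segment)
      show "?f (n + K) \<le> t ^ (n + K) / fact (n + K)" for n
      proof -
        have "?f (n + K) \<le> \<tau> ^ (n + K) / fact (n + K) * 1 * 1"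
          using \<tau> by (intro mult_mono) auto
        also have "\<dots> \<le> t ^ (n + K) / fact (n + K)"
          using \<tau> by (simp add: divide_right_mono power_mono)
        finally show ?thesis .
      qed
    qed
    then show ?thesis using K by (simp add: hit_def Compl_eq)
  qed
  then show ?thesis by (intro exI[of _ V]) (auto simp: V_def)
qed

section \<open>Reversibility and the Chapman-Kolmogorov equation\<close>

lemma hit_eq_nn_integral:
  "ennreal (hit \<tau> X x) = (\<integral>\<^sup>+y. ennreal (pmf (walk \<tau>) (y - x)) * indicator X y \<partial>count_space UNIV)"
proof -
  have "ennreal (hit \<tau> X x) = (\<integral>\<^sup>+v. indicator X (x + v) \<partial>walk \<tau>)"
    unfolding hit_def measure_pmf.emeasure_eq_measure[symmetric]
    by (subst nn_integral_indicator[symmetric]) (auto intro!: nn_integral_cong simp del: nn_integral_indicator split: split_indicator)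
  also have "\<dots> = (\<integral>\<^sup>+v. ennreal (pmf (walk \<tau>) v) * indicator X (x + v) \<partial>count_space UNIV)"
    by (rule nn_integral_measure_pmf)
  also have "\<dots> = (\<integral>\<^sup>+y. ennreal (pmf (walk \<tau>) (y - x)) * indicator X (x + (y - x)) \<partial>count_space UNIV)"
    by (rule nn_integral_bij_count_space[symmetric, where g = "\<lambda>y. y - x"])
       (rule bij_betwI[where g = "\<lambda>v. v + x"], auto)
  finally show ?thesis by simp
qed

lemma pmf_walk_minus: "pmf (walk \<tau>) (y - x) = pmf (walk \<tau>) (x - y)"
proof -
  have "pmf (map_pmf uminus (walk \<tau>)) (- (x - y)) = pmf (walk \<tau>) (x - y)"
    by (rule pmf_map_inj') (auto simp: inj_def)
  then show ?thesis by (simp add: walk_uminus)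
qed

lemma hit_add:
  assumes "s \<ge> 0" "r \<ge> 0"
  shows "ennreal (hit (s + r) D x) =
    (\<integral>\<^sup>+y. ennreal (pmf (walk s) (y - x)) * ennreal (hit r D y) \<partial>count_space UNIV)"
proof -
  have "ennreal (hit (s + r) D x) = (\<integral>\<^sup>+u. ennreal (hit r D (x + u)) \<partial>walk s)"
    unfolding hit_def walk_add[OF assms] measure_pmf.emeasure_eq_measure[symmetric]
    by (simp add: vimage_def add.assoc)
  also have "\<dots> = (\<integral>\<^sup>+u. ennreal (pmf (walk s) u) * ennreal (hit r D (x + u)) \<partial>count_space UNIV)"
    by (rule nn_integral_measure_pmf)
  also have "\<dots> = (\<integral>\<^sup>+y. ennreal (pmf (walk s) (y - x)) * ennreal (hit r D (x + (y - x))) \<partial>count_space UNIV)"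
    by (rule nn_integral_bij_count_space[symmetric, where g = "\<lambda>y. y - x"])
       (rule bij_betwI[where g = "\<lambda>v. v + x"], auto)
  finally show ?thesis by simp
qed

lemma nn_integral_count_space_commute:
  "(\<integral>\<^sup>+x. \<integral>\<^sup>+y. f x y \<partial>count_space UNIV \<partial>count_space UNIV)
    = (\<integral>\<^sup>+y. \<integral>\<^sup>+x. f x y \<partial>count_space UNIV \<partial>count_space UNIV)"
  using nn_integral_fst_count_space[of "case_prod f"] nn_integral_snd_count_space[of "case_prod f"]
  by simp

text \<open>By symmetry the walk in the first factor can be run from its other end, and
  Chapman-Kolmogorov joins the two pieces. The result depends on s and r through s + r alone, so
  summing such products over space forgets where the time interval was split.\<close>

lemma nn_integral_hit_hit:
  assumes "s \<ge> 0" "r \<ge> 0"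
  shows "(\<integral>\<^sup>+x. ennreal (hit s A x) * ennreal (hit r D x) \<partial>count_space UNIV)
    = (\<integral>\<^sup>+a. indicator A a * ennreal (hit (s + r) D a) \<partial>count_space UNIV)"
proof -
  have "(\<integral>\<^sup>+x. ennreal (hit s A x) * ennreal (hit r D x) \<partial>count_space UNIV)
    = (\<integral>\<^sup>+x. \<integral>\<^sup>+a. indicator A a * (ennreal (pmf (walk s) (x - a)) * ennreal (hit r D x)) \<partial>count_space UNIV \<partial>count_space UNIV)"
    unfolding hit_eq_nn_integral[of s]
    by (simp add: nn_integral_multc[symmetric])
       (intro nn_integral_cong, subst pmf_walk_minus, simp add: mult_ac)
  also have "\<dots> = (\<integral>\<^sup>+a. indicator A a * ennreal (hit (s + r) D a) \<partial>count_space UNIV)"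
    by (subst nn_integral_count_space_commute) (simp add: hit_add[OF assms] nn_integral_cmult)
  finally show ?thesis .
qed

text \<open>Expected number in D at time t of independent walkers, one started from each site of A.
  The values are in \<open>ennreal\<close> because A, the initial configuration, is infinite, and D
  may be a whole half-space.\<close>

definition mass :: "real \<Rightarrow> (int ^ 'n::finite) set \<Rightarrow> (int ^ 'n) set \<Rightarrow> ennreal" where
  "mass t A D = (\<integral>\<^sup>+x. ennreal (hit t A x) * indicator D x \<partial>count_space UNIV)"

lemma mass_commute:
  assumes "t \<ge> 0"
  shows "mass t A D = (\<integral>\<^sup>+a. indicator A a * ennreal (hit t D a) \<partial>count_space UNIV)"
  using nn_integral_hit_hit[OF assms order_refl, of A D]
  by (simp add: mass_def hit_0 ennreal_indicator)

lemma mass_finite: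
  assumes "finite D"
  shows "mass t A D = ennreal (\<Sum>x\<in>D. hit t A x)"
proof -
  have "mass t A D = (\<integral>\<^sup>+x. ennreal (hit t A x) \<partial>count_space D)"
    by (simp add: mass_def nn_integral_count_space_indicator)
  then show ?thesis using assms by (simp add: nn_integral_count_space_finite sum_ennreal)
qed

lemma sum_hit_commute:
  assumes "finite F" "finite B" "t \<ge> 0"
  shows "(\<Sum>x\<in>F. hit t B x) = (\<Sum>b\<in>B. hit t F b)"
proof -
  have "ennreal (\<Sum>x\<in>F. hit t B x) = ennreal (\<Sum>b\<in>B. hit t F b)"
    using mass_finite[OF assms(1), of t B] mass_finite[OF assms(2), of t F]
      mass_commute[OF assms(3), of B F]
    by (simp add: mass_def mult.commute)
  then show ?thesis by (simp add: sum_nonneg)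
qed

lemma sum_hit_hit_le:
  assumes "finite \<Lambda>" "s \<ge> 0" "r \<ge> 0"
  shows "ennreal (\<Sum>x\<in>\<Lambda>. hit s A x * hit r D x) \<le> mass (s + r) A D"
proof -
  have "ennreal (\<Sum>x\<in>\<Lambda>. hit s A x * hit r D x) = (\<Sum>x\<in>\<Lambda>. ennreal (hit s A x) * ennreal (hit r D x))"
    by (simp add: sum_ennreal flip: ennreal_mult)
  also have "\<dots> = (\<integral>\<^sup>+x. ennreal (hit s A x) * ennreal (hit r D x) \<partial>count_space \<Lambda>)"
    using assms by (simp add: nn_integral_count_space_finite)
  also have "\<dots> \<le> (\<integral>\<^sup>+x. ennreal (hit s A x) * ennreal (hit r D x) \<partial>count_space UNIV)"
    by (subst nn_integral_count_space_indicator) (auto intro!: nn_integral_mono simp: indicator_def)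
  also have "\<dots> = mass (s + r) A D"
    using assms by (simp add: nn_integral_hit_hit mass_commute)
  finally show ?thesis .
qed

lemma mass_mono: "D \<subseteq> D' \<Longrightarrow> mass t A D \<le> mass t A D'"
  unfolding mass_def by (intro nn_integral_mono) (auto simp: indicator_def)

text \<open>One coordinate of the walk is a walk on the integers with jump rate 1 / d; this is its
  heat kernel. Its variance is \<tau> / d, whence the ratio \<open>\<tau> / real CARD('n)\<close> in
  what follows.\<close>

definition k1 :: "'n::finite \<Rightarrow> real \<Rightarrow> int \<Rightarrow> real" where
  "k1 j \<tau> n = measure (walk \<tau>) {v :: int ^ 'n. v $ j = n}"

lemma hit_layer: "hit \<tau> {v. v $ j = n} x = k1 j \<tau> (n - x $ j)"
  by (simp add: hit_def k1_def algebra_simps)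

lemma sum_nbrs_coord:
  fixes F :: "int \<Rightarrow> 'b::real_vector"
  shows "(\<Sum>e\<in>(nbrs :: (int ^ 'n::finite) set). F (e $ j)) = F 1 + F (-1) + (2 * (real CARD('n) - 1)) *\<^sub>R F 0"
proof -
  have "(\<Sum>e\<in>(nbrs :: (int ^ 'n) set). F (e $ j))
      = (\<Sum>i\<in>UNIV. F (axis i 1 $ j) + F (axis (i::'n) (-1) $ j))" by (rule sum_nbrs)
  also have "\<dots> = F 1 + F (-1) + (\<Sum>i\<in>UNIV - {j}. F 0 + F 0)"
    by (subst sum.remove[of _ j]) (auto simp: axis_def intro!: sum.cong)
  also have "(\<Sum>i\<in>UNIV - {j}. F 0 + F 0) = (2 * (real CARD('n) - 1)) *\<^sub>R F 0"
    by (simp add: sum_constant_scaleR card_Diff_singleton_if of_nat_diff algebra_simps flip: scaleR_2)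
  finally show ?thesis .
qed

lemma exp_coord_rw:
  "(\<integral>\<^sup>+v. ennreal (exp (\<rho> * real_of_int (v $ j))) \<partial>rw k)
    = ennreal ((1 + (cosh \<rho> - 1) / CARD('n)) ^ k)" for j :: "'n::finite"
proof (induction k)
  case (Suc k)
  have pos: "0 \<le> 1 + (cosh \<rho> - 1) / CARD('n)"
    using cosh_real_ge_1[of \<rho>] by (intro add_nonneg_nonneg) auto
  have "(\<integral>\<^sup>+v. ennreal (exp (\<rho> * real_of_int (v $ j))) \<partial>rw (Suc k))
     = (\<integral>\<^sup>+e. \<integral>\<^sup>+v. ennreal (exp (\<rho> * real_of_int (e $ j))) * ennreal (exp (\<rho> * real_of_int (v $ j))) \<partial>rw k \<partial>pmf_of_set (nbrs :: (int ^ 'n) set))"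
    by (simp add: distrib_left exp_add ennreal_mult)
  also have "\<dots> = (\<integral>\<^sup>+e. ennreal (exp (\<rho> * real_of_int (e $ j))) * ennreal ((1 + (cosh \<rho> - 1) / CARD('n)) ^ k) \<partial>pmf_of_set (nbrs :: (int ^ 'n) set))"
    by (simp add: nn_integral_cmult Suc)
  also have "\<dots> = ennreal ((\<Sum>e\<in>(nbrs :: (int ^ 'n) set). exp (\<rho> * real_of_int (e $ j))) / (2 * CARD('n)) * (1 + (cosh \<rho> - 1) / CARD('n)) ^ k)"
    using pos
    by (simp add: nn_integral_multc nn_integral_pmf_of_set card_nbrs sum_nonneg sum_ennreal ennreal_mult flip: divide_ennreal)
       (simp add: ennreal_mult ennreal_of_nat_eq_real_of_nat ennreal_divide_times ennreal_times_divide mult.commute)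
  also have "(\<Sum>e\<in>(nbrs :: (int ^ 'n) set). exp (\<rho> * real_of_int (e $ j))) / (2 * CARD('n)) = 1 + (cosh \<rho> - 1) / CARD('n)"
    using sum_nbrs_coord[of "\<lambda>i. exp (\<rho> * real_of_int i)" j] by (simp add: cosh_field_def field_simps)
  finally show ?case by simp
qed simp

lemma exp_coord_walk:
  fixes j :: "'n::finite"
  assumes "\<tau> \<ge> 0"
  shows "(\<integral>\<^sup>+v. ennreal (exp (\<rho> * real_of_int (v $ j))) \<partial>walk \<tau>)
    = ennreal (exp (\<tau> / CARD('n) * (cosh \<rho> - 1)))"
proof -
  define \<kappa> where "\<kappa> = 1 + (cosh \<rho> - 1) / CARD('n)"
  have \<kappa>: "\<kappa> \<ge> 0" unfolding \<kappa>_def using cosh_real_ge_1[of \<rho>] by (intro add_nonneg_nonneg) auto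
  have "(\<integral>\<^sup>+v. ennreal (exp (\<rho> * real_of_int (v $ j))) \<partial>walk \<tau>) = (\<integral>\<^sup>+k. ennreal (\<kappa> ^ k) \<partial>pois \<tau>)"
    unfolding walk_def by (simp add: exp_coord_rw \<kappa>_def)
  also have "\<dots> = (\<Sum>k. ennreal (exp (-\<tau>) * ((\<tau> * \<kappa>) ^ k / fact k)))"
    using assms \<kappa>
    by (simp add: nn_integral_measure_pmf nn_integral_count_space_nat pmf_pois power_mult_distrib mult_ac flip: ennreal_mult)
  also have "\<dots> = ennreal (exp (-\<tau>) * exp (\<tau> * \<kappa>))"
  proof (rule suminf_ennreal_eq)
    show "(\<lambda>k. exp (-\<tau>) * ((\<tau> * \<kappa>) ^ k / fact k)) sums (exp (-\<tau>) * exp (\<tau> * \<kappa>))"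
      using exp_converges[of "\<tau> * \<kappa>"] by (intro sums_mult) (simp add: divide_inverse mult.commute)
  qed (use assms \<kappa> in auto)
  also have "exp (-\<tau>) * exp (\<tau> * \<kappa>) = exp (\<tau> / CARD('n) * (cosh \<rho> - 1))"
    by (simp add: \<kappa>_def mult_exp_exp algebra_simps)
  finally show ?thesis .
qed

text \<open>Markov's inequality for the exponential of \<open>\<rho>\<close> times the coordinate.
  The hypothesis carries the factor \<open>\<rho>\<close> on both sides so that a negative tilt
  covers sets bounded above in that coordinate, such as the initial configuration.\<close>

lemma hit_chernoff:
  fixes j :: "'n::finite"
  assumes "\<tau> \<ge> 0" "\<And>v. v \<in> X \<Longrightarrow> \<rho> * real_of_int (v $ j) \<ge> \<rho> * c"
  shows "hit \<tau> X x \<le> exp (\<tau> / CARD('n) * (cosh \<rho> - 1) - \<rho> * (c - real_of_int (x $ j)))"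
proof -
  have "ennreal (hit \<tau> X x) = (\<integral>\<^sup>+v. indicator {v. x + v \<in> X} v \<partial>walk \<tau>)"
    by (simp add: hit_def measure_pmf.emeasure_eq_measure)
  also have "\<dots> \<le> (\<integral>\<^sup>+v. ennreal (exp (- \<rho> * (c - real_of_int (x $ j)))) * ennreal (exp (\<rho> * real_of_int (v $ j))) \<partial>walk \<tau>)"
  proof (rule nn_integral_mono)
    fix v
    have "exp (- \<rho> * (c - real_of_int (x $ j))) * exp (\<rho> * real_of_int (v $ j)) \<ge> 1" if "x + v \<in> X"
      using assms(2)[OF that] by (simp add: mult_exp_exp algebra_simps)
    then show "indicator {v. x + v \<in> X} v \<le> ennreal (exp (- \<rho> * (c - real_of_int (x $ j)))) * ennreal (exp (\<rho> * real_of_int (v $ j)))"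
      by (auto simp: indicator_def ennreal_mult[symmetric] simp del: mult_minus_left)
  qed
  also have "\<dots> = ennreal (exp (- \<rho> * (c - real_of_int (x $ j))) * exp (\<tau> / CARD('n) * (cosh \<rho> - 1)))"
    using assms(1) by (simp add: nn_integral_cmult exp_coord_walk ennreal_mult)
  finally show ?thesis by (simp add: mult_exp_exp add.commute)
qed

section \<open>Fourier representation of the tilted one-coordinate kernel\<close>

lemma sin_ge_half:
  fixes x :: real
  assumes "0 \<le> x" "x \<le> pi / 2"
  shows "x / 2 \<le> sin x"
proof (cases "x \<le> pi / 3")
  case True
  have "sin 0 - 0 / 2 \<le> sin x - x / 2"
  proof (rule DERIV_nonneg_imp_nondecreasing[OF assms(1)])
    fix y assume y: "0 \<le> y" "y \<le> x"
    have "cos (pi / 3) \<le> cos y" using y True by (intro cos_monotone_0_pi_le) auto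
    then show "\<exists>d. ((\<lambda>x. sin x - x / 2) has_real_derivative d) (at y) \<and> 0 \<le> d"
      by (intro exI[of _ "cos y - 1 / 2"] conjI) (auto intro!: derivative_eq_intros simp: cos_60)
  qed
  then show ?thesis by simp
next
  case False
  \<comment> \<open>Beyond pi / 3 the sine is at least sqrt 3 / 2 \<ge> 0.85, while x / 2 \<le> pi /
    4 < 0.8.\<close>
  have "sin (pi / 3) \<le> sin x" using False assms by (intro sin_monotone_2pi_le) auto
  moreover have "(1.7 :: real) \<le> sqrt 3" by (rule real_le_rsqrt) (simp add: power2_eq_square)
  moreover have "pi < 3.2" using pi_approx by simp
  ultimately show ?thesis using assms by (simp add: sin_60)
qed

lemma one_minus_cos_ge:
  fixes \<theta> :: real
  assumes "\<bar>\<theta>\<bar> \<le> pi"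
  shows "\<theta>\<^sup>2 / 8 \<le> 1 - cos \<theta>"
proof -
  have "\<bar>\<theta>\<bar> / 4 \<le> sin (\<bar>\<theta>\<bar> / 2)" using sin_ge_half[of "\<bar>\<theta>\<bar> / 2"] assms by simp
  then have "(\<bar>\<theta>\<bar> / 4)\<^sup>2 \<le> (sin (\<bar>\<theta>\<bar> / 2))\<^sup>2" by (intro power_mono) auto
  moreover have "cos \<theta> = 1 - 2 * (sin (\<bar>\<theta>\<bar> / 2))\<^sup>2"
    using cos_double_sin[of "\<bar>\<theta>\<bar> / 2"] by simp
  ultimately show ?thesis by (simp add: power_divide)
qed

text \<open>For a step +1 or -1 with equal probabilities this is the mean of exp ((\<rho> + i
  \<theta>) * step): a characteristic function with real tilt \<rho>.\<close>

definition symb :: "real \<Rightarrow> real \<Rightarrow> complex" where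
  "symb \<rho> \<theta> = cosh (Complex \<rho> \<theta>)"

lemma symb_eq: "symb \<rho> \<theta> = Complex (cosh \<rho> * cos \<theta>) (sinh \<rho> * sin \<theta>)"
proof -
  have "exp (Complex \<rho> \<theta>) = Complex (exp \<rho> * cos \<theta>) (exp \<rho> * sin \<theta>)"
    by (simp add: exp_eq_polar cis.code scaleR_conv_of_real[symmetric] complex_eq_iff)
  moreover have "exp (- Complex \<rho> \<theta>) = Complex (exp (-\<rho>) * cos \<theta>) (- exp (-\<rho>) * sin \<theta>)"
    by (simp add: exp_eq_polar cis.code scaleR_conv_of_real[symmetric] complex_eq_iff)
  ultimately show ?thesis
    by (simp add: symb_def cosh_field_def sinh_field_def complex_eq_iff field_simps)
qed

lemma symb_cis: "symb \<rho> \<theta> = (of_real (exp \<rho>) * cis \<theta> + of_real (exp (-\<rho>)) * cis (-\<theta>)) / 2"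
  by (simp add: symb_eq complex_eq_iff cosh_field_def sinh_field_def field_simps)

lemma continuous_on_symb [continuous_intros]: "continuous_on S (symb \<rho>)"
  unfolding symb_cis by (intro continuous_intros) auto

lemma integral_cis:
  "(LINT \<theta>:{-pi..pi}|lborel. cis (- (\<theta> * real_of_int n))) = (if n = 0 then complex_of_real (2 * pi) else 0)"
proof (cases "n = 0")
  case True
  then show ?thesis
    by (simp add: set_lebesgue_integral_def scaleR_conv_of_real)
next
  case False
  define F where "F \<theta> = (\<i> / of_int n) * cis (- (\<theta> * real_of_int n))" for \<theta>
  have "(LINT \<theta>:{-pi..pi}|lborel. cis (- (\<theta> * real_of_int n))) = F pi - F (-pi)"
    unfolding set_lebesgue_integral_def
  proof (rule integral_FTC_atLeastAtMost)
    fix x :: real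
    show "(F has_vector_derivative cis (- (x * real_of_int n))) (at x within {-pi..pi})"
    proof -
      have "((\<lambda>z. \<i> / of_int n * exp (- (\<i> * of_int n) * z)) has_field_derivative
          exp (- (\<i> * of_int n) * of_real x)) (at (of_real x))"
        using False by (auto intro!: derivative_eq_intros)
      from has_vector_derivative_real_field[OF this] show ?thesis
        by (simp add: F_def[abs_def] cis_conv_exp mult_ac)
    qed
  qed (auto intro!: continuous_intros)
  also have "F pi = F (-pi)"
    by (simp add: F_def complex_eq_iff cis.sel)
  finally show ?thesis using False by simp
qed


lemma set_integrable_cont:
  fixes f :: "real \<Rightarrow> complex"
  shows "continuous_on {a..b} f \<Longrightarrow> set_integrable lborel {a..b} f"
  by (rule borel_integrable_atLeastAtMost')

text \<open>The same for one coordinate of a step in dimension d, which moves with probability 1 / d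
  only.\<close>

definition rw_symb :: "real \<Rightarrow> real \<Rightarrow> real \<Rightarrow> complex" where
  "rw_symb d \<rho> \<theta> = 1 + (symb \<rho> \<theta> - 1) / of_real d"

lemma continuous_on_rw_symb [continuous_intros]: "continuous_on S (rw_symb d \<rho>)"
  unfolding rw_symb_def divide_inverse by (intro continuous_intros)

lemma rw_layer_Suc:
  "measure (rw (Suc k)) {v :: int ^ 'n::finite. v $ j = n} =
    (measure (rw k) {v :: int ^ 'n. v $ j = n - 1} + measure (rw k) {v :: int ^ 'n. v $ j = n + 1}
      + 2 * (real CARD('n) - 1) * measure (rw k) {v :: int ^ 'n. v $ j = n}) / (2 * CARD('n))"
proof -
  have eq: "{v :: int ^ 'n. e + v \<in> {v. v $ j = n}} = {v. v $ j = n - e $ j}" for e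
    by auto
  show ?thesis
    unfolding rw_measure_Suc eq
    by (subst sum_nbrs_coord[where F = "\<lambda>i. measure (rw k) {v :: int ^ 'n. v $ j = n - i}"]) simp
qed

text \<open>Fourier inversion with the contour shifted by \<rho>, proved by induction on k: one more
  factor of the symbol translates the frequency factor one unit up and one unit down, and this is
  the recursion \<open>rw_layer_Suc\<close> of the left side.\<close>

lemma rw_fourier:
  fixes j :: "'n::finite"
  shows "complex_of_real (measure (rw k) {v :: int ^ 'n. v $ j = n} * exp (\<rho> * real_of_int n)) =
    (LINT \<theta>:{-pi..pi}|lborel. rw_symb CARD('n) \<rho> \<theta> ^ k * cis (- (\<theta> * real_of_int n))) / of_real (2 * pi)"
proof (induction k arbitrary: n)
  case 0
  show ?case by (simp add: integral_cis measure_return_pmf indicator_def)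
next
  case (Suc k)
  let ?d = "complex_of_nat CARD('n)"
  let ?I = "\<lambda>n. (LINT \<theta>:{-pi..pi}|lborel. rw_symb CARD('n) \<rho> \<theta> ^ k * cis (- (\<theta> * real_of_int n)))"
  let ?m = "\<lambda>n. complex_of_real (measure (rw k) {v :: int ^ 'n. v $ j = n} * exp (\<rho> * real_of_int n))"
  have int: "set_integrable lborel {-pi..pi} (\<lambda>\<theta>. c * (rw_symb CARD('n) \<rho> \<theta> ^ k * cis (- (\<theta> * real_of_int n))))" for n c
    by (intro set_integrable_cont continuous_intros)
  have pt: "rw_symb CARD('n) \<rho> \<theta> ^ Suc k * cis (- (\<theta> * real_of_int n)) =
      of_real (exp \<rho>) / (2 * ?d) * (rw_symb CARD('n) \<rho> \<theta> ^ k * cis (- (\<theta> * real_of_int (n - 1))))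
      + of_real (exp (-\<rho>)) / (2 * ?d) * (rw_symb CARD('n) \<rho> \<theta> ^ k * cis (- (\<theta> * real_of_int (n + 1))))
      + (1 - 1 / ?d) * (rw_symb CARD('n) \<rho> \<theta> ^ k * cis (- (\<theta> * real_of_int n)))" for \<theta>
  proof -
    have 1: "cis (- (\<theta> * real_of_int (n - 1))) = cis \<theta> * cis (- (\<theta> * real_of_int n))"
      by (simp add: cis_mult algebra_simps)
    have 2: "cis (- (\<theta> * real_of_int (n + 1))) = cis (-\<theta>) * cis (- (\<theta> * real_of_int n))"
      by (simp add: cis_mult algebra_simps)
    have 3: "rw_symb CARD('n) \<rho> \<theta> = of_real (exp \<rho>) / (2 * ?d) * cis \<theta> + of_real (exp (-\<rho>)) / (2 * ?d) * cis (-\<theta>) + (1 - 1 / ?d)"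
      unfolding rw_symb_def symb_cis by (simp add: field_simps)
    show ?thesis unfolding 1 2 power_Suc by (subst 3) (simp add: algebra_simps)
  qed
  have "(LINT \<theta>:{-pi..pi}|lborel. rw_symb CARD('n) \<rho> \<theta> ^ Suc k * cis (- (\<theta> * real_of_int n)))
     = of_real (exp \<rho>) / (2 * ?d) * ?I (n - 1) + of_real (exp (-\<rho>)) / (2 * ?d) * ?I (n + 1) + (1 - 1 / ?d) * ?I n"
    unfolding pt
    by (subst set_integral_add set_integral_mult_right, (intro set_integral_add int)+)+ simp
  then have "(LINT \<theta>:{-pi..pi}|lborel. rw_symb CARD('n) \<rho> \<theta> ^ Suc k * cis (- (\<theta> * real_of_int n))) / of_real (2 * pi)
     = of_real (exp \<rho>) / (2 * ?d) * ?m (n - 1) + of_real (exp (-\<rho>)) / (2 * ?d) * ?m (n + 1) + (1 - 1 / ?d) * ?m n"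
    unfolding Suc by (simp only: add_divide_distrib times_divide_eq_right)
  also have "\<dots> = complex_of_real (exp \<rho> / (2 * real CARD('n)) * (measure (rw k) {v :: int ^ 'n. v $ j = n - 1} * exp (\<rho> * real_of_int (n - 1)))
      + exp (-\<rho>) / (2 * real CARD('n)) * (measure (rw k) {v :: int ^ 'n. v $ j = n + 1} * exp (\<rho> * real_of_int (n + 1)))
      + (1 - 1 / real CARD('n)) * (measure (rw k) {v :: int ^ 'n. v $ j = n} * exp (\<rho> * real_of_int n)))"
    by simp
  also have "\<dots> = complex_of_real (measure (rw (Suc k)) {v :: int ^ 'n. v $ j = n} * exp (\<rho> * real_of_int n))"
  proof -
    have e: "exp \<rho> * exp (\<rho> * real_of_int (n - 1)) = exp (\<rho> * real_of_int n)" "exp (-\<rho>) * exp (\<rho> * real_of_int (n + 1)) = exp (\<rho> * real_of_int n)"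
      by (simp_all add: mult_exp_exp algebra_simps)
    have a: "exp \<rho> / (2 * real CARD('n)) * (u * exp (\<rho> * real_of_int (n - 1))) = u * exp (\<rho> * real_of_int n) / (2 * real CARD('n))"
      "exp (-\<rho>) / (2 * real CARD('n)) * (u * exp (\<rho> * real_of_int (n + 1))) = u * exp (\<rho> * real_of_int n) / (2 * real CARD('n))" for u
      using e by (simp_all add: mult.left_commute mult.assoc[symmetric])
    show ?thesis unfolding rw_layer_Suc a by (simp add: field_simps)
  qed
  finally show ?case by simp
qed

text \<open>\<open>rw_fourier\<close> averaged over the Poisson number of steps. The exponential
  series with terms (\<tau> R)^k / k! majorises the integrands and justifies exchanging sum and
  integral.\<close>

lemma k1_fourier:
  fixes j :: "'n::finite"
  assumes "\<tau> \<ge> 0"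
  shows "complex_of_real (k1 j \<tau> n * exp (\<rho> * real_of_int n)) =
    (LINT \<theta>:{-pi..pi}|lborel. exp (of_real (\<tau> / CARD('n)) * (symb \<rho> \<theta> - 1)) * cis (- (\<theta> * real_of_int n))) / of_real (2 * pi)"
proof -
  \<comment> \<open>\<open>symb\<close> is bounded by cosh \<rho>, hence \<open>rw_symb\<close> by 1
    + (cosh \<rho> + 1).\<close>
  define R where "R = 2 + cosh \<rho>"
  have R: "norm (rw_symb CARD('n) \<rho> \<theta>) \<le> R" for \<theta>
  proof -
    have "norm (symb \<rho> \<theta>) \<le> cosh \<rho>"
      using norm_triangle_ineq[of "of_real (exp \<rho>) * cis \<theta>" "of_real (exp (-\<rho>)) * cis (-\<theta>)"]
      by (simp add: symb_cis cosh_field_def norm_divide norm_mult)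
    then have "norm (symb \<rho> \<theta> - 1) \<le> cosh \<rho> + 1" using norm_triangle_ineq4[of "symb \<rho> \<theta>" 1] by simp
    moreover have "norm ((symb \<rho> \<theta> - 1) / of_real CARD('n)) \<le> norm (symb \<rho> \<theta> - 1)"
      by (simp add: norm_divide divide_le_eq mult_le_cancel_left1 Suc_leI)
    ultimately show ?thesis unfolding rw_symb_def R_def
      using norm_triangle_ineq[of 1 "(symb \<rho> \<theta> - 1) / of_real CARD('n)"] by simp
  qed
  have R0: "R \<ge> 0" by (simp add: R_def)
  let ?g = "\<lambda>k \<theta>. of_real (\<tau> ^ k / fact k * exp (-\<tau>)) * (rw_symb CARD('n) \<rho> \<theta> ^ k * cis (- (\<theta> * real_of_int n)))"
  let ?f = "\<lambda>k \<theta>. indicator {-pi..pi} \<theta> *\<^sub>R ?g k \<theta>"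
  have sR: "summable (\<lambda>k. (\<tau> * R) ^ k / fact k)"
    using summable_exp[of "\<tau> * R"] by (simp add: divide_inverse mult.commute)
  have bnd: "norm (?g k \<theta>) \<le> (\<tau> * R) ^ k / fact k" for k \<theta>
  proof -
    have "norm (?g k \<theta>) = \<tau> ^ k / fact k * exp (-\<tau>) * norm (rw_symb CARD('n) \<rho> \<theta>) ^ k"
      using assms by (simp add: norm_mult norm_power norm_divide)
    also have "\<dots> \<le> \<tau> ^ k / fact k * 1 * R ^ k"
      using assms R[of \<theta>] R0 by (intro mult_mono power_mono) auto
    finally show ?thesis by (simp add: power_mult_distrib)
  qed
  have sums_pt: "(\<lambda>k. ?g k \<theta>) sums (exp (of_real (\<tau> / CARD('n)) * (symb \<rho> \<theta> - 1)) * cis (- (\<theta> * real_of_int n)))" for \<theta>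
  proof -
    have "(\<lambda>k. (of_real \<tau> * rw_symb CARD('n) \<rho> \<theta>) ^ k /\<^sub>R fact k) sums exp (of_real \<tau> * rw_symb CARD('n) \<rho> \<theta>)"
      by (rule exp_converges)
    from sums_mult2[OF sums_mult[OF this, of "of_real (exp (-\<tau>))"], of "cis (- (\<theta> * real_of_int n))"]
    have "(\<lambda>k. ?g k \<theta>) sums (of_real (exp (-\<tau>)) * exp (of_real \<tau> * rw_symb CARD('n) \<rho> \<theta>) * cis (- (\<theta> * real_of_int n)))"
      by (simp add: power_mult_distrib scaleR_conv_of_real field_simps)
    moreover have "of_real (exp (-\<tau>)) * exp (of_real \<tau> * rw_symb CARD('n) \<rho> \<theta>) = exp (of_real (\<tau> / CARD('n)) * (symb \<rho> \<theta> - 1))"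
      unfolding exp_of_real[symmetric] mult_exp_exp by (simp add: rw_symb_def algebra_simps)
    ultimately show ?thesis by simp
  qed
  have int: "integrable lborel (?f k)" for k
    by (rule set_integrable_cont[of "-pi" pi "?g k", unfolded set_integrable_def]) (intro continuous_intros)
  have fb: "norm (?f k \<theta>) \<le> (\<tau> * R) ^ k / fact k * indicator {-pi..pi} \<theta>" for k \<theta>
    using bnd[of k \<theta>] by (simp add: indicator_def)
  have "(\<lambda>k. integral\<^sup>L lborel (?f k)) sums (\<integral>\<theta>. (\<Sum>k. ?f k \<theta>) \<partial>lborel)"
  proof (rule sums_integral[OF int])
    show "AE \<theta> in lborel. summable (\<lambda>k. norm (?f k \<theta>))"
    proof (intro AE_I2 summable_comparison_test'[OF summable_mult2[OF sR]])
      show "norm (norm (?f k \<theta>)) \<le> (\<tau> * R) ^ k / fact k * indicator {-pi..pi} \<theta>" for k \<theta>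
        using fb[of \<theta> k] by simp
    qed
    show "summable (\<lambda>k. \<integral>\<theta>. norm (?f k \<theta>) \<partial>lborel)"
    proof (rule summable_comparison_test'[OF summable_mult2[OF sR, of "2 * pi"]])
      fix k
      have "(\<integral>\<theta>. norm (?f k \<theta>) \<partial>lborel) \<le> (\<integral>\<theta>. (\<tau> * R) ^ k / fact k * indicator {-pi..pi} \<theta> \<partial>lborel)"
        using int fb by (intro integral_mono integrable_norm) auto
      then show "norm (\<integral>\<theta>. norm (?f k \<theta>) \<partial>lborel) \<le> (\<tau> * R) ^ k / fact k * (2 * pi)"
        by simp
    qed
  qed
  moreover have "(\<Sum>k. ?f k \<theta>) = indicator {-pi..pi} \<theta> *\<^sub>R (exp (of_real (\<tau> / CARD('n)) * (symb \<rho> \<theta> - 1)) * cis (- (\<theta> * real_of_int n)))" for \<theta>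
    using sums_scaleR_right[OF sums_pt, THEN sums_unique, symmetric] .
  ultimately have 1: "(\<lambda>k. integral\<^sup>L lborel (?f k)) sums
     (LINT \<theta>:{-pi..pi}|lborel. exp (of_real (\<tau> / CARD('n)) * (symb \<rho> \<theta> - 1)) * cis (- (\<theta> * real_of_int n)))"
    by (simp add: set_lebesgue_integral_def)
  have 2: "integral\<^sup>L lborel (?f k) = of_real (2 * pi) * of_real (\<tau> ^ k / fact k * exp (-\<tau>) * measure (rw k) {v :: int ^ 'n. 0 + v \<in> {v. v $ j = n}} * exp (\<rho> * real_of_int n))" for k
  proof -
    have "integral\<^sup>L lborel (?f k) = of_real (\<tau> ^ k / fact k * exp (-\<tau>)) * (LINT \<theta>:{-pi..pi}|lborel. rw_symb CARD('n) \<rho> \<theta> ^ k * cis (- (\<theta> * real_of_int n)))"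
      unfolding set_lebesgue_integral_def by (subst integral_mult_right_zero[symmetric]) (simp only: mult_scaleR_right)
    also have "(LINT \<theta>:{-pi..pi}|lborel. rw_symb CARD('n) \<rho> \<theta> ^ k * cis (- (\<theta> * real_of_int n))) = of_real (2 * pi) * complex_of_real (measure (rw k) {v :: int ^ 'n. v $ j = n} * exp (\<rho> * real_of_int n))"
      unfolding rw_fourier by simp
    finally show ?thesis by (simp only: of_real_mult mult_ac add_0 mem_Collect_eq)
  qed
  have "(\<lambda>k. of_real (2 * pi) * of_real (\<tau> ^ k / fact k * exp (-\<tau>) * measure (rw k) {v :: int ^ 'n. 0 + v \<in> {v. v $ j = n}} * exp (\<rho> * real_of_int n)))
     sums (complex_of_real (2 * pi) * of_real (hit \<tau> {v. v $ j = n} 0 * exp (\<rho> * real_of_int n)))"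
    by (intro sums_mult sums_of_real sums_mult2 hit_sums assms)
  then have "complex_of_real (2 * pi) * of_real (hit \<tau> {v. v $ j = n} 0 * exp (\<rho> * real_of_int n))
    = (LINT \<theta>:{-pi..pi}|lborel. exp (of_real (\<tau> / CARD('n)) * (symb \<rho> \<theta> - 1)) * cis (- (\<theta> * real_of_int n)))"
    using 1 unfolding 2 by (rule sums_unique2)
  then show ?thesis by (simp add: hit_layer field_simps)
qed

section \<open>Heat kernel bounds for one coordinate\<close>

text \<open>Dividing by the moment generating function turns the left side into the law of the walk
  tilted by \<rho>. The integrand then has modulus at most 1, with value 1 at \<theta> = 0; the
  upper bound and the local limit theorem for \<open>k1\<close> both start from here.\<close>

lemma k1_tilt:
  fixes j :: "'n::finite" and \<rho> :: real
  defines "T \<equiv> \<lambda>\<tau>. \<tau> / real CARD('n)"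
  assumes "\<tau> \<ge> 0"
  shows "complex_of_real (k1 j \<tau> n * exp (\<rho> * real_of_int n - T \<tau> * (cosh \<rho> - 1))) =
    (LINT \<theta>:{-pi..pi}|lborel. exp (of_real (T \<tau>) * (symb \<rho> \<theta> - of_real (cosh \<rho>))) * cis (- (\<theta> * real_of_int n))) / of_real (2 * pi)"
proof -
  have *: "of_real (exp (- T \<tau> * (cosh \<rho> - 1))) * (exp (of_real (T \<tau>) * (symb \<rho> \<theta> - 1)) * cis (- (\<theta> * real_of_int n)))
     = exp (of_real (T \<tau>) * (symb \<rho> \<theta> - of_real (cosh \<rho>))) * cis (- (\<theta> * real_of_int n))" for \<theta>
    unfolding exp_of_real[symmetric] mult.assoc[symmetric] mult_exp_exp by (simp add: algebra_simps)
  have "complex_of_real (k1 j \<tau> n * exp (\<rho> * real_of_int n - T \<tau> * (cosh \<rho> - 1)))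
     = of_real (exp (- T \<tau> * (cosh \<rho> - 1))) * complex_of_real (k1 j \<tau> n * exp (\<rho> * real_of_int n))"
    by (simp add: exp_diff exp_minus divide_inverse)
  also have "\<dots> = (LINT \<theta>:{-pi..pi}|lborel. of_real (exp (- T \<tau> * (cosh \<rho> - 1))) * (exp (of_real (T \<tau>) * (symb \<rho> \<theta> - 1)) * cis (- (\<theta> * real_of_int n)))) / of_real (2 * pi)"
    unfolding k1_fourier[OF assms(2)] T_def by simp
  finally show ?thesis unfolding * .
qed

text \<open>The real part of the exponent is T * cosh \<rho> * (cos \<theta> - 1), and cosh \<rho>
  \<ge> 1 only improves it. So the Gaussian majorant is uniform in the tilt.\<close>

lemma norm_tilt_le:
  assumes "T \<ge> 0" "\<bar>\<theta>\<bar> \<le> pi"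
  shows "norm (exp (of_real T * (symb \<rho> \<theta> - of_real (cosh \<rho>)))) \<le> exp (- (T * \<theta>\<^sup>2 / 8))"
proof -
  have "T * \<theta>\<^sup>2 / 8 \<le> T * (1 * (1 - cos \<theta>))"
    using mult_left_mono[OF one_minus_cos_ge[OF assms(2)] assms(1)] by simp
  also have "\<dots> \<le> T * (cosh \<rho> * (1 - cos \<theta>))"
    using assms(1) cosh_real_ge_1[of \<rho>] by (intro mult_left_mono mult_right_mono) auto
  finally show ?thesis by (simp add: symb_eq algebra_simps)
qed

lemma integral_gaussian:
  assumes "c > 0"
  shows "integrable lborel (\<lambda>s. exp (- (c * s\<^sup>2)))" "(\<integral>s. exp (- (c * s\<^sup>2)) \<partial>lborel) = sqrt (pi / c)"
proof -
  define \<sigma> where "\<sigma> = sqrt (1 / (2 * c))"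
  have \<sigma>: "\<sigma> > 0" "\<sigma>\<^sup>2 = 1 / (2 * c)" using assms by (simp_all add: \<sigma>_def)
  have eq: "exp (- (c * s\<^sup>2)) = sqrt (pi / c) * normal_density 0 \<sigma> s" for s
    using assms by (simp add: normal_density_def \<sigma>(2) real_sqrt_divide)
  have "integrable lborel (normal_density 0 \<sigma>)" "(\<integral>x. normal_density 0 \<sigma> x \<partial>lborel) = 1"
    using \<sigma>(1) by auto
  then show "integrable lborel (\<lambda>s. exp (- (c * s\<^sup>2)))" "(\<integral>s. exp (- (c * s\<^sup>2)) \<partial>lborel) = sqrt (pi / c)"
    unfolding eq by auto
qed

text \<open>A Chernoff bound, valid for every tilt, improved by the local factor 1 / sqrt T that
  comes from integrating the Gaussian majorant.\<close>

lemma k1_le: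
  fixes j :: "'n::finite"
  assumes "\<tau> > 0"
  shows "k1 j \<tau> n \<le> exp (\<tau> / real CARD('n) * (cosh \<rho> - 1) - \<rho> * real_of_int n) / sqrt (\<tau> / real CARD('n))"
proof -
  define T where "T = \<tau> / real CARD('n)"
  have T: "T > 0" using assms by (simp add: T_def)
  let ?g = "\<lambda>\<theta>. exp (of_real T * (symb \<rho> \<theta> - of_real (cosh \<rho>))) * cis (- (\<theta> * real_of_int n))"
  have nn: "k1 j \<tau> n \<ge> 0" by (simp add: k1_def)
  have "k1 j \<tau> n * exp (\<rho> * real_of_int n - T * (cosh \<rho> - 1)) = norm (complex_of_real (k1 j \<tau> n * exp (\<rho> * real_of_int n - T * (cosh \<rho> - 1))))"
    unfolding norm_of_real using nn by simp
  also have "\<dots> = norm (LINT \<theta>:{-pi..pi}|lborel. ?g \<theta>) / (2 * pi)"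
    using k1_tilt[of \<tau> j n \<rho>] assms by (simp add: T_def norm_divide)
  also have "norm (LINT \<theta>:{-pi..pi}|lborel. ?g \<theta>) \<le> (\<integral>\<theta>. exp (- (T / 8 * \<theta>\<^sup>2)) \<partial>lborel)"
    unfolding set_lebesgue_integral_def
  proof (rule order_trans[OF integral_norm_bound integral_mono[OF integrable_norm]])
    show "integrable lborel (\<lambda>\<theta>. indicator {-pi..pi} \<theta> *\<^sub>R ?g \<theta>)"
      by (rule set_integrable_cont[of "-pi" pi ?g, unfolded set_integrable_def]) (intro continuous_intros)
    show "integrable lborel (\<lambda>\<theta>. exp (- (T / 8 * \<theta>\<^sup>2)))"
      using T by (intro integral_gaussian) auto
    show "norm (indicator {-pi..pi} \<theta> *\<^sub>R ?g \<theta>) \<le> exp (- (T / 8 * \<theta>\<^sup>2))" for \<theta>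
      using norm_tilt_le[of T \<theta> \<rho>] T by (auto simp: indicator_def norm_mult)
  qed
  also have "(\<integral>\<theta>. exp (- (T / 8 * \<theta>\<^sup>2)) \<partial>lborel) = sqrt (8 * pi) / sqrt T"
    using T by (subst integral_gaussian) (auto simp: real_sqrt_divide)
  also have "sqrt (8 * pi) / sqrt T / (2 * pi) \<le> 1 / sqrt T"
  proof -
    have "8 * pi \<le> (2 * pi)\<^sup>2" using pi_gt3 by (simp add: power2_eq_square)
    then have "sqrt (8 * pi) \<le> 2 * pi" by (rule real_le_lsqrt[rotated]) auto
    then show ?thesis using T by (simp add: field_simps)
  qed
  finally have "k1 j \<tau> n * exp (\<rho> * real_of_int n - T * (cosh \<rho> - 1)) \<le> 1 / sqrt T"
    by (simp add: divide_right_mono)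
  then have "k1 j \<tau> n * exp (\<rho> * real_of_int n - T * (cosh \<rho> - 1)) * exp (T * (cosh \<rho> - 1) - \<rho> * real_of_int n)
      \<le> 1 / sqrt T * exp (T * (cosh \<rho> - 1) - \<rho> * real_of_int n)"
    by (rule mult_right_mono) simp
  then show ?thesis by (simp add: T_def mult.assoc mult_exp_exp)
qed

text \<open>Local central limit theorem for the tilted walk, whose mean is
  \<open>T t * sinh (\<rho> t)\<close>. The second hypothesis places \<open>n t\<close> within
  o(sqrt T) of this mean, so the Gaussian density is evaluated at its peak.\<close>

lemma k1_local_limit:
  fixes j :: "'n::finite" and \<rho> :: "real \<Rightarrow> real" and n :: "real \<Rightarrow> int"
  defines "T \<equiv> \<lambda>t. t / real CARD('n)"
  assumes \<rho>: "(\<rho> \<longlongrightarrow> 0) at_top"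
    and n: "((\<lambda>t. (real_of_int (n t) - T t * sinh (\<rho> t)) / sqrt (T t)) \<longlongrightarrow> 0) at_top"
  shows "((\<lambda>t. sqrt (T t) * (k1 j t (n t) * exp (\<rho> t * real_of_int (n t) - T t * (cosh (\<rho> t) - 1))))
     \<longlongrightarrow> 1 / sqrt (2 * pi)) at_top"
proof -
  have Ttop: "filterlim T at_top at_top" unfolding T_def by real_asymp
  let ?g = "\<lambda>t \<theta>. exp (of_real (T t) * (symb (\<rho> t) \<theta> - of_real (cosh (\<rho> t)))) * cis (- (\<theta> * real_of_int (n t)))"
  let ?h = "\<lambda>t s. indicator {-pi..pi} (s / sqrt (T t)) *\<^sub>R ?g t (s / sqrt (T t))"
  have lim: "((\<lambda>t. \<integral>s. ?h t s \<partial>lborel) \<longlongrightarrow> (\<integral>s. complex_of_real (exp (- (1 / 2 * s\<^sup>2))) \<partial>lborel)) at_top"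
  proof (rule integral_dominated_convergence_at_top[where w = "\<lambda>s::real. exp (- (1 / 8 * s\<^sup>2))"])
    show "integrable lborel (\<lambda>s::real. exp (- (1 / 8 * s\<^sup>2)))" by (rule integral_gaussian) simp
    show "(\<lambda>s. complex_of_real (exp (- (1 / 2 * s\<^sup>2)))) \<in> borel_measurable lborel" by measurable
    show "?h t \<in> borel_measurable lborel" for t
    proof -
      have 1: "?g t \<in> borel_measurable borel"
        by (intro borel_measurable_continuous_onI continuous_intros)
      have "(\<lambda>s. ?g t (s / sqrt (T t))) \<in> borel_measurable borel"
        by (rule measurable_compose[OF _ 1]) measurable
      then show ?thesis by measurable
    qed
    show "\<forall>\<^sub>F t in at_top. AE s in lborel. norm (?h t s) \<le> exp (- (1 / 8 * s\<^sup>2))"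
      using eventually_gt_at_top[of 0]
    proof eventually_elim
      case (elim t)
      then have T: "T t > 0" by (simp add: T_def)
      have "norm (?h t s) \<le> exp (- (1 / 8 * s\<^sup>2))" for s
      proof (cases "s / sqrt (T t) \<in> {-pi..pi}")
        case True
        then have "norm (?g t (s / sqrt (T t))) \<le> exp (- (T t * (s / sqrt (T t))\<^sup>2 / 8))"
          using norm_tilt_le[of "T t" "s / sqrt (T t)" "\<rho> t"] T by (simp only: norm_mult norm_cis) auto
        then show ?thesis using True T by (simp add: power_divide)
      qed simp
      then show ?case by simp
    qed
    show "AE s in lborel. ((\<lambda>t. ?h t s) \<longlongrightarrow> complex_of_real (exp (- (1 / 2 * s\<^sup>2)))) at_top"
    proof (rule AE_I2)
      fix s :: real
      \<comment> \<open>Modulus and phase of the rescaled integrand. A tends to the Gaussian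
        exponent; in B the linear part of the sine is balanced by the centring of
        \<open>n t\<close>, which leaves the cubic remainder of the sine and the offset of
        \<open>n t\<close> from the mean.\<close>
      define A where "A t = T t * cosh (\<rho> t) * (cos (s / sqrt (T t)) - 1)" for t
      define B where "B t = T t * sinh (\<rho> t) * (sin (s / sqrt (T t)) - s / sqrt (T t)) - s * ((real_of_int (n t) - T t * sinh (\<rho> t)) / sqrt (T t))" for t
      have c1: "((\<lambda>t. T t * (cos (s / sqrt (T t)) - 1)) \<longlongrightarrow> - (1 / 2 * s\<^sup>2)) at_top"
      proof -
        have "((\<lambda>u. u * (cos (s / sqrt u) - 1)) \<longlongrightarrow> - (s * s / 2)) at_top" by real_asymp
        from filterlim_compose[OF this Ttop] show ?thesis by (simp add: power2_eq_square)
      qed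
      have c2: "((\<lambda>t. T t * (sin (s / sqrt (T t)) - s / sqrt (T t))) \<longlongrightarrow> 0) at_top"
      proof -
        have "((\<lambda>u. u * (sin (s / sqrt u) - s / sqrt u)) \<longlongrightarrow> 0) at_top" by real_asymp
        from filterlim_compose[OF this Ttop] show ?thesis .
      qed
      have ch: "((\<lambda>t. cosh (\<rho> t)) \<longlongrightarrow> 1) at_top" "((\<lambda>t. sinh (\<rho> t)) \<longlongrightarrow> 0) at_top"
        using tendsto_cosh[OF \<rho>] tendsto_sinh[OF \<rho>] by simp_all
      have A: "(A \<longlongrightarrow> - (1 / 2 * s\<^sup>2)) at_top"
        using tendsto_mult[OF ch(1) c1] by (simp add: A_def[abs_def] mult_ac power2_eq_square)
      have B: "(B \<longlongrightarrow> 0) at_top"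
        using tendsto_diff[OF tendsto_mult[OF ch(2) c2] tendsto_mult_left[OF n, of s]] by (simp add: B_def[abs_def] mult_ac)
      have eq: "?g t (s / sqrt (T t)) = of_real (exp (A t)) * cis (B t)" if "t > 0" for t
      proof -
        have "of_real (T t) * (symb (\<rho> t) (s / sqrt (T t)) - of_real (cosh (\<rho> t))) = Complex (A t) (T t * sinh (\<rho> t) * sin (s / sqrt (T t)))"
          by (simp add: symb_eq complex_eq_iff A_def algebra_simps)
        then have "?g t (s / sqrt (T t)) = of_real (exp (A t)) * (cis (T t * sinh (\<rho> t) * sin (s / sqrt (T t))) * cis (- (s / sqrt (T t) * real_of_int (n t))))"
          by (simp add: exp_eq_polar)
        also have "cis (T t * sinh (\<rho> t) * sin (s / sqrt (T t))) * cis (- (s / sqrt (T t) * real_of_int (n t))) = cis (B t)"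
          unfolding cis_mult B_def
            by (rule arg_cong[of _ _ cis]) (simp add: algebra_simps diff_divide_distrib)
        finally show ?thesis .
      qed
      have "((\<lambda>t. complex_of_real (exp (A t)) * cis (B t)) \<longlongrightarrow> complex_of_real (exp (- (1 / 2 * s\<^sup>2))) * cis 0) at_top"
        using A B by (intro tendsto_intros tendsto_cis)
      moreover have "\<forall>\<^sub>F t in at_top. complex_of_real (exp (A t)) * cis (B t) = ?h t s"
      proof -
        have "((\<lambda>u. s / sqrt u) \<longlongrightarrow> 0) at_top" by real_asymp
        from filterlim_compose[OF this Ttop] have z: "((\<lambda>t. s / sqrt (T t)) \<longlongrightarrow> 0) at_top" .
        have "\<forall>\<^sub>F t in at_top. s / sqrt (T t) < pi" "\<forall>\<^sub>F t in at_top. s / sqrt (T t) > - pi"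
          using order_tendstoD[OF z] by auto
        then show ?thesis using eventually_gt_at_top[of 0]
        proof eventually_elim
          case (elim t)
          then have "s / sqrt (T t) \<in> {-pi..pi}" by auto
          then show ?case unfolding eq[OF elim(3)] by (simp only: indicator_simps scaleR_one)
        qed
      qed
      ultimately show "((\<lambda>t. ?h t s) \<longlongrightarrow> complex_of_real (exp (- (1 / 2 * s\<^sup>2)))) at_top"
        by (simp add: filterlim_cong[OF refl refl])
    qed
  qed
  have "(\<integral>s. complex_of_real (exp (- (1 / 2 * s\<^sup>2))) \<partial>lborel) = of_real (sqrt (2 * pi))"
    using integral_gaussian(2)[of "1/2"] by (subst integral_complex_of_real) (simp add: mult.commute)
  with lim have lim2: "((\<lambda>t. (\<integral>s. ?h t s \<partial>lborel) / of_real (2 * pi)) \<longlongrightarrow> of_real (sqrt (2 * pi)) / of_real (2 * pi)) at_top"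
    by (auto intro!: tendsto_intros)
  have "\<forall>\<^sub>F t in at_top. (\<integral>s. ?h t s \<partial>lborel) / of_real (2 * pi) =
     complex_of_real (sqrt (T t) * (k1 j t (n t) * exp (\<rho> t * real_of_int (n t) - T t * (cosh (\<rho> t) - 1))))"
    using eventually_gt_at_top[of 0]
  proof eventually_elim
    case (elim t)
    then have T: "T t > 0" by (simp add: T_def)
    have "(LINT \<theta>:{-pi..pi}|lborel. ?g t \<theta>) = \<bar>1 / sqrt (T t)\<bar> *\<^sub>R (\<integral>s. ?h t s \<partial>lborel)"
      unfolding set_lebesgue_integral_def
      by (subst lborel_integral_real_affine[of "1 / sqrt (T t)" _ 0]) (use T in auto)
    then have "(\<integral>s. ?h t s \<partial>lborel) = of_real (sqrt (T t)) * (LINT \<theta>:{-pi..pi}|lborel. ?g t \<theta>)"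
      using T by (simp add: scaleR_conv_of_real)
    then show ?case
      using k1_tilt[of t j "n t" "\<rho> t"] elim by (simp add: T_def)
  qed
  with lim2 have "((\<lambda>t. complex_of_real (sqrt (T t) * (k1 j t (n t) * exp (\<rho> t * real_of_int (n t) - T t * (cosh (\<rho> t) - 1)))))
      \<longlongrightarrow> complex_of_real (sqrt (2 * pi) / (2 * pi))) at_top"
    by (simp add: filterlim_cong[OF refl refl])
  then have "((\<lambda>t. sqrt (T t) * (k1 j t (n t) * exp (\<rho> t * real_of_int (n t) - T t * (cosh (\<rho> t) - 1))))
      \<longlongrightarrow> sqrt (2 * pi) / (2 * pi)) at_top"
    by (simp only: tendsto_of_real_iff)
  also have "sqrt (2 * pi) / (2 * pi) = 1 / sqrt (2 * pi)"
    by (simp add: real_div_sqrt divide_simps)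
  finally show ?thesis .
qed

section \<open>Layers of the initial configuration\<close>

text \<open>For a nonnegative profile, the number of initial particles at height - k
  (\<open>card_layer\<close>).\<close>

definition layer_card :: "'n::finite \<Rightarrow> ('n \<Rightarrow> real \<Rightarrow> real) \<Rightarrow> nat \<Rightarrow> real" where
  "layer_card j g k = (\<Prod>i | i \<noteq> j. 2 * real_of_int \<lfloor>g i (real k)\<rfloor> + 1)"

lemma card_layer:
  fixes j :: "'n::finite"
  assumes "\<And>i. i \<noteq> j \<Longrightarrow> 0 \<le> g i (real k)"
  shows "finite {x \<in> {x. init_config j g x}. x $ j = - int k}"
    and "real (card {x \<in> {x. init_config j g x}. x $ j = - int k}) = layer_card j g k"
proof -
  define R where "R i = (if i = j then {- int k} else {- \<lfloor>g i (real k)\<rfloor>..\<lfloor>g i (real k)\<rfloor>})" for i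
  have eq: "{x \<in> {x. init_config j g x}. x $ j = - int k} = (\<lambda>f. \<chi> i. f i) ` (Pi\<^sub>E UNIV R)"
  proof (intro equalityI subsetI)
    fix x assume x: "x \<in> {x \<in> {x. init_config j g x}. x $ j = - int k}"
    then have "x $ i \<in> R i" for i
      by (auto simp: R_def init_config_def le_floor_iff abs_le_iff minus_le_iff floor_le_iff)
    then have "(\<lambda>i. x $ i) \<in> Pi\<^sub>E UNIV R" by auto
    moreover have "x = (\<chi> i. x $ i)" by simp
    ultimately show "x \<in> (\<lambda>f. \<chi> i. f i) ` (Pi\<^sub>E UNIV R)" by (metis imageI)
  next
    fix x assume "x \<in> (\<lambda>f. \<chi> i. f i) ` (Pi\<^sub>E UNIV R)"
    then have x: "x $ i \<in> R i" for i by auto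
    have j: "x $ j = - int k" using x[of j] by (simp add: R_def)
    have "\<bar>real_of_int (x $ i)\<bar> \<le> g i (real k)" if "i \<noteq> j" for i
    proof -
      have "\<bar>x $ i\<bar> \<le> \<lfloor>g i (real k)\<rfloor>" using x[of i] that by (auto simp: R_def abs_le_iff)
      then show ?thesis by (simp add: le_floor_iff)
    qed
    then show "x \<in> {x \<in> {x. init_config j g x}. x $ j = - int k}" using j by (simp add: init_config_def)
  qed
  have inj: "inj_on (\<lambda>f. \<chi> i. f i) (Pi\<^sub>E UNIV R)"
    by (auto simp: inj_on_def vec_eq_iff)
  show "finite {x \<in> {x. init_config j g x}. x $ j = - int k}"
    unfolding eq by (intro finite_imageI finite_PiE) (auto simp: R_def)
  have "real (card {x \<in> {x. init_config j g x}. x $ j = - int k}) = (\<Prod>i\<in>UNIV. real (card (R i)))"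
    unfolding eq card_image[OF inj] by (simp add: card_PiE)
  also have "\<dots> = (\<Prod>i | i \<noteq> j. real (card (R i)))"
    by (rule prod.mono_neutral_right) (auto simp: R_def)
  also have "\<dots> = layer_card j g k" unfolding layer_card_def
  proof (rule prod.cong[OF refl])
    fix i assume i: "i \<in> {i. i \<noteq> j}"
    then have "0 \<le> \<lfloor>g i (real k)\<rfloor>" using assms[of i] by simp
    then show "real (card (R i)) = 2 * real_of_int \<lfloor>g i (real k)\<rfloor> + 1"
      using i by (simp add: R_def)
  qed
  finally show "real (card {x \<in> {x. init_config j g x}. x $ j = - int k}) = layer_card j g k" .
qed

lemma layer_card_nonneg: "(\<And>i. i \<noteq> j \<Longrightarrow> 0 \<le> g i (real k)) \<Longrightarrow> 0 \<le> layer_card j g k"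
  unfolding layer_card_def by (intro prod_nonneg) (auto intro!: add_nonneg_nonneg)

lemma nn_integral_init_coord:
  fixes j :: "'n::finite" and h :: "int \<Rightarrow> ennreal"
  assumes g: "\<And>i k. i \<noteq> j \<Longrightarrow> 0 \<le> g i (real k)"
  shows "(\<integral>\<^sup>+a. indicator {x. init_config j g x} a * h (a $ j) \<partial>count_space UNIV)
    = (\<Sum>k. ennreal (layer_card j g k) * h (- int k))"
proof -
  define A where "A k = {x \<in> {x. init_config j g x}. x $ j = - int k}" for k
  have ind: "indicator {x. init_config j g x} a * h (a $ j) = (\<Sum>k. h (- int k) * indicator (A k) a)" for a
  proof (cases "init_config j g a")
    case True
    define k0 where "k0 = nat (- (a $ j))"
    have k0: "a $ j = - int k0" using True by (simp add: k0_def init_config_def)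
    have "(\<Sum>k. h (- int k) * indicator (A k) a) = (\<Sum>k\<in>{k0}. h (- int k) * indicator (A k) a)"
      by (rule suminf_finite) (auto simp: A_def k0)
    then show ?thesis using True k0 by (simp add: A_def)
  next
    case False
    then show ?thesis by (simp add: A_def)
  qed
  have "(\<integral>\<^sup>+a. indicator {x. init_config j g x} a * h (a $ j) \<partial>count_space UNIV)
     = (\<Sum>k. \<integral>\<^sup>+a. h (- int k) * indicator (A k) a \<partial>count_space UNIV)"
    unfolding ind by (rule nn_integral_suminf) auto
  also have "\<dots> = (\<Sum>k. ennreal (layer_card j g k) * h (- int k))"
  proof (rule suminf_cong)
    fix k
    have "(\<integral>\<^sup>+a. h (- int k) * indicator (A k) a \<partial>count_space UNIV) = h (- int k) * emeasure (count_space UNIV) (A k)"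
      by (rule nn_integral_cmult_indicator) auto
    also have "emeasure (count_space UNIV) (A k) = ennreal (layer_card j g k)"
      using card_layer[of j g k, OF g] by (simp add: emeasure_count_space_finite A_def ennreal_of_nat_eq_real_of_nat)
    finally show "(\<integral>\<^sup>+a. h (- int k) * indicator (A k) a \<partial>count_space UNIV) = ennreal (layer_card j g k) * h (- int k)"
      by (simp add: mult.commute)
  qed
  finally show ?thesis .
qed

text \<open>\<open>mass_commute\<close> follows each walker from its start; all sites of a layer are
  equally likely to end at height n.\<close>

lemma mass_layer:
  fixes j :: "'n::finite"
  assumes "\<And>i k. i \<noteq> j \<Longrightarrow> 0 \<le> g i (real k)" "t \<ge> 0"
  shows "mass t {x. init_config j g x} {v. v $ j = n} = (\<Sum>k. ennreal (layer_card j g k * k1 j t (n + int k)))"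
  unfolding mass_commute[OF assms(2)] hit_layer
  using nn_integral_init_coord[of j g "\<lambda>i. ennreal (k1 j t (n - i))"] assms(1)
  by (simp add: ennreal_mult' layer_card_nonneg k1_def)

text \<open>From the layer - k to the height n + 1 + m the distance is n + 1 + m + k. Grouping by i
  = m + k turns the double sum into a single one, with the kernel at n + i + 1 weighted by the
  number of sites in the layers 0, ..., i.\<close>

lemma mass_halfspace:
  fixes j :: "'n::finite"
  assumes g: "\<And>i k. i \<noteq> j \<Longrightarrow> 0 \<le> g i (real k)" and t: "t \<ge> 0"
  shows "mass t {x. init_config j g x} {v. v $ j > n}
     = (\<Sum>i. ennreal ((\<Sum>k<Suc i. layer_card j g k) * k1 j t (n + int (Suc i))))"
proof -
  let ?A = "{x. init_config j g x}"
  let ?L = "layer_card j g"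
  have L: "?L k \<ge> 0" for k by (intro layer_card_nonneg g)
  have k1: "k1 j t i \<ge> 0" for i by (simp add: k1_def)
  have ind: "ennreal (hit t ?A x) * indicator {v. v $ j > n} x = (\<Sum>m. ennreal (hit t ?A x) * indicator {v. v $ j = n + 1 + int m} x)" for x
  proof (cases "x $ j > n")
    case True
    define m0 where "m0 = nat (x $ j - n - 1)"
    have m0: "x $ j = n + 1 + int m0" using True by (simp add: m0_def)
    have "(\<Sum>m. ennreal (hit t ?A x) * indicator {v. v $ j = n + 1 + int m} x) = (\<Sum>m\<in>{m0}. ennreal (hit t ?A x) * indicator {v. v $ j = n + 1 + int m} x)"
      by (rule suminf_finite) (auto simp: m0)
    then show ?thesis using True m0 by simp
  next
    case False
    then show ?thesis by (simp add: indicator_def)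
  qed
  have "mass t ?A {v. v $ j > n} = (\<Sum>m. mass t ?A {v. v $ j = n + 1 + int m})"
    unfolding mass_def ind by (rule nn_integral_suminf) auto
  also have "\<dots> = (\<Sum>m. \<Sum>k. ennreal (?L k * k1 j t (n + 1 + int m + int k)))"
    by (simp add: mass_layer[of j g t, OF g t])
  also have "\<dots> = (\<integral>\<^sup>+m. \<integral>\<^sup>+k. ennreal (?L k * k1 j t (n + 1 + int m + int k)) \<partial>count_space UNIV \<partial>count_space UNIV)"
    by (simp add: nn_integral_count_space_nat)
  also have "\<dots> = (\<integral>\<^sup>+k. \<integral>\<^sup>+m. ennreal (?L k * k1 j t (n + 1 + int m + int k)) \<partial>count_space UNIV \<partial>count_space UNIV)"
    by (rule nn_integral_count_space_commute)
  also have "\<dots> = (\<integral>\<^sup>+k. \<integral>\<^sup>+i. ennreal (?L k * k1 j t (n + int (Suc i))) * indicator {k..} i \<partial>count_space UNIV \<partial>count_space UNIV)"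
  proof (rule nn_integral_cong)
    fix k :: nat
    have "(\<integral>\<^sup>+m. ennreal (?L k * k1 j t (n + 1 + int m + int k)) \<partial>count_space UNIV)
        = (\<integral>\<^sup>+m. ennreal (?L k * k1 j t (n + int (Suc (m + k)))) \<partial>count_space UNIV)"
      by (simp add: algebra_simps)
    also have "\<dots> = (\<integral>\<^sup>+i. ennreal (?L k * k1 j t (n + int (Suc i))) \<partial>count_space {k..})"
      by (rule nn_integral_bij_count_space[where g = "\<lambda>m. m + k"])
         (rule bij_betwI[where g = "\<lambda>i. i - k"], auto)
    finally show "(\<integral>\<^sup>+m. ennreal (?L k * k1 j t (n + 1 + int m + int k)) \<partial>count_space UNIV)
        = (\<integral>\<^sup>+i. ennreal (?L k * k1 j t (n + int (Suc i))) * indicator {k..} i \<partial>count_space UNIV)"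
      by (simp add: nn_integral_count_space_indicator)
  qed
  also have "\<dots> = (\<integral>\<^sup>+i. \<integral>\<^sup>+k. ennreal (?L k * k1 j t (n + int (Suc i))) * indicator {k..} i \<partial>count_space UNIV \<partial>count_space UNIV)"
    by (rule nn_integral_count_space_commute)
  also have "\<dots> = (\<integral>\<^sup>+i. ennreal ((\<Sum>k<Suc i. ?L k) * k1 j t (n + int (Suc i))) \<partial>count_space UNIV)"
  proof (rule nn_integral_cong)
    fix i :: nat
    have "(\<integral>\<^sup>+k. ennreal (?L k * k1 j t (n + int (Suc i))) * indicator {k..} i \<partial>count_space UNIV)
        = (\<integral>\<^sup>+k. ennreal (?L k * k1 j t (n + int (Suc i))) * indicator {..<Suc i} k \<partial>count_space UNIV)"
      by (intro nn_integral_cong) (auto simp: indicator_def)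
    also have "\<dots> = (\<Sum>k<Suc i. ennreal (?L k * k1 j t (n + int (Suc i))))"
      by (simp add: nn_integral_count_space_indicator[symmetric] nn_integral_count_space_finite)
    also have "\<dots> = ennreal ((\<Sum>k<Suc i. ?L k) * k1 j t (n + int (Suc i)))"
      using L k1 by (simp only: sum_ennreal mult_nonneg_nonneg sum_distrib_right)
    finally show "(\<integral>\<^sup>+k. ennreal (?L k * k1 j t (n + int (Suc i))) * indicator {k..} i \<partial>count_space UNIV)
        = ennreal ((\<Sum>k<Suc i. ?L k) * k1 j t (n + int (Suc i)))" .
  qed
  finally show ?thesis by (simp add: nn_integral_count_space_nat)
qed

lemma profile_nonneg: "0 \<le> c \<Longrightarrow> 0 \<le> r \<Longrightarrow> 0 \<le> profile c \<alpha> r u"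
  by (simp add: profile_def)

text \<open>A growing profile makes the rounding negligible, whereas a constant one (\<alpha> i = 0)
  keeps its integer part in the limit; hence the two kinds of factors.\<close>

lemma layer_card_asymp:
  fixes j :: "'n::finite"
  assumes c: "\<And>i. i \<noteq> j \<Longrightarrow> c i > 0" and \<alpha>: "\<And>i. i \<noteq> j \<Longrightarrow> \<alpha> i \<ge> 0"
  shows "(\<lambda>k. layer_card j (\<lambda>i. profile (c i) (\<alpha> i) (r i)) k / real k powr (\<Sum>i | i \<noteq> j. \<alpha> i))
    \<longlonglongrightarrow> (\<Prod>i | i \<noteq> j \<and> \<alpha> i = 0. 2 * real_of_int \<lfloor>c i + r i\<rfloor> + 1) * (\<Prod>i | i \<noteq> j \<and> \<alpha> i > 0. 2 * c i)"
proof -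
  define l where "l i = (if \<alpha> i = 0 then 2 * real_of_int \<lfloor>c i + r i\<rfloor> + 1 else 2 * c i)" for i
  define f where "f i k = (2 * real_of_int \<lfloor>profile (c i) (\<alpha> i) (r i) (real k)\<rfloor> + 1) / real k powr \<alpha> i" for i and k :: nat
  have "(\<lambda>k. f i k) \<longlonglongrightarrow> l i" if "i \<noteq> j" for i
  proof (cases "\<alpha> i = 0")
    case True
    have "\<forall>\<^sub>F k in sequentially. l i = f i k"
      using eventually_gt_at_top[of 0] by eventually_elim (simp add: f_def l_def True profile_def)
    then show ?thesis by (rule Lim_transform_eventually[OF tendsto_const])
  next
    case False
    then have a: "\<alpha> i > 0" using \<alpha>[OF that] by simp
    have lim: "(\<lambda>k. real k powr - \<alpha> i) \<longlonglongrightarrow> 0"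
      using a by real_asymp
    have lo: "(\<lambda>k. 2 * c i + (2 * r i - 1) * real k powr - \<alpha> i) \<longlonglongrightarrow> 2 * c i + (2 * r i - 1) * 0"
      by (intro tendsto_intros lim)
    have up: "(\<lambda>k. 2 * c i + (2 * r i + 1) * real k powr - \<alpha> i) \<longlonglongrightarrow> 2 * c i + (2 * r i + 1) * 0"
      by (intro tendsto_intros lim)
    have "\<forall>\<^sub>F k in sequentially. 2 * c i + (2 * r i - 1) * real k powr - \<alpha> i \<le> f i k"
      using eventually_gt_at_top[of 0]
    proof eventually_elim
      case (elim k)
      have "c i * real k powr \<alpha> i + r i - 1 \<le> real_of_int \<lfloor>c i * real k powr \<alpha> i + r i\<rfloor>" by linarith
      then have "2 * (c i * real k powr \<alpha> i) + (2 * r i - 1) \<le> 2 * real_of_int \<lfloor>c i * real k powr \<alpha> i + r i\<rfloor> + 1" by linarith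
      then have "(2 * (c i * real k powr \<alpha> i) + (2 * r i - 1)) / real k powr \<alpha> i \<le> f i k"
        unfolding f_def profile_def using False by (intro divide_right_mono) auto
      then show ?case using elim by (simp add: powr_minus field_simps)
    qed
    moreover have "\<forall>\<^sub>F k in sequentially. f i k \<le> 2 * c i + (2 * r i + 1) * real k powr - \<alpha> i"
      using eventually_gt_at_top[of 0]
    proof eventually_elim
      case (elim k)
      have "2 * real_of_int \<lfloor>c i * real k powr \<alpha> i + r i\<rfloor> + 1 \<le> 2 * (c i * real k powr \<alpha> i) + (2 * r i + 1)" by linarith
      then have "f i k \<le> (2 * (c i * real k powr \<alpha> i) + (2 * r i + 1)) / real k powr \<alpha> i"
        unfolding f_def profile_def using False by (intro divide_right_mono) auto
      then show ?case using elim by (simp add: powr_minus field_simps)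
    qed
    ultimately show ?thesis
      using tendsto_sandwich[OF _ _ lo[simplified] up[simplified]] False by (simp add: l_def)
  qed
  then have lim: "(\<lambda>k. \<Prod>i | i \<noteq> j. f i k) \<longlonglongrightarrow> (\<Prod>i | i \<noteq> j. l i)"
    by (intro tendsto_prod) auto
  have "\<forall>\<^sub>F k in sequentially. (\<Prod>i | i \<noteq> j. f i k) = layer_card j (\<lambda>i. profile (c i) (\<alpha> i) (r i)) k / real k powr (\<Sum>i | i \<noteq> j. \<alpha> i)"
    using eventually_gt_at_top[of 0]
    by eventually_elim (simp add: f_def layer_card_def prod_dividef powr_sum)
  with lim have "(\<lambda>k. layer_card j (\<lambda>i. profile (c i) (\<alpha> i) (r i)) k / real k powr (\<Sum>i | i \<noteq> j. \<alpha> i)) \<longlonglongrightarrow> (\<Prod>i | i \<noteq> j. l i)"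
    by (rule Lim_transform_eventually)
  also have "(\<Prod>i | i \<noteq> j. l i) = (\<Prod>i\<in>{i. i \<noteq> j \<and> \<alpha> i = 0} \<union> {i. i \<noteq> j \<and> \<alpha> i > 0}. l i)"
    using \<alpha> by (intro prod.cong) (auto simp: less_le)
  also have "\<dots> = (\<Prod>i | i \<noteq> j \<and> \<alpha> i = 0. l i) * (\<Prod>i | i \<noteq> j \<and> \<alpha> i > 0. l i)"
    by (rule prod.union_disjoint) auto
  also have "\<dots> = (\<Prod>i | i \<noteq> j \<and> \<alpha> i = 0. 2 * real_of_int \<lfloor>c i + r i\<rfloor> + 1) * (\<Prod>i | i \<noteq> j \<and> \<alpha> i > 0. 2 * c i)"
    by (intro arg_cong2[of _ _ _ _ "(*)"] prod.cong) (auto simp: l_def)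
  finally show ?thesis .
qed

section \<open>Asymptotics of the expected number of independent walks in the half-space\<close>

lemma has_bochner_integral_Gamma:
  fixes a c :: real
  assumes "a > -1" "c > 0"
  shows "has_bochner_integral lborel (\<lambda>y. indicator {0<..} y * (y powr a * exp (- (c * y)))) (Gamma (a + 1) / c powr (a + 1))"
proof -
  let ?f = "\<lambda>y. indicator {0<..} y * (y powr a * exp (- y)) :: real"
  have "(\<integral>\<^sup>+y. ennreal (y powr ((a + 1) - 1) / exp y) * indicator {0..} y \<partial>lborel) = ennreal (Gamma (a + 1))"
    using assms by (intro nn_integral_has_integral_lebesgue' Gamma_integral_real) auto
  also have "(\<integral>\<^sup>+y. ennreal (y powr ((a + 1) - 1) / exp y) * indicator {0..} y \<partial>lborel) = (\<integral>\<^sup>+y. ennreal (?f y) \<partial>lborel)"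
    by (intro nn_integral_cong) (auto simp: indicator_def exp_minus divide_inverse)
  finally have 1: "has_bochner_integral lborel ?f (Gamma (a + 1))"
    using assms by (intro has_bochner_integral_nn_integral) (auto intro!: Gamma_real_nonneg)
  have "has_bochner_integral lborel (\<lambda>y. ?f (0 + c * y)) (Gamma (a + 1) /\<^sub>R \<bar>c\<bar>)"
    using assms 1 by (intro lborel_has_bochner_integral_real_affine_iff[THEN iffD1, of c ?f _ 0]) (auto simp: scaleR_conv_of_real)
  then have 2: "has_bochner_integral lborel (\<lambda>y. ?f (0 + c * y) * c powr (- a)) (Gamma (a + 1) /\<^sub>R \<bar>c\<bar> * c powr (- a))"
    by (rule has_bochner_integral_mult_left)
  have eq1: "?f (0 + c * y) * c powr (- a) = indicator {0<..} y * (y powr a * exp (- (c * y)))" for y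
    using assms by (auto simp: indicator_def zero_less_mult_iff powr_mult powr_minus)
  have eq2: "Gamma (a + 1) /\<^sub>R \<bar>c\<bar> * c powr (- a) = Gamma (a + 1) / c powr (a + 1)"
    using assms by (simp add: powr_add powr_minus field_simps)
  show ?thesis using 2 unfolding eq1 eq2 .
qed

text \<open>Writes a series as the integral of a step function with cells of width 1 / b, so that
  limits of sums become instances of dominated convergence. Cells are open on the left, which is
  what the ceiling selects.\<close>

lemma suminf_eq_nn_integral_step:
  fixes F :: "nat \<Rightarrow> real"
  assumes b: "b > 0" and F: "\<And>i. 0 \<le> F i"
  shows "(\<Sum>i. ennreal (F (Suc i))) = (\<integral>\<^sup>+y. ennreal (indicator {0<..} y * (b * F (nat \<lceil>b * y\<rceil>))) \<partial>lborel)"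
proof -
  let ?I = "\<lambda>i. {real i / b<..real (Suc i) / b}"
  have "ennreal (indicator {0<..} y * (b * F (nat \<lceil>b * y\<rceil>))) = (\<Sum>i. ennreal (b * F (Suc i)) * indicator (?I i) y)" for y
  proof (cases "y > 0")
    case True
    define i0 where "i0 = nat \<lceil>b * y\<rceil> - 1"
    have pos: "\<lceil>b * y\<rceil> > 0" using True b by simp
    then have S: "nat \<lceil>b * y\<rceil> = Suc i0" unfolding i0_def by simp
    then have c: "\<lceil>b * y\<rceil> = int (Suc i0)" using pos by simp
    have mem: "y \<in> ?I i \<longleftrightarrow> i = i0" for i
    proof -
      have "y \<in> ?I i \<longleftrightarrow> real i < b * y \<and> b * y \<le> real (Suc i)"
        using b by (auto simp: field_simps)
      also have "\<dots> \<longleftrightarrow> \<lceil>b * y\<rceil> = int (Suc i)" by (subst ceiling_eq_iff) auto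
      finally show ?thesis unfolding c by auto
    qed
    define h where "h i = ennreal (b * F (Suc i)) * indicator (?I i) y" for i
    have "suminf h = (\<Sum>i\<in>{i0}. h i)"
    proof (rule suminf_finite)
      fix i assume "i \<notin> {i0}"
      then have "y \<notin> ?I i" using mem by blast
      then show "h i = 0" by (simp add: h_def)
    qed simp
    then have "suminf h = h i0" by simp
    then have "(\<Sum>i. ennreal (b * F (Suc i)) * indicator (?I i) y) = ennreal (b * F (Suc i0)) * indicator (?I i0) y"
      unfolding h_def .
    moreover have "indicator (?I i0) y = (1::ennreal)" using mem[of i0] by (simp only: indicator_simps)
    ultimately show ?thesis using True S by simp
  next
    case False
    then have "y \<notin> ?I i" for i using b by (auto simp: field_simps not_less) (meson less_le_trans linorder_not_less mult_nonneg_nonpos of_nat_0_le_iff order.strict_implies_order order.trans not_less)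
    then show ?thesis using False by simp
  qed
  then have "(\<integral>\<^sup>+y. ennreal (indicator {0<..} y * (b * F (nat \<lceil>b * y\<rceil>))) \<partial>lborel)
      = (\<integral>\<^sup>+y. (\<Sum>i. ennreal (b * F (Suc i)) * indicator (?I i) y) \<partial>lborel)"
    by simp
  also have "\<dots> = (\<Sum>i. \<integral>\<^sup>+y. ennreal (b * F (Suc i)) * indicator (?I i) y \<partial>lborel)"
    by (rule nn_integral_suminf) measurable
  also have "\<dots> = (\<Sum>i. ennreal (F (Suc i)))"
  proof (rule suminf_cong)
    fix i
    have "(\<integral>\<^sup>+y. ennreal (b * F (Suc i)) * indicator (?I i) y \<partial>lborel) = ennreal (b * F (Suc i)) * ennreal (real (Suc i) / b - real i / b)"
      using b by (subst nn_integral_cmult_indicator) (auto simp: field_simps)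
    also have "\<dots> = ennreal (F (Suc i))"
      using b F by (subst ennreal_mult[symmetric]) (auto simp: field_simps)
    finally show "(\<integral>\<^sup>+y. ennreal (b * F (Suc i)) * indicator (?I i) y \<partial>lborel) = ennreal (F (Suc i))" .
  qed
  finally show ?thesis ..
qed

lemma measurable_step [measurable]:
  fixes F :: "nat \<Rightarrow> real" and b :: real
  shows "(\<lambda>y. F (nat \<lceil>b * y\<rceil>)) \<in> borel_measurable borel"
proof -
  have "(\<lambda>y. \<lceil>b * y\<rceil>) \<in> measurable borel (count_space UNIV)" by measurable
  from measurable_compose[OF this, of "\<lambda>i. F (nat i)" borel] show ?thesis by simp
qed

text \<open>The normalised sum is a Riemann sum for C * y^\<gamma> on (0, 1]. The hypothesis divides
  by a power of \<open>Suc k\<close> so that boundedness of the quotients also bounds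
  \<open>K 0\<close>.\<close>

lemma sum_powr_asymp:
  fixes K :: "nat \<Rightarrow> real"
  assumes K: "\<And>k. 0 \<le> K k" and \<gamma>: "\<gamma> \<ge> 0" and lim: "(\<lambda>k. K k / real (Suc k) powr \<gamma>) \<longlonglongrightarrow> C"
  shows "(\<lambda>n. (\<Sum>k<n. K k) / real n powr (\<gamma> + 1)) \<longlonglongrightarrow> C / (\<gamma> + 1)"
proof -
  obtain C1 where C1: "\<And>k. \<bar>K k / real (Suc k) powr \<gamma>\<bar> \<le> C1"
    using convergent_imp_Bseq[OF convergentI[OF lim]] by (auto simp: Bseq_def)
  have KC: "K k \<le> C1 * real (Suc k) powr \<gamma>" for k
    using C1[of k] by (simp add: abs_le_iff divide_le_eq)
  have C1_0: "C1 \<ge> 0" using C1[of 0] by linarith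
  let ?f = "\<lambda>n y. indicator {0<..1} y * (K (nat \<lceil>real n * y\<rceil> - 1) / real n powr \<gamma>)"
  have "(\<lambda>n. \<integral>y. ?f n y \<partial>lborel) \<longlonglongrightarrow> (\<integral>y. indicator {0<..1} y * (C * y powr \<gamma>) \<partial>lborel)"
  proof (rule integral_dominated_convergence[where w = "\<lambda>y::real. indicator {0<..1} y * (C1 * 2 powr \<gamma>)"])
    show "(\<lambda>y. indicator {0<..1} y * (C * y powr \<gamma>)) \<in> borel_measurable lborel" by measurable
    show "?f n \<in> borel_measurable lborel" for n
      using measurable_step[of "\<lambda>i. K (i - 1)" "real n"] by measurable
    show "integrable lborel (\<lambda>y::real. indicator {0<..1} y * (C1 * 2 powr \<gamma>) :: real)"
      by (intro integrable_mult_left integrable_real_indicator) (simp_all add: emeasure_lborel_Ioc)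
    show "AE y in lborel. norm (?f n y) \<le> indicator {0<..1} y * (C1 * 2 powr \<gamma>)" for n
    proof (rule AE_I2)
      fix y
      show "norm (?f n y) \<le> indicator {0<..1} y * (C1 * 2 powr \<gamma>)"
      proof (cases "y \<in> {0<..1} \<and> n > 0")
        case True
        then have p: "\<lceil>real n * y\<rceil> > 0" by simp
        then have S: "real (Suc (nat \<lceil>real n * y\<rceil> - 1)) = real_of_int \<lceil>real n * y\<rceil>" by simp
        \<comment> \<open>The ceiling overshoots by at most 1 \<le> n, whence the factor
          \<open>2 powr \<gamma>\<close> in the majorant.\<close>
        have "real_of_int \<lceil>real n * y\<rceil> \<le> real n * y + 1" by linarith
        also have "\<dots> \<le> real n * 1 + real n" using True by (intro add_mono mult_left_mono) auto
        finally have "real_of_int \<lceil>real n * y\<rceil> powr \<gamma> \<le> (2 * real n) powr \<gamma>"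
          using p \<gamma> by (intro powr_mono2) auto
        then have "K (nat \<lceil>real n * y\<rceil> - 1) \<le> C1 * (2 * real n) powr \<gamma>"
          using KC[of "nat \<lceil>real n * y\<rceil> - 1"] C1_0 unfolding S by (meson mult_left_mono order_trans)
        then have "K (nat \<lceil>real n * y\<rceil> - 1) / real n powr \<gamma> \<le> C1 * 2 powr \<gamma>"
          using True by (simp add: powr_mult divide_le_eq)
        then show ?thesis using True K by simp
      qed (use C1_0 in \<open>auto simp: indicator_def\<close>)
    qed
    show "AE y in lborel. (\<lambda>n. ?f n y) \<longlonglongrightarrow> indicator {0<..1} y * (C * y powr \<gamma>)"
    proof (rule AE_I2)
      fix y :: real
      show "(\<lambda>n. ?f n y) \<longlonglongrightarrow> indicator {0<..1} y * (C * y powr \<gamma>)"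
      proof (cases "y \<in> {0<..1}")
        case True
        then have y: "y > 0" by simp
        define m where "m n = nat \<lceil>real n * y\<rceil> - 1" for n
        have ev: "\<forall>\<^sub>F n in sequentially. n > 0" by (rule eventually_gt_at_top)
        have S: "real (Suc (m n)) = real_of_int \<lceil>real n * y\<rceil>" if "n > 0" for n
        proof -
          have "\<lceil>real n * y\<rceil> > 0" using that y by simp
          then show ?thesis unfolding m_def by simp
        qed
        have ratio: "(\<lambda>n. real_of_int \<lceil>real n * y\<rceil> / real n) \<longlonglongrightarrow> y"
          using y by real_asymp
        have "filterlim (\<lambda>n. \<lceil>real n * y\<rceil>) at_top sequentially"
          using y by real_asymp
        then have "filterlim m at_top sequentially"
          unfolding m_def filterlim_at_top
        proof (intro allI)
          fix N :: nat assume "\<forall>Z. \<forall>\<^sub>F n in sequentially. Z \<le> \<lceil>real n * y\<rceil>"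
          then have "\<forall>\<^sub>F n in sequentially. int (Suc N) \<le> \<lceil>real n * y\<rceil>" by blast
          then show "\<forall>\<^sub>F n in sequentially. N \<le> nat \<lceil>real n * y\<rceil> - 1" by eventually_elim linarith
        qed
        from filterlim_compose[OF lim this] have 1: "(\<lambda>n. K (m n) / real (Suc (m n)) powr \<gamma>) \<longlonglongrightarrow> C" .
        have 2: "(\<lambda>n. (real_of_int \<lceil>real n * y\<rceil> / real n) powr \<gamma>) \<longlonglongrightarrow> y powr \<gamma>"
          using y by (intro tendsto_powr ratio tendsto_const) auto
        have "(\<lambda>n. K (m n) / real (Suc (m n)) powr \<gamma> * (real_of_int \<lceil>real n * y\<rceil> / real n) powr \<gamma>) \<longlonglongrightarrow> C * y powr \<gamma>"
          by (rule tendsto_mult[OF 1 2])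
        moreover have "\<forall>\<^sub>F n in sequentially. K (m n) / real (Suc (m n)) powr \<gamma> * (real_of_int \<lceil>real n * y\<rceil> / real n) powr \<gamma> = ?f n y"
          using ev
        proof eventually_elim
          case (elim n)
          have p: "real_of_int \<lceil>real n * y\<rceil> > 0" using elim y by simp
          have "K (m n) / c powr \<gamma> * (c / real n) powr \<gamma> = K (m n) / real n powr \<gamma>" if "c > 0" for c
            using that elim by (simp add: powr_divide)
          from this[OF p] show ?case unfolding S[OF elim] using True by (simp add: m_def)
        qed
        ultimately have "(\<lambda>n. ?f n y) \<longlonglongrightarrow> C * y powr \<gamma>" by (rule Lim_transform_eventually)
        then show ?thesis using True by simp
      qed simp
    qed
  qed
  moreover have "(\<integral>y. indicator {0<..1} y * (C * y powr \<gamma>) \<partial>lborel) = C / (\<gamma> + 1)"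
  proof -
    have "((\<lambda>y. y powr \<gamma>) has_integral (1 powr (\<gamma> + 1) / (\<gamma> + 1))) {0..1::real}"
      using \<gamma> by (intro has_integral_powr_from_0) auto
    then have "(\<integral>\<^sup>+y. ennreal (y powr \<gamma>) * indicator {0..1} y \<partial>lborel) = ennreal (1 / (\<gamma> + 1))"
      using nn_integral_has_integral_lebesgue'[of "{0..1::real}" "\<lambda>y. y powr \<gamma>"] by simp
    also have "(\<integral>\<^sup>+y. ennreal (y powr \<gamma>) * indicator {0..1} y \<partial>lborel) = (\<integral>\<^sup>+y. ennreal (indicator {0<..1} y * y powr \<gamma>) \<partial>lborel)"
      by (intro nn_integral_cong) (auto simp: indicator_def)
    finally have "has_bochner_integral lborel (\<lambda>y. indicator {0<..1} y * y powr \<gamma>) (1 / (\<gamma> + 1))"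
      using \<gamma> by (intro has_bochner_integral_nn_integral) auto
    from has_bochner_integral_mult_left[OF this, of C] have "has_bochner_integral lborel (\<lambda>y. indicator {0<..1} y * (C * y powr \<gamma>)) (1 / (\<gamma> + 1) * C)"
      by (simp add: mult_ac)
    then show ?thesis by (simp add: has_bochner_integral_integral_eq)
  qed
  moreover have "\<forall>\<^sub>F n in sequentially. (\<integral>y. ?f n y \<partial>lborel) = (\<Sum>k<n. K k) / real n powr (\<gamma> + 1)"
    using eventually_gt_at_top[of 0]
  proof eventually_elim
    case (elim n)
    \<comment> \<open>Summands extended by 0 beyond n, to bring the finite sum into the form of
      \<open>suminf_eq_nn_integral_step\<close>.\<close>
    define F where "F i = (if i \<in> {1..n} then K (i - 1) / real n powr (\<gamma> + 1) else 0)" for i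
    have F0: "F i \<ge> 0" for i using K by (simp add: F_def)
    have "(\<integral>\<^sup>+y. ennreal (?f n y) \<partial>lborel) = (\<integral>\<^sup>+y. ennreal (indicator {0<..} y * (real n * F (nat \<lceil>real n * y\<rceil>))) \<partial>lborel)"
    proof (rule nn_integral_cong)
      fix y
      show "ennreal (?f n y) = ennreal (indicator {0<..} y * (real n * F (nat \<lceil>real n * y\<rceil>)))"
      proof (cases "y > 0")
        case True
        have p: "\<lceil>real n * y\<rceil> > 0" using True elim by simp
        have "nat \<lceil>real n * y\<rceil> \<in> {1..n} \<longleftrightarrow> y \<le> 1"
        proof -
          have "nat \<lceil>real n * y\<rceil> \<in> {1..n} \<longleftrightarrow> \<lceil>real n * y\<rceil> \<le> int n" using p by (simp only: atLeastAtMost_iff) linarith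
          also have "\<dots> \<longleftrightarrow> real n * y \<le> real n * 1" by (simp add: ceiling_le_iff)
          also have "\<dots> \<longleftrightarrow> y \<le> 1" using elim by (simp only: mult_le_cancel_left_pos of_nat_0_less_iff)
          finally show ?thesis .
        qed
        then show ?thesis using True elim by (auto simp: F_def indicator_def powr_add field_simps)
      qed simp
    qed
    also have "\<dots> = (\<Sum>i. ennreal (F (Suc i)))"
      using elim F0 by (intro suminf_eq_nn_integral_step[symmetric]) auto
    also have "\<dots> = (\<Sum>i<n. ennreal (F (Suc i)))"
      by (rule suminf_finite) (auto simp: F_def)
    also have "\<dots> = ennreal ((\<Sum>k<n. K k) / real n powr (\<gamma> + 1))"
      using K by (subst sum_ennreal) (auto simp: F_def sum_divide_distrib)
    finally have "(\<integral>\<^sup>+y. ennreal (?f n y) \<partial>lborel) = ennreal ((\<Sum>k<n. K k) / real n powr (\<gamma> + 1))" .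
    then have "has_bochner_integral lborel (?f n) ((\<Sum>k<n. K k) / real n powr (\<gamma> + 1))"
      using K measurable_step[of "\<lambda>i. K (i - 1)" "real n"]
      by (intro has_bochner_integral_nn_integral) (auto intro!: sum_nonneg divide_nonneg_nonneg)
    then show ?case by (rule has_bochner_integral_integral_eq)
  qed
  ultimately show ?thesis by (simp add: Lim_transform_eventually)
qed

section \<open>The scaling constants and the saddle point\<close>

locale scaling =
  fixes d \<beta> x :: real
  assumes d: "d \<ge> 1" and \<beta>: "\<beta> \<ge> 1"
begin

text \<open>Variance of one coordinate of the walk at time t.\<close>

definition T :: "real \<Rightarrow> real" where "T t = t / d"
definition bb :: "real \<Rightarrow> real" where "bb t = (\<beta> * t / (d * ln t)) powr (1 / 2)"
definition aa :: "real \<Rightarrow> real" where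
  "aa t = ln (t / ((2 * pi) powr (1 / (2 * \<beta>)) * ln t powr ((\<beta> + 1) / (2 * \<beta>))))"
definition zz :: "real \<Rightarrow> real" where "zz t = bb t * (x + aa t)"
text \<open>Approximate minimiser of r |-> T * (cosh r - 1) - r * z at the level z; the exact one
  solves T * sinh r = z. The discrepancy is harmless by \<open>T_cosh\<close> and
  \<open>T_sinh\<close>.\<close>

definition \<rho> :: "real \<Rightarrow> real" where "\<rho> t = zz t / T t"

text \<open>In the variable s = ln t the level is s + w s in units of \<open>bb t\<close>: beyond
  its leading term, \<open>x + aa t\<close> is only logarithmic in s.\<close>

definition w :: "real \<Rightarrow> real" where
  "w s = x - ln (2 * pi) / (2 * \<beta>) - (\<beta> + 1) / (2 * \<beta>) * ln s"

lemma aa_eq: "t > 1 \<Longrightarrow> x + aa t = ln t + w (ln t)"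
  unfolding aa_def w_def by (subst ln_div) (auto simp: ln_mult ln_powr)

lemma bb_pos: "t > 1 \<Longrightarrow> bb t > 0"
  using d \<beta> by (simp add: bb_def)

lemma T_pos: "t > 0 \<Longrightarrow> T t > 0"
  using d by (simp add: T_def)

lemma bb_sq: "t > 1 \<Longrightarrow> (bb t)\<^sup>2 = \<beta> * T t / ln t"
  using d \<beta> by (simp add: bb_def T_def powr_half_sqrt field_simps)

lemma ln_bb: "t > 1 \<Longrightarrow> ln (bb t) = (ln \<beta> + ln t - ln d - ln (ln t)) / 2"
  using d \<beta> by (simp add: bb_def ln_powr ln_div ln_mult)

lemma ln_top: "filterlim (ln :: real \<Rightarrow> real) at_top at_top"
  by real_asymp

lemma w_form:
  obtains p g where "g > 0" "w = (\<lambda>s. p - g * ln s)"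
  using \<beta> by (intro that[of "(\<beta> + 1) / (2 * \<beta>)" "x - ln (2 * pi) / (2 * \<beta>)"]) (auto simp: w_def)

lemma w_lims: "((\<lambda>s. w s / s) \<longlongrightarrow> 0) at_top" "((\<lambda>s. (w s)\<^sup>2 / s) \<longlongrightarrow> 0) at_top"
proof -
  obtain p g where g: "g > 0" and w: "w = (\<lambda>s. p - g * ln s)" by (rule w_form)
  show "((\<lambda>s. w s / s) \<longlongrightarrow> 0) at_top" "((\<lambda>s. (w s)\<^sup>2 / s) \<longlongrightarrow> 0) at_top"
    unfolding w using g by real_asymp+
qed

text \<open>After heights are rescaled by \<open>bb t\<close>, the weight exp (- \<rho> k) becomes
  exp (- \<beta> y), the exponential of the Gamma integral. The reason is \<open>bb_sq\<close>, as
  \<open>x + aa t\<close> is asymptotic to ln t.\<close>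

lemma \<rho>_bb: "((\<lambda>t. \<rho> t * bb t) \<longlongrightarrow> \<beta>) at_top"
proof -
  have "((\<lambda>s. \<beta> * (1 + w s / s)) \<longlongrightarrow> \<beta> * (1 + 0)) at_top"
    by (intro tendsto_intros w_lims)
  from filterlim_compose[OF this ln_top] have "((\<lambda>t. \<beta> * (1 + w (ln t) / ln t)) \<longlongrightarrow> \<beta>) at_top" by simp
  moreover have "\<forall>\<^sub>F t in at_top. \<beta> * (1 + w (ln t) / ln t) = \<rho> t * bb t"
    using eventually_gt_at_top[of 1]
  proof eventually_elim
    case (elim t)
    have "\<rho> t * bb t = (bb t)\<^sup>2 * (x + aa t) / T t" by (simp add: \<rho>_def zz_def power2_eq_square)
    also have "\<dots> = \<beta> / ln t * (ln t + w (ln t))"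
      using elim T_pos[of t] by (simp add: bb_sq aa_eq)
    finally show ?case using elim by (simp add: field_simps)
  qed
  ultimately show ?thesis by (rule Lim_transform_eventually)
qed

lemma bb_top: "filterlim bb at_top at_top"
proof -
  have "filterlim (\<lambda>t. sqrt (\<beta> * t / (d * ln t))) at_top at_top"
    using d \<beta> by real_asymp
  moreover have "\<forall>\<^sub>F t in at_top. sqrt (\<beta> * t / (d * ln t)) = bb t"
    using eventually_gt_at_top[of 1]
    by eventually_elim (use d \<beta> in \<open>simp add: bb_def powr_half_sqrt\<close>)
  ultimately show ?thesis by (rule filterlim_mono_eventually[OF _ order_refl order_refl])
qed

text \<open>Heights of order \<open>bb t\<close> are o(sqrt T), so all layers that matter lie in the
  window of \<open>k1_local_limit\<close>.\<close>

lemma bb_T: "((\<lambda>t. bb t / sqrt (T t)) \<longlongrightarrow> 0) at_top"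
proof -
  have "((\<lambda>t. sqrt (\<beta> / ln t)) \<longlongrightarrow> 0) at_top" using \<beta> by real_asymp
  moreover have "\<forall>\<^sub>F t in at_top. sqrt (\<beta> / ln t) = bb t / sqrt (T t)"
    using eventually_gt_at_top[of 1]
  proof eventually_elim
    case (elim t)
    have "bb t = sqrt (\<beta> * T t / ln t)" using bb_sq[OF elim] bb_pos[OF elim] by (metis less_imp_le real_sqrt_unique)
    then show ?case using T_pos[of t] elim by (simp add: real_sqrt_divide real_sqrt_mult)
  qed
  ultimately show ?thesis by (rule Lim_transform_eventually)
qed

lemma \<rho>_sq: "t > 1 \<Longrightarrow> (\<rho> t)\<^sup>2 * T t = \<beta> * (ln t + w (ln t))\<^sup>2 / ln t"
proof -
  assume t: "t > 1"
  have "(\<rho> t)\<^sup>2 * T t = (bb t)\<^sup>2 * (x + aa t)\<^sup>2 / T t"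
    using T_pos[of t] t by (simp add: \<rho>_def zz_def power_mult_distrib power_divide power2_eq_square)
  then show ?thesis using T_pos[of t] t by (simp add: bb_sq aa_eq)
qed

lemma \<rho>_pos: "\<forall>\<^sub>F t in at_top. \<rho> t > 0"
proof -
  have "\<forall>\<^sub>F t in at_top. \<rho> t * bb t > 0" using \<beta> by (intro order_tendstoD(1)[OF \<rho>_bb]) auto
  then show ?thesis using eventually_gt_at_top[of 1]
    by eventually_elim (metis bb_pos less_asym' zero_less_mult_pos2)
qed

text \<open>This is the order of the error made by replacing cosh with its quadratic part. As
  \<open>(\<rho> t)\<^sup>2 * T t\<close> is of order ln t, it is of order (ln t)^2 / t.\<close>

lemma \<rho>_T4: "((\<lambda>t. T t * (\<rho> t)^4) \<longlongrightarrow> 0) at_top"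
proof -
  have "((\<lambda>s. (\<beta> * (s + w s)\<^sup>2 / s)\<^sup>2 * (d * exp (- s))) \<longlongrightarrow> 0) at_top"
  proof -
    obtain p g where g: "g > 0" and w: "w = (\<lambda>s. p - g * ln s)" by (rule w_form)
    show ?thesis unfolding w using g d \<beta> by real_asymp
  qed
  from filterlim_compose[OF this ln_top] have "((\<lambda>t. (\<beta> * (ln t + w (ln t))\<^sup>2 / ln t)\<^sup>2 * (d * exp (- ln t))) \<longlongrightarrow> 0) at_top" .
  moreover have "\<forall>\<^sub>F t in at_top. (\<beta> * (ln t + w (ln t))\<^sup>2 / ln t)\<^sup>2 * (d * exp (- ln t)) = T t * (\<rho> t)^4"
    using eventually_gt_at_top[of 1]
  proof eventually_elim
    case (elim t)
    show ?case unfolding \<rho>_sq[OF elim, symmetric] using elim d T_pos[of t]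
      by (simp add: exp_minus T_def power_mult_distrib field_simps power2_eq_square power4_eq_xxxx)
  qed
  ultimately show ?thesis by (rule Lim_transform_eventually)
qed

lemma T_top: "filterlim T at_top at_top"
  unfolding T_def using d by real_asymp

lemma \<rho>_0: "(\<rho> \<longlongrightarrow> 0) at_top"
proof -
  have "((\<lambda>t. \<rho> t * bb t * inverse (bb t)) \<longlongrightarrow> \<beta> * 0) at_top"
    by (intro tendsto_mult \<rho>_bb tendsto_inverse_0_at_top bb_top)
  moreover have "\<forall>\<^sub>F t in at_top. \<rho> t * bb t * inverse (bb t) = \<rho> t"
    using eventually_gt_at_top[of 1] by eventually_elim (use bb_pos in \<open>force simp: field_simps\<close>)
  ultimately show ?thesis using Lim_transform_eventually by fastforce
qed

lemma \<rho>_right: "filterlim \<rho> (at_right 0) at_top"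
  using \<rho>_0 \<rho>_pos by (simp add: filterlim_at eventually_mono)

lemma T_cosh: "((\<lambda>t. T t * (cosh (\<rho> t) - 1) - (\<rho> t)\<^sup>2 * T t / 2) \<longlongrightarrow> 0) at_top"
proof -
  have "((\<lambda>r :: real. (cosh r - 1 - r\<^sup>2 / 2) / r^4) \<longlongrightarrow> 1 / 24) (at_right 0)"
    by real_asymp
  from tendsto_mult[OF \<rho>_T4 filterlim_compose[OF this \<rho>_right]]
  have "((\<lambda>t. T t * \<rho> t ^ 4 * ((cosh (\<rho> t) - 1 - (\<rho> t)\<^sup>2 / 2) / \<rho> t ^ 4)) \<longlongrightarrow> 0) at_top" by simp
  moreover have "\<forall>\<^sub>F t in at_top. T t * \<rho> t ^ 4 * ((cosh (\<rho> t) - 1 - (\<rho> t)\<^sup>2 / 2) / \<rho> t ^ 4) = T t * (cosh (\<rho> t) - 1) - (\<rho> t)\<^sup>2 * T t / 2"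
    using \<rho>_pos by eventually_elim (simp add: field_simps)
  ultimately show ?thesis by (rule Lim_transform_eventually)
qed

text \<open>Puts the level within o(sqrt T) of the mean of the tilted walk, as
  \<open>k1_local_limit\<close> requires.\<close>

lemma T_sinh: "((\<lambda>t. (zz t - T t * sinh (\<rho> t)) / sqrt (T t)) \<longlongrightarrow> 0) at_top"
proof -
  have 1: "((\<lambda>r :: real. (r - sinh r) / r^3) \<longlongrightarrow> - 1 / 6) (at_right 0)"
    by real_asymp
  have "((\<lambda>t. sqrt (T t * \<rho> t ^ 4 * (\<rho> t)\<^sup>2)) \<longlongrightarrow> sqrt (0 * 0\<^sup>2)) at_top"
    by (intro tendsto_intros \<rho>_T4 \<rho>_0)
  from tendsto_mult[OF this filterlim_compose[OF 1 \<rho>_right]]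
  have "((\<lambda>t. sqrt (T t * \<rho> t ^ 4 * (\<rho> t)\<^sup>2) * ((\<rho> t - sinh (\<rho> t)) / \<rho> t ^ 3)) \<longlongrightarrow> 0) at_top" by simp
  moreover have "\<forall>\<^sub>F t in at_top. sqrt (T t * \<rho> t ^ 4 * (\<rho> t)\<^sup>2) * ((\<rho> t - sinh (\<rho> t)) / \<rho> t ^ 3) = (zz t - T t * sinh (\<rho> t)) / sqrt (T t)"
    using \<rho>_pos eventually_gt_at_top[of 1]
  proof eventually_elim
    case (elim t)
    have T: "T t > 0" using T_pos elim by simp
    have "\<rho> t ^ 4 * (\<rho> t)\<^sup>2 = (\<rho> t ^ 3)\<^sup>2" by (simp flip: power_add power_mult)
    then have "sqrt (T t * \<rho> t ^ 4 * (\<rho> t)\<^sup>2) = sqrt (T t) * sqrt ((\<rho> t ^ 3)\<^sup>2)"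
      by (simp only: mult.assoc real_sqrt_mult)
    then have "sqrt (T t * \<rho> t ^ 4 * (\<rho> t)\<^sup>2) = sqrt (T t) * \<rho> t ^ 3"
      using elim by (simp only: real_sqrt_abs) simp
    then have "sqrt (T t * \<rho> t ^ 4 * (\<rho> t)\<^sup>2) * ((\<rho> t - sinh (\<rho> t)) / \<rho> t ^ 3) = sqrt (T t) * (\<rho> t - sinh (\<rho> t))"
      using elim by simp
    also have "\<dots> = T t / sqrt (T t) * (\<rho> t - sinh (\<rho> t))" using T by (simp add: real_div_sqrt)
    also have "\<dots> = (zz t - T t * sinh (\<rho> t)) / sqrt (T t)" using T by (simp add: \<rho>_def right_diff_distrib diff_divide_distrib)
    finally show ?case .
  qed
  ultimately show ?thesis by (rule Lim_transform_eventually)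
qed

definition lead :: real where
  "lead = \<beta> powr ((\<beta> + 1) / 2) / d powr (\<beta> / 2) * exp (- \<beta> * x) * sqrt (2 * pi)"

text \<open>Here the form of \<open>aa\<close> is decided. With s = ln t the exponent is - \<beta> s
  / 2 - \<beta> w + o(1). The first term cancels the power t^(\<beta> / 2) left by
  \<open>bb t powr (\<beta> + 1) / sqrt (T t)\<close>; the second cancels the power of ln t and
  produces sqrt (2 pi) * exp (- \<beta> x).\<close>

lemma prefactor: "((\<lambda>t. bb t powr (\<beta> + 1) / sqrt (T t) * exp (- ((\<rho> t)\<^sup>2 * T t / 2))) \<longlongrightarrow> lead) at_top"
proof -
  have "((\<lambda>s. lead * exp (- (\<beta> / 2 * ((w s)\<^sup>2 / s)))) \<longlongrightarrow> lead * exp (- (\<beta> / 2 * 0))) at_top"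
    by (intro tendsto_intros w_lims)
  from filterlim_compose[OF this ln_top] have "((\<lambda>t. lead * exp (- (\<beta> / 2 * ((w (ln t))\<^sup>2 / ln t)))) \<longlongrightarrow> lead) at_top" by simp
  moreover have "\<forall>\<^sub>F t in at_top. lead * exp (- (\<beta> / 2 * ((w (ln t))\<^sup>2 / ln t))) = bb t powr (\<beta> + 1) / sqrt (T t) * exp (- ((\<rho> t)\<^sup>2 * T t / 2))"
    using eventually_gt_at_top[of 1]
  proof eventually_elim
    case (elim t)
    define s where "s = ln t"
    have s: "s > 0" using elim by (simp add: s_def)
    have T: "T t > 0" using T_pos elim by simp
    have lead: "lead = exp ((\<beta> + 1) / 2 * ln \<beta> - \<beta> / 2 * ln d - \<beta> * x + ln (2 * pi) / 2)"
    proof -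
      have h: "exp (ln (2 * pi) / 2) = sqrt (2 * pi)"
      proof -
        have a: "ln (2 * pi) / 2 = ln (sqrt (2 * pi))" using ln_sqrt[of "2 * pi"] by simp
        show ?thesis unfolding a by (rule exp_ln) simp
      qed
      show ?thesis
      proof -
        have "\<beta> powr ((\<beta> + 1) / 2) = exp ((\<beta> + 1) / 2 * ln \<beta>)" "d powr (\<beta> / 2) = exp (\<beta> / 2 * ln d)"
          using d \<beta> by (simp_all add: powr_def)
        moreover have "exp (- \<beta> * x) = inverse (exp (\<beta> * x))" by (simp add: exp_minus)
        ultimately show ?thesis unfolding lead_def exp_add exp_diff h by (simp only: divide_inverse)
      qed
    qed
    have "bb t powr (\<beta> + 1) = exp ((\<beta> + 1) * ((ln \<beta> + s - ln d - ln s) / 2))"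
      using bb_pos[OF elim] ln_bb[OF elim] by (simp add: powr_def s_def)
    moreover have "sqrt (T t) = exp ((s - ln d) / 2)"
    proof -
      have "ln (sqrt (T t)) = (s - ln d) / 2" using T elim d by (simp add: ln_sqrt T_def ln_div s_def)
      then show ?thesis using T by (metis exp_ln real_sqrt_gt_zero)
    qed
    ultimately have "bb t powr (\<beta> + 1) / sqrt (T t) * exp (- ((\<rho> t)\<^sup>2 * T t / 2))
       = exp ((\<beta> + 1) * ((ln \<beta> + s - ln d - ln s) / 2) - (s - ln d) / 2 - \<beta> * (s + w s)\<^sup>2 / s / 2)"
      unfolding \<rho>_sq[OF elim] s_def[symmetric] by (simp only: exp_diff exp_minus divide_inverse)
    also have "(\<beta> + 1) * ((ln \<beta> + s - ln d - ln s) / 2) - (s - ln d) / 2 - \<beta> * (s + w s)\<^sup>2 / s / 2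
       = ((\<beta> + 1) / 2 * ln \<beta> - \<beta> / 2 * ln d - \<beta> * x + ln (2 * pi) / 2) - (\<beta> / 2 * ((w s)\<^sup>2 / s))"
    proof -
      have "(s + w s)\<^sup>2 / s = s + 2 * w s + (w s)\<^sup>2 / s"
        using s by (simp add: power2_eq_square field_simps)
      then have "\<beta> * ((s + w s)\<^sup>2 / s) / 2 = \<beta> * (s + 2 * w s + (w s)\<^sup>2 / s) / 2" by (simp only:)
      then have e: "\<beta> * (s + w s)\<^sup>2 / s / 2 = \<beta> * s / 2 + \<beta> * w s + \<beta> / 2 * ((w s)\<^sup>2 / s)"
        by (simp add: distrib_left add_divide_distrib)
      have "\<beta> * w s = \<beta> * x - ln (2 * pi) / 2 - (\<beta> + 1) / 2 * ln s"
        using \<beta> by (simp add: w_def field_simps)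
      then show ?thesis unfolding e by (simp add: field_simps)
    qed
    finally show ?case unfolding lead s_def[symmetric] by (simp only: exp_diff exp_minus divide_inverse)
  qed
  ultimately show ?thesis by (rule Lim_transform_eventually)
qed

lemma gauss_0: "((\<lambda>t. exp (- ((\<rho> t)\<^sup>2 * T t / 2))) \<longlongrightarrow> 0) at_top"
proof -
  have "((\<lambda>s. exp (- (\<beta> * (s + w s)\<^sup>2 / s / 2))) \<longlongrightarrow> 0) at_top"
  proof -
    obtain p g where g: "g > 0" and w: "w = (\<lambda>s. p - g * ln s)" by (rule w_form)
    show ?thesis unfolding w using g \<beta> by real_asymp
  qed
  from filterlim_compose[OF this ln_top] have "((\<lambda>t. exp (- (\<beta> * (ln t + w (ln t))\<^sup>2 / ln t / 2))) \<longlongrightarrow> 0) at_top" .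
  moreover have "\<forall>\<^sub>F t in at_top. exp (- (\<beta> * (ln t + w (ln t))\<^sup>2 / ln t / 2)) = exp (- ((\<rho> t)\<^sup>2 * T t / 2))"
    using eventually_gt_at_top[of 1] by eventually_elim (simp add: \<rho>_sq)
  ultimately show ?thesis by (rule Lim_transform_eventually)
qed

text \<open>The rate of decay of the two-particle error. By \<open>prefactor\<close> the Gaussian
  weight is of order sqrt T / b^(\<beta> + 1) and by \<open>\<rho>_bb\<close> the tilt is of order 1
  / b, so the product is of order T * b^(- \<beta> - 2), which \<open>bb_sq\<close> turns into ln t
  * b^(- \<beta>).\<close>

lemma gauss_\<rho>_0: "((\<lambda>t. (exp (- ((\<rho> t)\<^sup>2 * T t / 2)))\<^sup>2 * \<rho> t powr (- \<beta>)) \<longlongrightarrow> 0) at_top"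
proof -
  have b: "((\<lambda>t. T t * bb t powr (- \<beta> - 2)) \<longlongrightarrow> 0) at_top"
  proof (rule tendsto_sandwich)
    show "\<forall>\<^sub>F t in at_top. 0 \<le> T t * bb t powr (- \<beta> - 2)"
      using eventually_gt_at_top[of 1] by eventually_elim (use T_pos in \<open>simp add: less_imp_le\<close>)
    have "\<forall>\<^sub>F t in at_top. bb t \<ge> 1" using bb_top by (simp add: filterlim_at_top)
    then show "\<forall>\<^sub>F t in at_top. T t * bb t powr (- \<beta> - 2) \<le> ln t / \<beta> * inverse (bb t)"
      using eventually_gt_at_top[of 1]
    proof eventually_elim
      case (elim t)
      have "bb t powr (- \<beta> - 2) \<le> bb t powr (- 3)" using elim \<beta> by (intro powr_mono) auto
      also have "\<dots> = inverse ((bb t)\<^sup>2) * inverse (bb t)"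
        using elim by (simp add: powr_minus powr_numeral power3_eq_cube power2_eq_square)
      finally have "T t * bb t powr (- \<beta> - 2) \<le> T t * (inverse ((bb t)\<^sup>2) * inverse (bb t))"
        using T_pos[of t] elim by (intro mult_left_mono) auto
      also have "\<dots> = ln t / \<beta> * inverse (bb t)"
        using T_pos[of t] elim \<beta> by (simp add: bb_sq)
      finally show ?case .
    qed
    have "((\<lambda>t. ln t / \<beta> * inverse (sqrt (\<beta> * t / (d * ln t)))) \<longlongrightarrow> 0) at_top"
      using d \<beta> by real_asymp
    moreover have "\<forall>\<^sub>F t in at_top. ln t / \<beta> * inverse (sqrt (\<beta> * t / (d * ln t))) = ln t / \<beta> * inverse (bb t)"
      using eventually_gt_at_top[of 1]
      by eventually_elim (use d \<beta> in \<open>simp add: bb_def powr_half_sqrt\<close>)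
    ultimately show "((\<lambda>t. ln t / \<beta> * inverse (bb t)) \<longlongrightarrow> 0) at_top" by (rule Lim_transform_eventually)
  qed simp
  have "((\<lambda>t. (\<rho> t * bb t) powr (- \<beta>) * (bb t powr (\<beta> + 1) / sqrt (T t) * exp (- ((\<rho> t)\<^sup>2 * T t / 2)))\<^sup>2 * (T t * bb t powr (- \<beta> - 2)))
      \<longlongrightarrow> \<beta> powr (- \<beta>) * lead\<^sup>2 * 0) at_top"
    using \<beta> by (intro tendsto_mult tendsto_powr \<rho>_bb tendsto_power prefactor b tendsto_const) auto
  moreover have "\<forall>\<^sub>F t in at_top. (\<rho> t * bb t) powr (- \<beta>) * (bb t powr (\<beta> + 1) / sqrt (T t) * exp (- ((\<rho> t)\<^sup>2 * T t / 2)))\<^sup>2 * (T t * bb t powr (- \<beta> - 2))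
      = (exp (- ((\<rho> t)\<^sup>2 * T t / 2)))\<^sup>2 * \<rho> t powr (- \<beta>)"
    using eventually_gt_at_top[of 1] \<rho>_pos
  proof eventually_elim
    case (elim t)
    have b: "bb t > 0" using bb_pos elim by simp
    have T: "T t > 0" using T_pos elim by simp
    have "bb t powr (- \<beta>) * (bb t powr (\<beta> + 1))\<^sup>2 * bb t powr (- \<beta> - 2) = 1"
      using b by (simp add: power2_eq_square powr_add[symmetric])
    moreover have "(\<rho> t * bb t) powr (- \<beta>) * (bb t powr (\<beta> + 1) / sqrt (T t) * exp (- ((\<rho> t)\<^sup>2 * T t / 2)))\<^sup>2 * (T t * bb t powr (- \<beta> - 2))
       = (bb t powr (- \<beta>) * (bb t powr (\<beta> + 1))\<^sup>2 * bb t powr (- \<beta> - 2)) * ((exp (- ((\<rho> t)\<^sup>2 * T t / 2)))\<^sup>2 * \<rho> t powr (- \<beta>))"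
      using b T elim by (simp add: powr_mult power_mult_distrib power_divide)
    ultimately show ?case by simp
  qed
  ultimately show ?thesis using Lim_transform_eventually by fastforce
qed

end

section \<open>Sums over the layers at the critical level\<close>

lemma exp_minus_le_quadratic:
  fixes x :: real
  assumes "0 \<le> x"
  shows "exp (- x) \<le> 1 - x + x\<^sup>2 / 2"
proof -
  have "(1 - 0 + 0\<^sup>2 / 2) - exp (- 0) \<le> (1 - x + x\<^sup>2 / 2) - exp (- x)"
  proof (rule DERIV_nonneg_imp_nondecreasing[OF assms])
    fix y :: real
    show "\<exists>d. ((\<lambda>x. (1 - x + x\<^sup>2 / 2) - exp (- x)) has_real_derivative d) (at y) \<and> 0 \<le> d"
      using exp_ge_add_one_self[of "- y"]
      by (intro exI[of _ "- 1 + y + exp (- y)"] conjI) (auto intro!: derivative_eq_intros)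
  qed
  then show ?thesis by simp
qed

lemma powr_le_exp_half:
  fixes u \<gamma> :: real
  assumes "u > 0" "\<gamma> \<ge> 0"
  shows "u powr \<gamma> \<le> (2 * \<gamma> + 1) powr \<gamma> * exp (u / 2)"
proof -
  define v where "v = u / (2 * \<gamma> + 1)"
  have v: "v > 0" "u = (2 * \<gamma> + 1) * v" using assms by (simp_all add: v_def)
  have "v powr \<gamma> \<le> exp (\<gamma> * v)"
    using v(1) assms ln_le_minus_one[of v] by (simp add: powr_def mult_left_mono)
  also have "\<gamma> * v \<le> u / 2" using v assms by (simp add: algebra_simps)
  finally have "v powr \<gamma> \<le> exp (u / 2)" by simp
  then show ?thesis unfolding v(2) using assms v by (simp add: powr_mult mult_left_mono)
qed

text \<open>Half of the exponential absorbs the power at the cost of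
  \<open>r powr (- \<gamma>)\<close>; the other half is a geometric series with sum at most 4 / r.
  The order agrees with that of the corresponding Gamma integral.\<close>

lemma suminf_powr_exp_le:
  fixes K :: "nat \<Rightarrow> real"
  assumes K: "\<And>k. 0 \<le> K k" "\<And>k. K k \<le> C1 * real (Suc k) powr \<gamma>" and \<gamma>: "\<gamma> \<ge> 0" and r: "0 < r" "r \<le> 1"
  shows "(\<Sum>k. ennreal (K k * exp (- (r * real k)))) \<le> ennreal (8 * C1 * (2 * \<gamma> + 1) powr \<gamma> * r powr (- (\<gamma> + 1)))"
proof -
  define D where "D = (2 * \<gamma> + 1) powr \<gamma>"
  have D: "D \<ge> 0" by (simp add: D_def)
  have C1: "C1 \<ge> 0" using K[of 0] by simp
  define q where "q = exp (- (r / 2))"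
  have q: "0 < q" "q < 1" using r by (auto simp: q_def)
  \<comment> \<open>With y = r / 2 \<le> 1: 1 - exp (- y) \<ge> y - y^2 / 2 \<ge> y / 2.\<close>
  have "1 - q \<ge> r / 4"
  proof -
    have "(r / 2)\<^sup>2 \<le> r / 2 * 1" unfolding power2_eq_square using r by (intro mult_left_mono) auto
    then show ?thesis using exp_minus_le_quadratic[of "r / 2"] r by (simp add: q_def)
  qed
  then have iq: "1 / (1 - q) \<le> 4 / r" using r q by (simp add: field_simps)
  have le: "K k * exp (- (r * real k)) \<le> 2 * C1 * D * r powr (- \<gamma>) * q ^ k" for k
  proof -
    have "(r * real (Suc k)) powr \<gamma> \<le> D * exp (r * real (Suc k) / 2)"
      unfolding D_def using r \<gamma> by (intro powr_le_exp_half) auto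
    then have "r powr (- \<gamma>) * (r * real (Suc k)) powr \<gamma> \<le> r powr (- \<gamma>) * (D * exp (r * real (Suc k) / 2))"
      by (rule mult_left_mono) simp
    moreover have "r powr (- \<gamma>) * (r * real (Suc k)) powr \<gamma> = real (Suc k) powr \<gamma>"
      using r by (simp add: powr_mult powr_minus del: of_nat_Suc)
    ultimately have "K k \<le> C1 * (r powr (- \<gamma>) * (D * exp (r * real (Suc k) / 2)))"
      using K(2)[of k] C1 by (metis (no_types, lifting) mult_left_mono order_trans)
    then have "K k * exp (- (r * real k)) \<le> C1 * (r powr (- \<gamma>) * (D * exp (r * real (Suc k) / 2))) * exp (- (r * real k))"
      by (rule mult_right_mono) simp
    also have "\<dots> = C1 * D * r powr (- \<gamma>) * (exp (r / 2) * exp (- (r / 2) * real k))"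
    proof -
      have "exp (r * real (Suc k) / 2) * exp (- (r * real k)) = exp (r / 2) * exp (- (r / 2) * real k)"
        unfolding mult_exp_exp by (simp add: field_simps)
      then show ?thesis by (simp add: mult_ac)
    qed
    also have "\<dots> \<le> C1 * D * r powr (- \<gamma>) * (2 * exp (- (r / 2) * real k))"
    proof (intro mult_left_mono mult_right_mono)
      have "exp (r / 2) \<le> exp (1 / 2 :: real)" using r by simp
      also have "\<dots> \<le> 2"
        using exp_half_le2 by simp
      finally show "exp (r / 2) \<le> 2" .
    qed (use C1 D in auto)
    also have "exp (- (r / 2) * real k) = q ^ k" by (simp add: q_def exp_of_nat_mult[symmetric] mult.commute)
    finally show ?thesis by (simp add: mult_ac)
  qed
  have "(\<Sum>k. ennreal (K k * exp (- (r * real k)))) \<le> (\<Sum>k. ennreal (2 * C1 * D * r powr (- \<gamma>) * q ^ k))"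
    by (intro suminf_le ennreal_leI le) auto
  also have "\<dots> = ennreal (2 * C1 * D * r powr (- \<gamma>) * (1 / (1 - q)))"
    using C1 D q by (intro suminf_ennreal_eq sums_mult geometric_sums) auto
  also have "\<dots> \<le> ennreal (2 * C1 * D * r powr (- \<gamma>) * (4 / r))"
    using C1 D by (intro ennreal_leI mult_left_mono iq) auto
  also have "2 * C1 * D * r powr (- \<gamma>) * (4 / r) = 8 * C1 * D * r powr (- (\<gamma> + 1))"
    using r by (simp add: powr_diff powr_minus field_simps powr_add)
  finally show ?thesis unfolding D_def .
qed

locale scaling_layers = scaling d \<beta> x for d \<beta> x :: real +
  fixes j :: "'n::finite" and K :: "nat \<Rightarrow> real" and C :: real
  assumes d_card: "d = real CARD('n)" and K_nonneg: "\<And>k. 0 \<le> K k"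
    and K_lim: "(\<lambda>k. K k / real k powr (\<beta> - 1)) \<longlonglongrightarrow> C"
begin

text \<open>A site's integer height exceeds the real level \<open>zz t\<close> exactly when it
  exceeds the floor of the level.\<close>

definition Z :: "real \<Rightarrow> int" where "Z t = \<lfloor>zz t\<rfloor>"
text \<open>Excess of the Chernoff exponent at the integer level over its Gaussian value - \<rho>^2
  T / 2: the remainder of cosh plus the rounding of the level (\<open>exponent_eq\<close>).\<close>

definition E :: "real \<Rightarrow> real" where
  "E t = T t * (cosh (\<rho> t) - 1) - (\<rho> t)\<^sup>2 * T t / 2 + \<rho> t * (zz t - real_of_int (Z t))"
text \<open>Chernoff bound for a walker starting at height at most 0 to be beyond the level at time
  t.\<close>

definition Q :: "real \<Rightarrow> real" where
  "Q t = exp (T t * (cosh (\<rho> t) - 1) - \<rho> t * real_of_int (Z t))"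
definition hsum :: "nat \<Rightarrow> real" where "hsum n = (\<Sum>k<n. K k)"

lemma T_card: "T t = t / real CARD('n)"
  unfolding T_def by (simp only: d_card)

lemma k1_le_T: "t > 0 \<Longrightarrow> k1 j t n \<le> exp (T t * (cosh r - 1) - r * real_of_int n) / sqrt (T t)"
  unfolding T_card by (rule k1_le)

lemma K_lim_Suc: "(\<lambda>k. K k / real (Suc k) powr (\<beta> - 1)) \<longlonglongrightarrow> C"
proof -
  have "(\<lambda>k. real k / real (Suc k)) \<longlonglongrightarrow> 1" by real_asymp
  then have "(\<lambda>k. (real k / real (Suc k)) powr (\<beta> - 1)) \<longlonglongrightarrow> 1 powr (\<beta> - 1)"
    by (intro tendsto_powr tendsto_const) auto
  from tendsto_mult[OF K_lim this]
  have "(\<lambda>k. K k / real k powr (\<beta> - 1) * (real k / real (Suc k)) powr (\<beta> - 1)) \<longlonglongrightarrow> C" by simp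
  moreover have "\<forall>\<^sub>F k in sequentially. K k / real k powr (\<beta> - 1) * (real k / real (Suc k)) powr (\<beta> - 1) = K k / real (Suc k) powr (\<beta> - 1)"
    using eventually_gt_at_top[of 0]
    by eventually_elim (simp add: powr_divide del: of_nat_Suc)
  ultimately show ?thesis by (rule Lim_transform_eventually)
qed

lemma K_bound: "\<exists>C1. \<forall>k. K k \<le> C1 * real (Suc k) powr (\<beta> - 1)"
proof -
  obtain C1 where C1: "\<And>k. \<bar>K k / real (Suc k) powr (\<beta> - 1)\<bar> \<le> C1"
    using convergent_imp_Bseq[OF convergentI[OF K_lim_Suc]] by (auto simp: Bseq_def)
  then have "K k \<le> C1 * real (Suc k) powr (\<beta> - 1)" for k
    using C1[of k] by (simp add: abs_le_iff divide_le_eq)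
  then show ?thesis by blast
qed

lemma hsum_lim: "(\<lambda>n. hsum n / real n powr \<beta>) \<longlonglongrightarrow> C / \<beta>"
  using sum_powr_asymp[OF K_nonneg _ K_lim_Suc] \<beta> by (simp add: hsum_def)

lemma hsum_nonneg: "hsum n \<ge> 0"
  unfolding hsum_def by (intro sum_nonneg K_nonneg)

lemma E_lim: "(E \<longlongrightarrow> 0) at_top"
proof -
  have "((\<lambda>t. \<rho> t * (zz t - real_of_int (Z t))) \<longlongrightarrow> 0) at_top"
  proof (rule Lim_null_comparison[OF _ tendsto_rabs_zero[OF \<rho>_0]])
    have "\<bar>zz t - real_of_int (Z t)\<bar> \<le> 1" for t unfolding Z_def by linarith
    then show "\<forall>\<^sub>F t in at_top. norm (\<rho> t * (zz t - real_of_int (Z t))) \<le> \<bar>\<rho> t\<bar>"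
      by (auto simp: abs_mult intro!: mult_left_le always_eventually)
  qed
  from tendsto_add[OF T_cosh this] show ?thesis by (simp add: E_def[abs_def])
qed

lemma exponent_eq: "t > 0 \<Longrightarrow> T t * (cosh (\<rho> t) - 1) - \<rho> t * real_of_int (Z t) = E t - (\<rho> t)\<^sup>2 * T t / 2"
proof -
  assume "t > 0"
  then have "\<rho> t * zz t = (\<rho> t)\<^sup>2 * T t" using T_pos[of t] by (simp add: \<rho>_def power2_eq_square)
  then show ?thesis by (simp add: E_def algebra_simps)
qed

lemma exp_E_le: "\<forall>\<^sub>F t in at_top. exp (E t) \<le> 2"
proof -
  have "((\<lambda>t. exp (E t)) \<longlongrightarrow> exp 0) at_top" by (intro tendsto_intros E_lim)
  then have "\<forall>\<^sub>F t in at_top. exp (E t) < 2" by (rule order_tendstoD) simp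
  then show ?thesis by eventually_elim simp
qed

lemma Q_le: "\<forall>\<^sub>F t in at_top. Q t \<le> 2 * exp (- ((\<rho> t)\<^sup>2 * T t / 2))"
  using exp_E_le eventually_gt_at_top[of 0]
proof eventually_elim
  case (elim t)
  have "Q t = exp (E t) * exp (- ((\<rho> t)\<^sup>2 * T t / 2))"
    unfolding Q_def exponent_eq[OF elim(2)] by (simp add: mult_exp_exp)
  then show ?case using elim(1) by (simp add: mult_right_mono)
qed

lemma Q_nonneg: "Q t \<ge> 0"
  by (simp add: Q_def)

lemma Q_lim: "(Q \<longlongrightarrow> 0) at_top"
proof (rule tendsto_sandwich[where f = "\<lambda>_. 0", OF _ Q_le])
  show "((\<lambda>t. 2 * exp (- ((\<rho> t)\<^sup>2 * T t / 2))) \<longlongrightarrow> 0) at_top"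
    using tendsto_mult_left[OF gauss_0, of 2] by simp
qed (auto simp: Q_nonneg)

lemma Q_\<rho>_lim: "((\<lambda>t. (Q t)\<^sup>2 * \<rho> t powr (- \<beta>)) \<longlongrightarrow> 0) at_top"
proof (rule tendsto_sandwich[where f = "\<lambda>_. 0"])
  show "((\<lambda>t. 4 * ((exp (- ((\<rho> t)\<^sup>2 * T t / 2)))\<^sup>2 * \<rho> t powr (- \<beta>))) \<longlongrightarrow> 0) at_top"
    using tendsto_mult_left[OF gauss_\<rho>_0, of 4] by simp
  show "\<forall>\<^sub>F t in at_top. (Q t)\<^sup>2 * \<rho> t powr (- \<beta>) \<le> 4 * ((exp (- ((\<rho> t)\<^sup>2 * T t / 2)))\<^sup>2 * \<rho> t powr (- \<beta>))"
    using Q_le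
  proof eventually_elim
    case (elim t)
    have "(Q t)\<^sup>2 \<le> (2 * exp (- ((\<rho> t)\<^sup>2 * T t / 2)))\<^sup>2" by (rule power_mono[OF elim Q_nonneg])
    then have "(Q t)\<^sup>2 \<le> 4 * (exp (- ((\<rho> t)\<^sup>2 * T t / 2)))\<^sup>2" by (simp only: power_mult_distrib) simp
    then have "(Q t)\<^sup>2 * \<rho> t powr (- \<beta>) \<le> 4 * (exp (- ((\<rho> t)\<^sup>2 * T t / 2)))\<^sup>2 * \<rho> t powr (- \<beta>)"
      by (rule mult_right_mono) simp
    then show ?case by (simp only: mult.assoc)
  qed
qed (auto intro: always_eventually)

text \<open>The bound \<open>k1_le_T\<close> at the tilt \<open>\<rho> t\<close> factorises into a
  part for the target height and a part for the layer of departure, and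
  \<open>suminf_powr_exp_le\<close> sums the latter. Raising the target above \<open>Z t\<close>
  only lowers the bound, whence the uniformity in n.\<close>

lemma layer_sum_le:
  obtains C3 where "C3 \<ge> 0"
    "\<forall>\<^sub>F t in at_top. \<forall>n \<ge> Z t. (\<Sum>k. ennreal (K k * k1 j t (n + int k))) \<le> ennreal (C3 * Q t * \<rho> t powr (- \<beta>) / sqrt (T t))"
proof -
  obtain C1 where C1: "\<And>k. K k \<le> C1 * real (Suc k) powr (\<beta> - 1)" using K_bound by blast
  have C1_0: "C1 \<ge> 0" using C1[of 0] K_nonneg[of 0] by simp
  define C3 where "C3 = 8 * C1 * (2 * (\<beta> - 1) + 1) powr (\<beta> - 1)"
  have C3: "C3 \<ge> 0" using C1_0 by (simp add: C3_def)
  have "\<forall>\<^sub>F t in at_top. \<rho> t < 1" using \<rho>_0 by (rule order_tendstoD) simp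
  then have "\<forall>\<^sub>F t in at_top. \<forall>n \<ge> Z t. (\<Sum>k. ennreal (K k * k1 j t (n + int k))) \<le> ennreal (C3 * Q t * \<rho> t powr (- \<beta>) / sqrt (T t))"
    using \<rho>_pos eventually_gt_at_top[of 0]
  proof eventually_elim
    case (elim t)
    have T: "T t > 0" using T_pos elim by simp
    show ?case
    proof (intro allI impI)
      fix n assume n: "n \<ge> Z t"
      have "K k * k1 j t (n + int k) \<le> Q t / sqrt (T t) * (K k * exp (- (\<rho> t * real k)))" for k
      proof -
        have "k1 j t (n + int k) \<le> exp (T t * (cosh (\<rho> t) - 1) - \<rho> t * real_of_int (n + int k)) / sqrt (T t)"
          using elim by (intro k1_le_T) auto
        also have "\<dots> \<le> exp (T t * (cosh (\<rho> t) - 1) - \<rho> t * real_of_int (Z t) - \<rho> t * real k) / sqrt (T t)"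
        proof (intro divide_right_mono)
          have "\<rho> t * real_of_int (Z t) \<le> \<rho> t * real_of_int n" using n elim by (intro mult_left_mono) auto
          then show "exp (T t * (cosh (\<rho> t) - 1) - \<rho> t * real_of_int (n + int k)) \<le> exp (T t * (cosh (\<rho> t) - 1) - \<rho> t * real_of_int (Z t) - \<rho> t * real k)"
            by (simp add: algebra_simps)
        qed (use T in simp)
        also have "\<dots> = Q t / sqrt (T t) * exp (- (\<rho> t * real k))"
          by (simp add: Q_def mult_exp_exp)
        finally have "K k * k1 j t (n + int k) \<le> K k * (Q t / sqrt (T t) * exp (- (\<rho> t * real k)))"
          by (rule mult_left_mono) (rule K_nonneg)
        then show ?thesis by (simp add: mult_ac)
      qed
      then have "(\<Sum>k. ennreal (K k * k1 j t (n + int k))) \<le> (\<Sum>k. ennreal (Q t / sqrt (T t)) * ennreal (K k * exp (- (\<rho> t * real k))))"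
        using T K_nonneg Q_nonneg by (intro suminf_le) (auto simp: ennreal_mult[symmetric] intro!: ennreal_leI)
      also have "\<dots> = ennreal (Q t / sqrt (T t)) * (\<Sum>k. ennreal (K k * exp (- (\<rho> t * real k))))"
        by (rule ennreal_suminf_cmult)
      also have "\<dots> \<le> ennreal (Q t / sqrt (T t)) * ennreal (C3 * \<rho> t powr (- \<beta>))"
        using suminf_powr_exp_le[OF K_nonneg C1 _ elim(2), of ] \<beta> elim by (intro mult_left_mono) (auto simp: C3_def)
      also have "\<dots> = ennreal (C3 * Q t * \<rho> t powr (- \<beta>) / sqrt (T t))"
        using T Q_nonneg C3 by (subst ennreal_mult[symmetric]) (auto simp: field_simps)
      finally show "(\<Sum>k. ennreal (K k * k1 j t (n + int k))) \<le> ennreal (C3 * Q t * \<rho> t powr (- \<beta>) / sqrt (T t))" .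
    qed
  qed
  with C3 show ?thesis by (rule that)
qed

text \<open>With the layer constant C this is M * exp (- \<beta> x), the parameter of the Poisson
  limit.\<close>

definition limit_mass :: real where
  "limit_mass = C * Gamma \<beta> / (d powr (\<beta> / 2) * \<beta> powr ((\<beta> + 1) / 2)) * exp (- \<beta> * x)"

text \<open>With i + 1 = \<lceil>bb t * y\<rceil> the sum becomes an integral over y. By
  \<open>factor\<close> the integrand is a product of a volume ratio, a distance ratio, the tilted
  kernel, the prefactor, the exponent error and the exponential weight, each of which converges and
  is bounded. The sqrt (2 pi) in \<open>lead\<close> cancels the one in the local limit.\<close>

lemma halfspace_sum_lim:
  "((\<lambda>t. \<Sum>i. ennreal (hsum (Suc i) * k1 j t (Z t + int (Suc i)))) \<longlongrightarrow> ennreal limit_mass) at_top"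
proof -
  define m where "m t y = nat \<lceil>bb t * y\<rceil>" for t y
  let ?f = "\<lambda>t y. indicator {0<..} y * (bb t * (hsum (m t y) * k1 j t (Z t + int (m t y))))"
  let ?l = "\<lambda>y. indicator {0<..} y * (y powr \<beta> * exp (- (\<beta> * y))) * (C / \<beta> * (1 / sqrt (2 * pi)) * lead)"
  obtain H where H: "\<And>n. hsum n / real n powr \<beta> \<le> H"
  proof -
    obtain H where "\<And>k. \<bar>hsum k / real k powr \<beta>\<bar> \<le> H"
      using convergent_imp_Bseq[OF convergentI[OF hsum_lim]] by (auto simp: Bseq_def)
    then show ?thesis by (intro that[of H]) (rule order_trans[OF abs_ge_self])
  qed
  have H0: "H \<ge> 0" using H[of 0] by (simp add: hsum_def)
  have lead0: "lead > 0" using \<beta> d by (simp add: lead_def)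
  let ?g = "\<lambda>a y. indicator {0<..} y * (y powr a * exp (- (\<beta> / 2 * y))) :: real"
  \<comment> \<open>Product of the bounds of the factors: H, 2^\<beta> (1 + y^\<beta>), 1, lead + 1,
    2 and exp (- \<beta> y / 2). The last one uses \<rho> * b > \<beta> / 2, which holds
    eventually.\<close>
  define W where "W y = H * 2 powr \<beta> * (lead + 1) * 2 * (?g 0 y + ?g \<beta> y)" for y
  have factor: "bb t * (hsum k * k1 j t (Z t + int k)) =
      (hsum k / real k powr \<beta>) * (real k / bb t) powr \<beta>
      * (sqrt (T t) * (k1 j t (Z t + int k) * exp (\<rho> t * real_of_int (Z t + int k) - T t * (cosh (\<rho> t) - 1))))
      * (bb t powr (\<beta> + 1) / sqrt (T t) * exp (- ((\<rho> t)\<^sup>2 * T t / 2))) * exp (E t) * exp (- (\<rho> t * real k))"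
    if "t > 1" "k > 0" for t k
  proof -
    have b: "bb t > 0" and T: "T t > 0" using bb_pos T_pos that by auto
    have "\<rho> t * real_of_int (Z t + int k) - T t * (cosh (\<rho> t) - 1) = - (E t - (\<rho> t)\<^sup>2 * T t / 2) + \<rho> t * real k"
      using exponent_eq[of t] that by (simp add: algebra_simps)
    then have e1: "exp (\<rho> t * real_of_int (Z t + int k) - T t * (cosh (\<rho> t) - 1)) * exp (- ((\<rho> t)\<^sup>2 * T t / 2)) * exp (E t) * exp (- (\<rho> t * real k)) = 1"
      by (simp add: mult_exp_exp)
    have e2: "(hsum k / real k powr \<beta>) * (real k / bb t) powr \<beta> * bb t powr (\<beta> + 1) = bb t * hsum k"
      using b that by (simp add: powr_divide powr_add)
    have alg: "h * k' = a * b * (s * (k' * X)) * (c / s * Y) * Z' * V"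
      if "X * Y * Z' * V = 1" "a * b * c = h" "s \<noteq> 0" for a b c h k' s X Y Z' V :: real
    proof -
      have "a * b * (s * (k' * X)) * (c / s * Y) * Z' * V = (a * b * c) * k' * (X * Y * Z' * V)"
        using that(3) by simp
      also have "\<dots> = h * k'" by (simp only: that mult_1_right)
      finally show ?thesis ..
    qed
    have "bb t * hsum k * k1 j t (Z t + int k) = hsum k / real k powr \<beta> * (real k / bb t) powr \<beta>
      * (sqrt (T t) * (k1 j t (Z t + int k) * exp (\<rho> t * real_of_int (Z t + int k) - T t * (cosh (\<rho> t) - 1))))
      * (bb t powr (\<beta> + 1) / sqrt (T t) * exp (- ((\<rho> t)\<^sup>2 * T t / 2))) * exp (E t) * exp (- (\<rho> t * real k))"
      by (rule alg[OF e1 e2]) (use T in simp)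
    then show ?thesis by (simp only: mult.assoc)
  qed
  have k1_bd: "sqrt (T t) * (k1 j t n * exp (\<rho> t * real_of_int n - T t * (cosh (\<rho> t) - 1))) \<le> 1" if "t > 0" for t n
  proof -
    have T: "T t > 0" using T_pos that by simp
    have "k1 j t n \<le> exp (T t * (cosh (\<rho> t) - 1) - \<rho> t * real_of_int n) / sqrt (T t)"
      using that by (intro k1_le_T) auto
    then have "sqrt (T t) * (k1 j t n * exp (\<rho> t * real_of_int n - T t * (cosh (\<rho> t) - 1)))
        \<le> sqrt (T t) * (exp (T t * (cosh (\<rho> t) - 1) - \<rho> t * real_of_int n) / sqrt (T t) * exp (\<rho> t * real_of_int n - T t * (cosh (\<rho> t) - 1)))"
      using T by (intro mult_left_mono mult_right_mono) auto
    also have "\<dots> = 1" using T by (simp add: mult_exp_exp)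
    finally show ?thesis .
  qed
  have m_pos: "m t y > 0" if "t > 1" "y > 0" for t y
    unfolding m_def using bb_pos[OF that(1)] that(2) by simp
  have m_real: "real (m t y) = real_of_int \<lceil>bb t * y\<rceil>" if "t > 1" "y > 0" for t y
  proof -
    have "\<lceil>bb t * y\<rceil> > 0" using bb_pos[OF that(1)] that(2) by simp
    then show ?thesis by (simp add: m_def)
  qed
  have ev_b: "\<forall>\<^sub>F t in at_top. bb t \<ge> 1" using bb_top by (simp add: filterlim_at_top)
  have ev_\<rho>b: "\<forall>\<^sub>F t in at_top. \<rho> t * bb t > \<beta> / 2" using \<beta> by (intro order_tendstoD(1)[OF \<rho>_bb]) auto
  have ev_pre: "\<forall>\<^sub>F t in at_top. bb t powr (\<beta> + 1) / sqrt (T t) * exp (- ((\<rho> t)\<^sup>2 * T t / 2)) < lead + 1"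
    by (intro order_tendstoD(2)[OF prefactor]) auto
  have dom: "\<forall>\<^sub>F t in at_top. \<forall>y. norm (?f t y) \<le> W y"
    using ev_b ev_\<rho>b ev_pre exp_E_le \<rho>_pos eventually_gt_at_top[of 1]
  proof eventually_elim
    case (elim t)
    have T: "T t > 0" using T_pos elim by simp
    have "norm (?f t y) \<le> W y" for y
    proof (cases "y > 0")
      case True
      let ?k = "m t y"
      have k: "?k > 0" using m_pos elim True by simp
      have kle: "real ?k \<le> bb t * y + 1" using m_real[of t y] elim True by linarith
      have kge: "real ?k \<ge> bb t * y" using m_real[of t y] elim True by linarith
      have p1: "(real ?k / bb t) powr \<beta> \<le> 2 powr \<beta> * (1 + y powr \<beta>)"
      proof -
        have "real ?k / bb t \<le> (bb t * y + 1) / bb t" using kle elim by (intro divide_right_mono) auto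
        also have "\<dots> \<le> 2 * max 1 y" using elim True
        proof -
          have "(bb t * y + 1) / bb t = y + 1 / bb t" using elim by (simp add: add_divide_distrib)
          also have "\<dots> \<le> y + 1" using elim by simp
          also have "\<dots> \<le> 2 * max 1 y" by simp
          finally show ?thesis .
        qed
        finally have "(real ?k / bb t) powr \<beta> \<le> (2 * max 1 y) powr \<beta>" using \<beta> elim by (intro powr_mono2) auto
        also have "\<dots> = 2 powr \<beta> * (max 1 y) powr \<beta>" using True by (simp add: powr_mult)
        also have "(max 1 y) powr \<beta> \<le> 1 + y powr \<beta>" by (auto simp: max_def)
        finally show ?thesis by (simp add: mult_left_mono)
      qed
      have p2: "exp (- (\<rho> t * real ?k)) \<le> exp (- (\<beta> / 2 * y))"
      proof -
        have "\<beta> / 2 * y \<le> \<rho> t * bb t * y" using elim True by (intro mult_right_mono) auto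
        also have "\<dots> \<le> \<rho> t * real ?k" using kge elim by (simp add: mult.assoc mult_left_mono)
        finally show ?thesis by simp
      qed
      have nn: "0 \<le> k1 j t n" for n by (simp add: k1_def)
      have "bb t * (hsum ?k * k1 j t (Z t + int ?k)) \<le> H * (2 powr \<beta> * (1 + y powr \<beta>)) * 1 * (lead + 1) * 2 * exp (- (\<beta> / 2 * y))"
        unfolding factor[OF elim(6) k]
        using elim T H0 lead0 hsum_nonneg[of ?k] nn H[of ?k] p1 p2 k1_bd[of t "Z t + int ?k"]
        by (intro mult_mono) (auto intro!: mult_nonneg_nonneg divide_nonneg_nonneg simp del: of_int_add)
      also have "\<dots> = W y" using True by (simp add: W_def algebra_simps)
      finally have "bb t * (hsum ?k * k1 j t (Z t + int ?k)) \<le> W y" .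
      moreover have "bb t * (hsum ?k * k1 j t (Z t + int ?k)) \<ge> 0" using elim hsum_nonneg nn by simp
      ultimately show ?thesis using True by simp
    next
      case False
      then show ?thesis by (simp add: W_def)
    qed
    then show ?case by blast
  qed
  have W_int: "integrable lborel W"
    using has_bochner_integral_Gamma[of 0 "\<beta> / 2"] has_bochner_integral_Gamma[of \<beta> "\<beta> / 2"] \<beta>
    unfolding W_def by (intro integrable_mult_right Bochner_Integration.integrable_add) (auto simp: has_bochner_integral_iff)
  have meas: "?f t \<in> borel_measurable lborel" for t
    using measurable_step[of "\<lambda>k. bb t * (hsum k * k1 j t (Z t + int k))" "bb t"] unfolding m_def by measurable
  have lim: "((\<lambda>t. ?f t y) \<longlongrightarrow> ?l y) at_top" for y
  proof (cases "y > 0")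
    case True
    have ev1: "\<forall>\<^sub>F t in at_top. (t :: real) > 1" by (rule eventually_gt_at_top)
    have mb: "((\<lambda>t. real (m t y) / bb t) \<longlongrightarrow> y) at_top"
    proof -
      have "((\<lambda>b. real_of_int \<lceil>b * y\<rceil> / b) \<longlongrightarrow> y) at_top" using True by real_asymp
      from filterlim_compose[OF this bb_top]
      show ?thesis by (rule Lim_transform_eventually) (use ev1 in eventually_elim, simp add: m_real True)
    qed
    have m_top: "filterlim (\<lambda>t. m t y) at_top at_top"
    proof -
      have "filterlim (\<lambda>t. y * bb t) at_top at_top"
        by (rule filterlim_tendsto_pos_mult_at_top[OF tendsto_const True bb_top])
      then have "filterlim (\<lambda>t. bb t * y) at_top at_top" by (simp only: mult.commute)
      then have "filterlim (\<lambda>t. real (m t y)) at_top at_top"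
        by (rule filterlim_at_top_mono) (use ev1 in eventually_elim, simp add: m_real True)
      then show ?thesis by (simp add: filterlim_real_sequentially filterlim_sequentially_iff_filterlim_real)
    qed
    have l1: "((\<lambda>t. hsum (m t y) / real (m t y) powr \<beta>) \<longlongrightarrow> C / \<beta>) at_top"
      by (rule filterlim_compose[OF hsum_lim m_top])
    have l2: "((\<lambda>t. (real (m t y) / bb t) powr \<beta>) \<longlongrightarrow> y powr \<beta>) at_top"
      using True by (intro tendsto_powr mb tendsto_const) auto
    have l3: "((\<lambda>t. sqrt (T t) * (k1 j t (Z t + int (m t y)) * exp (\<rho> t * real_of_int (Z t + int (m t y)) - T t * (cosh (\<rho> t) - 1)))) \<longlongrightarrow> 1 / sqrt (2 * pi)) at_top"
      unfolding T_card
    proof (rule k1_local_limit[OF \<rho>_0])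
      have a1: "((\<lambda>t. (zz t - real_of_int (Z t)) / sqrt (T t)) \<longlongrightarrow> 0) at_top"
      proof (rule Lim_null_comparison)
        have fl: "\<bar>zz t - real_of_int (Z t)\<bar> \<le> 1" for t unfolding Z_def by linarith
        show "\<forall>\<^sub>F t in at_top. norm ((zz t - real_of_int (Z t)) / sqrt (T t)) \<le> inverse (sqrt (T t))"
          using ev1
        proof eventually_elim
          case (elim t)
          have "\<bar>zz t - real_of_int (Z t)\<bar> / sqrt (T t) \<le> 1 / sqrt (T t)"
            using T_pos[of t] elim by (intro divide_right_mono fl) auto
          then show ?case using T_pos[of t] elim by (simp add: abs_divide inverse_eq_divide)
        qed
        have "((\<lambda>u. inverse (sqrt u)) \<longlongrightarrow> (0::real)) at_top" by real_asymp
        from filterlim_compose[OF this T_top] show "((\<lambda>t. inverse (sqrt (T t))) \<longlongrightarrow> 0) at_top" .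
      qed
      have "((\<lambda>t. (zz t - T t * sinh (\<rho> t)) / sqrt (T t) - (zz t - real_of_int (Z t)) / sqrt (T t) + real (m t y) / bb t * (bb t / sqrt (T t))) \<longlongrightarrow> 0 - 0 + y * 0) at_top"
        by (intro tendsto_add tendsto_diff tendsto_mult T_sinh a1 mb bb_T)
      moreover have "\<forall>\<^sub>F t in at_top. (zz t - T t * sinh (\<rho> t)) / sqrt (T t) - (zz t - real_of_int (Z t)) / sqrt (T t) + real (m t y) / bb t * (bb t / sqrt (T t))
         = (real_of_int (Z t + int (m t y)) - T t * sinh (\<rho> t)) / sqrt (T t)"
        using ev1
      proof eventually_elim
        case (elim t)
        have "real (m t y) / bb t * (bb t / sqrt (T t)) = real (m t y) / sqrt (T t)" using bb_pos[OF elim] by simp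
        then show ?case by (simp add: add_divide_distrib diff_divide_distrib)
      qed
      ultimately show "((\<lambda>t. (real_of_int (Z t + int (m t y)) - t / real CARD('n) * sinh (\<rho> t)) / sqrt (t / real CARD('n))) \<longlongrightarrow> 0) at_top"
        unfolding T_card by (simp add: Lim_transform_eventually)
    qed
    have l4: "((\<lambda>t. exp (- (\<rho> t * real (m t y)))) \<longlongrightarrow> exp (- (\<beta> * y))) at_top"
    proof -
      have "((\<lambda>t. exp (- (\<rho> t * bb t * (real (m t y) / bb t)))) \<longlongrightarrow> exp (- (\<beta> * y))) at_top"
        by (intro tendsto_intros \<rho>_bb mb)
      moreover have "\<forall>\<^sub>F t in at_top. exp (- (\<rho> t * bb t * (real (m t y) / bb t))) = exp (- (\<rho> t * real (m t y)))"
        using ev1 by eventually_elim (use bb_pos in force)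
      ultimately show ?thesis by (rule Lim_transform_eventually)
    qed
    have l5: "((\<lambda>t. exp (E t)) \<longlongrightarrow> exp 0) at_top" by (intro tendsto_intros E_lim)
    have "((\<lambda>t. (hsum (m t y) / real (m t y) powr \<beta>) * (real (m t y) / bb t) powr \<beta>
      * (sqrt (T t) * (k1 j t (Z t + int (m t y)) * exp (\<rho> t * real_of_int (Z t + int (m t y)) - T t * (cosh (\<rho> t) - 1))))
      * (bb t powr (\<beta> + 1) / sqrt (T t) * exp (- ((\<rho> t)\<^sup>2 * T t / 2))) * exp (E t) * exp (- (\<rho> t * real (m t y))))
      \<longlongrightarrow> C / \<beta> * y powr \<beta> * (1 / sqrt (2 * pi)) * lead * exp 0 * exp (- (\<beta> * y))) at_top"
      by (intro tendsto_mult l1 l2 l3 l4 l5 prefactor)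
    moreover have "\<forall>\<^sub>F t in at_top. (hsum (m t y) / real (m t y) powr \<beta>) * (real (m t y) / bb t) powr \<beta>
      * (sqrt (T t) * (k1 j t (Z t + int (m t y)) * exp (\<rho> t * real_of_int (Z t + int (m t y)) - T t * (cosh (\<rho> t) - 1))))
      * (bb t powr (\<beta> + 1) / sqrt (T t) * exp (- ((\<rho> t)\<^sup>2 * T t / 2))) * exp (E t) * exp (- (\<rho> t * real (m t y)))
      = ?f t y"
      using ev1
    proof eventually_elim
      case (elim t)
      show ?case unfolding factor[OF elim m_pos[OF elim True], symmetric] using True by simp
    qed
    ultimately have "((\<lambda>t. ?f t y) \<longlongrightarrow> C / \<beta> * y powr \<beta> * (1 / sqrt (2 * pi)) * lead * exp 0 * exp (- (\<beta> * y))) at_top"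
      by (rule Lim_transform_eventually)
    then show ?thesis using True by (simp add: mult_ac)
  qed simp
  have l_int: "has_bochner_integral lborel ?l (Gamma (\<beta> + 1) / \<beta> powr (\<beta> + 1) * (C / \<beta> * (1 / sqrt (2 * pi)) * lead))"
    using \<beta> by (intro has_bochner_integral_mult_left has_bochner_integral_Gamma) auto
  have "Gamma (\<beta> + 1) / \<beta> powr (\<beta> + 1) * (C / \<beta> * (1 / sqrt (2 * pi)) * lead) = limit_mass"
  proof -
    have "\<beta> powr (\<beta> + 1) = \<beta> powr ((\<beta> + 1) / 2) * \<beta> powr ((\<beta> + 1) / 2)"
      by (simp flip: powr_add)
    moreover have "Gamma (\<beta> + 1) = \<beta> * Gamma \<beta>" using \<beta> by (intro Gamma_plus1) (auto simp: nonpos_Ints_def)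
    ultimately show ?thesis using \<beta> by (simp add: lead_def limit_mass_def mult_ac)
  qed
  with l_int have l_eq: "integral\<^sup>L lborel ?l = limit_mass" by (simp add: has_bochner_integral_iff)
  have "((\<lambda>t. \<integral>y. ?f t y \<partial>lborel) \<longlongrightarrow> integral\<^sup>L lborel ?l) at_top"
  proof (rule integral_dominated_convergence_at_top[where w = W and f = ?l and s = ?f, OF _ meas W_int])
    show "?l \<in> borel_measurable lborel" using l_int by (auto simp: has_bochner_integral_iff)
    show "\<forall>\<^sub>F t in at_top. AE y in lborel. norm (?f t y) \<le> W y" using dom by eventually_elim simp
    show "AE y in lborel. ((\<lambda>t. ?f t y) \<longlongrightarrow> ?l y) at_top" using lim by simp
  qed
  then have "((\<lambda>t. ennreal (\<integral>y. ?f t y \<partial>lborel)) \<longlongrightarrow> ennreal limit_mass) at_top"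
    unfolding l_eq by (rule tendsto_ennrealI)
  moreover have "\<forall>\<^sub>F t in at_top. ennreal (\<integral>y. ?f t y \<partial>lborel) = (\<Sum>i. ennreal (hsum (Suc i) * k1 j t (Z t + int (Suc i))))"
    using dom eventually_gt_at_top[of 1]
  proof eventually_elim
    case (elim t)
    have nn: "0 \<le> k1 j t n" for n by (simp add: k1_def)
    have "integrable lborel (?f t)"
    proof (rule Bochner_Integration.integrable_bound[OF W_int meas], rule AE_I2)
      fix y
      have "norm (?f t y) \<le> W y" using elim(1) by blast
      also have "\<dots> \<le> norm (W y)" by simp
      finally show "norm (?f t y) \<le> norm (W y)" .
    qed
    then have "ennreal (\<integral>y. ?f t y \<partial>lborel) = (\<integral>\<^sup>+y. ennreal (?f t y) \<partial>lborel)"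
      using bb_pos[of t] elim hsum_nonneg nn by (intro nn_integral_eq_integral[symmetric]) (auto intro!: mult_nonneg_nonneg)
    also have "\<dots> = (\<Sum>i. ennreal (hsum (Suc i) * k1 j t (Z t + int (Suc i))))"
      unfolding m_def using bb_pos[of t] elim hsum_nonneg nn
      by (intro suminf_eq_nn_integral_step[symmetric, of _ "\<lambda>k. hsum k * k1 j t (Z t + int k)"]) auto
    finally show ?case .
  qed
  ultimately show ?thesis by (rule Lim_transform_eventually)
qed

end

section \<open>Markov semigroups\<close>

lemma has_vector_derivative_quotient_iff:
  fixes f :: "real \<Rightarrow> 'a::real_normed_vector"
  shows "(f has_vector_derivative f') (at x within S) \<longleftrightarrow>
    ((\<lambda>y. (f y - f x) /\<^sub>R (y - x)) \<longlongrightarrow> f') (at x within S)"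
proof -
  have eq: "norm ((f y - f x) - (y - x) *\<^sub>R f') / norm (y - x) = norm ((f y - f x) /\<^sub>R (y - x) - f')" if "y \<noteq> x" for y
  proof -
    have "(f y - f x) /\<^sub>R (y - x) - f' = ((f y - f x) - (y - x) *\<^sub>R f') /\<^sub>R (y - x)"
      using that by (simp add: scaleR_diff_right)
    then show ?thesis by (simp add: divide_inverse_commute)
  qed
  have "(f has_vector_derivative f') (at x within S) \<longleftrightarrow>
    ((\<lambda>y. norm ((f y - f x) - (y - x) *\<^sub>R f') / norm (y - x)) \<longlongrightarrow> 0) (at x within S)"
    unfolding has_vector_derivative_def has_derivative_iff_norm
    by (simp add: bounded_linear_scaleR_left)
  also have "\<dots> \<longleftrightarrow> ((\<lambda>y. norm ((f y - f x) /\<^sub>R (y - x) - f')) \<longlongrightarrow> 0) (at x within S)"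
  proof (intro filterlim_cong refl)
    show "\<forall>\<^sub>F y in at x within S. norm ((f y - f x) - (y - x) *\<^sub>R f') / norm (y - x) = norm ((f y - f x) /\<^sub>R (y - x) - f')"
      unfolding eventually_at_filter by (intro always_eventually allI impI eq)
  qed
  also have "\<dots> \<longleftrightarrow> ((\<lambda>y. (f y - f x) /\<^sub>R (y - x)) \<longlongrightarrow> f') (at x within S)"
    by (simp only: tendsto_norm_zero_iff LIM_zero_iff)
  finally show ?thesis .
qed

lemma bounded_linear_apply_bcontfun:
  "bounded_linear (\<lambda>f :: 'a::topological_space \<Rightarrow>\<^sub>C 'b::real_normed_vector. apply_bcontfun f x)"
  by (rule bounded_linear_intro[where K = 1]) (auto simp: norm_bounded)

lemma filterlim_abs_diff_at_right:
  fixes t :: real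
  shows "filterlim (\<lambda>s. \<bar>s - t\<bar>) (at_right 0) (at t within S)"
  unfolding filterlim_at
proof
  have "((\<lambda>s. \<bar>s - t\<bar>) \<longlongrightarrow> \<bar>t - t\<bar>) (at t within S)" by (intro tendsto_intros)
  then show "((\<lambda>s. \<bar>s - t\<bar>) \<longlongrightarrow> 0) (at t within S)" by simp
qed (simp add: eventually_at_filter)

locale semigroup =
  fixes S :: "real \<Rightarrow> ('n::finite config \<Rightarrow>\<^sub>C real) \<Rightarrow> ('n config \<Rightarrow>\<^sub>C real)"
  assumes markov: "markov_semigroup S"
begin

lemma lin: "t \<ge> 0 \<Longrightarrow> linear (S t)" and S_0 [simp]: "S 0 f = f"
  and S_add: "s \<ge> 0 \<Longrightarrow> t \<ge> 0 \<Longrightarrow> S (s + t) f = S s (S t f)"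
  and S_const: "t \<ge> 0 \<Longrightarrow> S t (const_bcontfun 1) = const_bcontfun 1"
  and S_pos: "t \<ge> 0 \<Longrightarrow> (\<And>\<eta>. 0 \<le> apply_bcontfun f \<eta>) \<Longrightarrow> 0 \<le> apply_bcontfun (S t f) \<eta>"
  and S_right: "t \<ge> 0 \<Longrightarrow> continuous (at_right t) (\<lambda>s. S s f)"
  using markov unfolding markov_semigroup_def by auto

lemma S_mono:
  assumes "t \<ge> 0" "\<And>\<eta>. apply_bcontfun f \<eta> \<le> apply_bcontfun g \<eta>"
  shows "apply_bcontfun (S t f) \<eta> \<le> apply_bcontfun (S t g) \<eta>"
  using S_pos[OF assms(1), of "g - f" \<eta>] assms(2) by (simp add: linear_diff[OF lin[OF assms(1)]])

lemma S_const': "t \<ge> 0 \<Longrightarrow> S t (const_bcontfun c) = const_bcontfun c"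
proof -
  assume t: "t \<ge> 0"
  have eq: "const_bcontfun c = c *\<^sub>R (const_bcontfun 1 :: 'n config \<Rightarrow>\<^sub>C real)" by (rule bcontfun_eqI) simp
  show ?thesis unfolding eq by (simp add: linear_cmul[OF lin[OF t]] S_const[OF t])
qed

text \<open>Positivity and invariance of constants keep \<open>S t f\<close> between the constants -
  norm f and norm f.\<close>

lemma S_contraction:
  assumes "t \<ge> 0"
  shows "norm (S t f) \<le> norm f"
proof (rule norm_bound)
  fix \<eta>
  have b: "\<bar>apply_bcontfun f \<zeta>\<bar> \<le> norm f" for \<zeta> using norm_bounded[of f \<zeta>] by simp
  have "apply_bcontfun (S t f) \<eta> \<le> apply_bcontfun (S t (const_bcontfun (norm f))) \<eta>"
    using b by (intro S_mono assms) (auto simp: abs_le_iff)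
  moreover have "apply_bcontfun (S t (const_bcontfun (- norm f))) \<eta> \<le> apply_bcontfun (S t f) \<eta>"
    using b by (intro S_mono assms) (auto simp: abs_le_iff minus_le_iff)
  ultimately show "norm (apply_bcontfun (S t f) \<eta>) \<le> norm f"
    using assms by (auto simp: S_const' abs_le_iff)
qed

text \<open>The increment between two times is \<open>S\<close> at the earlier time applied to an
  increment from 0, and \<open>S\<close> contracts. Thus right continuity at 0 yields two-sided
  continuity.\<close>

lemma S_diff_le:
  assumes "s \<ge> 0" "t \<ge> 0"
  shows "norm (S s f - S t f) \<le> norm (S \<bar>s - t\<bar> f - f)"
proof -
  have *: "norm (S s f - S t f) \<le> norm (S \<bar>s - t\<bar> f - f)" if "s \<ge> 0" "s \<le> t" for s t
  proof -
    have "S t f = S s (S \<bar>s - t\<bar> f)" using S_add[of s "\<bar>s - t\<bar>" f] that by simp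
    then have "S s f - S t f = S s (f - S \<bar>s - t\<bar> f)" using that by (simp add: linear_diff[OF lin])
    also have "norm \<dots> \<le> norm (f - S \<bar>s - t\<bar> f)" using that by (intro S_contraction)
    finally show ?thesis by (simp add: norm_minus_commute)
  qed
  show ?thesis
  proof (cases "s \<le> t")
    case True then show ?thesis using * assms by blast
  next
    case False then show ?thesis using *[of t s] assms by (simp add: norm_minus_commute abs_minus_commute)
  qed
qed

lemma S_right_0: "((\<lambda>u. norm (S u f - f)) \<longlongrightarrow> 0) (at_right 0)"
  using S_right[of 0 f] unfolding continuous_within by (simp add: LIM_zero_iff tendsto_norm_zero_iff)

lemma S_tendsto:
  assumes "t \<ge> 0"
  shows "((\<lambda>s. S s f) \<longlongrightarrow> S t f) (at t within {0..})"
proof -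
  have "((\<lambda>s. norm (S \<bar>s - t\<bar> f - f)) \<longlongrightarrow> 0) (at t within {0..})"
    by (rule filterlim_compose[OF S_right_0 filterlim_abs_diff_at_right])
  then have "((\<lambda>s. S s f - S t f) \<longlongrightarrow> 0) (at t within {0..})"
    by (rule Lim_null_comparison[rotated]) (use assms in \<open>auto simp: eventually_at_filter S_diff_le\<close>)
  then show ?thesis by (simp add: LIM_zero_iff)
qed

text \<open>The generator gives a right derivative at 0. On either side of t the difference quotient
  is \<open>S m\<close> applied to the quotient at 0, with m the earlier of the two times; having
  \<open>S m h\<close> in place of \<open>S t h\<close> is paid for by
  \<open>S_diff_le\<close>.\<close>

lemma S_has_derivative:
  assumes "(f, h) \<in> generator_graph S" "t \<ge> 0"
  shows "((\<lambda>s. S s f) has_vector_derivative S t h) (at t within {0..})"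
proof -
  have g: "((\<lambda>u. norm ((S u f - f) /\<^sub>R u - h)) \<longlongrightarrow> 0) (at_right 0)"
    using assms(1) by (simp add: generator_graph_def LIM_zero_iff tendsto_norm_zero_iff)
  have lim: "((\<lambda>s. norm ((S \<bar>s - t\<bar> f - f) /\<^sub>R \<bar>s - t\<bar> - h) + norm (S \<bar>s - t\<bar> h - h)) \<longlongrightarrow> 0 + 0) (at t within {0..})"
    by (intro tendsto_add filterlim_compose[OF g filterlim_abs_diff_at_right]
        filterlim_compose[OF S_right_0 filterlim_abs_diff_at_right])
  have le: "norm ((S s f - S t f) /\<^sub>R (s - t) - S t h)
      \<le> norm ((S \<bar>s - t\<bar> f - f) /\<^sub>R \<bar>s - t\<bar> - h) + norm (S \<bar>s - t\<bar> h - h)" if "s \<ge> 0" "s \<noteq> t" for s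
  proof -
    define m u where "m = min s t" and "u = \<bar>s - t\<bar>"
    have m: "m \<ge> 0" and u: "u \<ge> 0" using that assms by (auto simp: m_def u_def)
    have "(S s f - S t f) /\<^sub>R (s - t) = (S (m + u) f - S m f) /\<^sub>R u"
    proof (cases "s \<le> t")
      case True
      then have "m + u = t" "m = s" "u = - (s - t)" by (auto simp: m_def u_def)
      then show ?thesis by (metis inverse_minus_eq minus_diff_eq scaleR_minus_left scaleR_minus_right)
    next
      case False
      then have "m + u = s" "m = t" "u = s - t" by (auto simp: m_def u_def)
      then show ?thesis by simp
    qed
    also have "\<dots> = S m ((S u f - f) /\<^sub>R u)"
      using m u by (simp add: S_add linear_diff[OF lin] linear_cmul[OF lin])
    finally have eq: "(S s f - S t f) /\<^sub>R (s - t) = S m ((S u f - f) /\<^sub>R u)" .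
    have "norm (S m ((S u f - f) /\<^sub>R u) - S t h) \<le> norm (S m ((S u f - f) /\<^sub>R u) - S m h) + norm (S m h - S t h)"
      using norm_triangle_ineq[of "S m ((S u f - f) /\<^sub>R u) - S m h" "S m h - S t h"] by simp
    also have "norm (S m ((S u f - f) /\<^sub>R u) - S m h) \<le> norm ((S u f - f) /\<^sub>R u - h)"
      using S_contraction[OF m, of "(S u f - f) /\<^sub>R u - h"] by (simp add: linear_diff[OF lin[OF m]])
    also have "norm (S m h - S t h) \<le> norm (S u h - h)"
    proof (cases "s \<le> t")
      case True
      then have "m = s" by (simp add: m_def)
      then show ?thesis using S_diff_le[of s t h] that assms by (simp add: u_def)
    qed (simp add: m_def)
    finally show ?thesis unfolding eq u_def by simp
  qed
  have "((\<lambda>s. (S s f - S t f) /\<^sub>R (s - t) - S t h) \<longlongrightarrow> 0) (at t within {0..})"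
    by (rule Lim_null_comparison[OF _ lim[simplified]]) (auto simp: eventually_at_filter le)
  then show ?thesis unfolding has_vector_derivative_quotient_iff by (simp add: LIM_zero_iff)
qed

text \<open>The product rule behind Duhamel's formula. Only strong continuity of \<open>S\<close> is
  at hand, so the contraction property is used to replace the moving argument by its limit before
  the time of \<open>S\<close> is moved.\<close>

lemma S_curve_has_derivative:
  assumes F: "\<And>\<tau>. \<tau> \<ge> 0 \<Longrightarrow> (F has_vector_derivative F' \<tau>) (at \<tau> within {0..})"
    and H: "\<And>\<tau>. \<tau> \<ge> 0 \<Longrightarrow> (F \<tau>, H \<tau>) \<in> generator_graph S"
    and s: "s \<in> {0..t}"
  shows "((\<lambda>s. S s (F (t - s))) has_vector_derivative S s (H (t - s) - F' (t - s))) (at s within {0..t})"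
proof -
  have "(F has_vector_derivative F' (t - s)) (at (t - s) within (\<lambda>r. t - r) ` {0..t})"
    by (rule has_vector_derivative_within_subset[OF F]) (use s in auto)
  moreover have "((\<lambda>r. t - r) has_vector_derivative -1) (at s within {0..t})"
    by (auto intro!: derivative_eq_intros)
  ultimately have "((F \<circ> (\<lambda>r. t - r)) has_vector_derivative (-1) *\<^sub>R F' (t - s)) (at s within {0..t})"
    by (rule vector_diff_chain_within[rotated])
  then have q: "((\<lambda>r. (F (t - r) - F (t - s)) /\<^sub>R (r - s)) \<longlongrightarrow> - F' (t - s)) (at s within {0..t})"
    unfolding has_vector_derivative_quotient_iff by (simp add: o_def)
  let ?Q = "\<lambda>r. (F (t - r) - F (t - s)) /\<^sub>R (r - s)" and ?q = "- F' (t - s)"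
  have lim: "((\<lambda>r. norm (?Q r - ?q) + norm (S r ?q - S s ?q)) \<longlongrightarrow> 0 + 0) (at s within {0..t})"
  proof (intro tendsto_add tendsto_norm_zero)
    show "((\<lambda>r. ?Q r - ?q) \<longlongrightarrow> 0) (at s within {0..t})" using q by (rule LIM_zero)
    have "((\<lambda>r. S r ?q) \<longlongrightarrow> S s ?q) (at s within {0..t})"
      by (rule tendsto_within_subset[OF S_tendsto]) (use s in auto)
    then show "((\<lambda>r. S r ?q - S s ?q) \<longlongrightarrow> 0) (at s within {0..t})" by (rule LIM_zero)
  qed
  have "((\<lambda>r. S r (?Q r) - S s ?q) \<longlongrightarrow> 0) (at s within {0..t})"
  proof (rule Lim_null_comparison[OF _ lim[unfolded add_0]])
    have "norm (S r (?Q r) - S s ?q) \<le> norm (?Q r - ?q) + norm (S r ?q - S s ?q)" if "r \<ge> 0" for r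
    proof -
      have "norm (S r (?Q r) - S s ?q) \<le> norm (S r (?Q r) - S r ?q) + norm (S r ?q - S s ?q)"
        using norm_triangle_ineq[of "S r (?Q r) - S r ?q" "S r ?q - S s ?q"] by simp
      also have "norm (S r (?Q r) - S r ?q) \<le> norm (?Q r - ?q)"
        using S_contraction[OF that, of "?Q r - ?q"] unfolding linear_diff[OF lin[OF that]] .
      finally show ?thesis by simp
    qed
    then show "\<forall>\<^sub>F r in at s within {0..t}. norm (S r (?Q r) - S s ?q) \<le> norm (?Q r - ?q) + norm (S r ?q - S s ?q)"
      by (auto simp: eventually_at_filter)
  qed
  then have 1: "((\<lambda>r. S r (?Q r)) \<longlongrightarrow> S s ?q) (at s within {0..t})" by (simp only: LIM_zero_iff)
  have "((\<lambda>r. S r (F (t - s))) has_vector_derivative S s (H (t - s))) (at s within {0..t})"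
    by (rule has_vector_derivative_within_subset[OF S_has_derivative[OF H]]) (use s in auto)
  then have 2: "((\<lambda>r. (S r (F (t - s)) - S s (F (t - s))) /\<^sub>R (r - s)) \<longlongrightarrow> S s (H (t - s))) (at s within {0..t})"
    unfolding has_vector_derivative_quotient_iff .
  have 3: "((\<lambda>r. S r (?Q r) + (S r (F (t - s)) - S s (F (t - s))) /\<^sub>R (r - s)) \<longlongrightarrow> S s ?q + S s (H (t - s))) (at s within {0..t})"
    by (rule tendsto_add[OF 1 2])
  have "S s ?q + S s (H (t - s)) = S s (H (t - s) - F' (t - s))"
    using s by (simp add: linear_diff[OF lin] linear_neg[OF lin])
  moreover have "\<forall>\<^sub>F r in at s within {0..t}. S r (?Q r) + (S r (F (t - s)) - S s (F (t - s))) /\<^sub>R (r - s)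
      = (S r (F (t - r)) - S s (F (t - s))) /\<^sub>R (r - s)"
  proof -
    have "S r (?Q r) + (S r (F (t - s)) - S s (F (t - s))) /\<^sub>R (r - s)
      = (S r (F (t - r)) - S s (F (t - s))) /\<^sub>R (r - s)" if "r \<ge> 0" for r
    proof -
      have "S r (?Q r) = (S r (F (t - r)) - S r (F (t - s))) /\<^sub>R (r - s)"
        by (simp only: linear_cmul[OF lin[OF that]] linear_diff[OF lin[OF that]])
      then show ?thesis by (simp only: flip: scaleR_add_right) (simp only: diff_add_cancel diff_add_eq_diff_diff_swap add_diff_eq)
    qed
    then show ?thesis unfolding eventually_at_filter by (intro always_eventually) auto
  qed
  ultimately have "((\<lambda>r. (S r (F (t - r)) - S s (F (t - s))) /\<^sub>R (r - s)) \<longlongrightarrow> S s (H (t - s) - F' (t - s))) (at s within {0..t})"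
    using Lim_transform_eventually[OF 3] by (simp only:)
  then show ?thesis unfolding has_vector_derivative_quotient_iff .
qed

end

section \<open>The exclusion generator on product functions\<close>

definition depends_on :: "(int ^ 'n::finite) set \<Rightarrow> ('n config \<Rightarrow> 'b) \<Rightarrow> bool" where
  "depends_on A f \<longleftrightarrow> (\<forall>\<eta> \<zeta>. (\<forall>x\<in>A. \<eta> x = \<zeta> x) \<longrightarrow> f \<eta> = f \<zeta>)"

lemma local_funI: "finite A \<Longrightarrow> depends_on A f \<Longrightarrow> local_fun f"
  unfolding local_fun_def depends_on_def by blast

text \<open>A local function is a finite sum over the patterns X on A of its value at X times the
  indicator of that pattern, hence a polynomial in finitely many coordinates.\<close>

lemma bcontfun_of_local_fun:
  assumes "local_fun f"
  shows "f \<in> bcontfun"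
proof -
  obtain A where A: "finite A" "depends_on A f"
    using assms unfolding local_fun_def depends_on_def by blast
  have eq: "f = (\<lambda>\<eta>. \<Sum>X\<in>Pow A. f (\<lambda>x. x \<in> X) * (\<Prod>x\<in>A. of_bool (\<eta> x = (x \<in> X))))"
  proof
    fix \<eta>
    have "(\<Prod>x\<in>A. of_bool (\<eta> x = (x \<in> X))) = (of_bool (X = {x\<in>A. \<eta> x}) :: real)" if "X \<in> Pow A" for X
    proof (cases "X = {x\<in>A. \<eta> x}")
      case True then show ?thesis by (auto intro!: prod.neutral)
    next
      case False
      then obtain x where "x \<in> A" "\<eta> x \<noteq> (x \<in> X)" using \<open>X \<in> Pow A\<close> by blast
      then have "(\<Prod>x\<in>A. of_bool (\<eta> x = (x \<in> X))) = (0::real)" using A(1) by (intro prod_zero) auto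
      with False show ?thesis by simp
    qed
    then have "(\<Sum>X\<in>Pow A. f (\<lambda>x. x \<in> X) * (\<Prod>x\<in>A. of_bool (\<eta> x = (x \<in> X))))
       = (\<Sum>X\<in>Pow A. if X = {x\<in>A. \<eta> x} then f (\<lambda>x. x \<in> X) else 0)"
      by (intro sum.cong) auto
    also have "\<dots> = f (\<lambda>x. x \<in> {x\<in>A. \<eta> x})" using A(1) by (subst sum.delta) auto
    also have "\<dots> = f \<eta>" using A(2) by (auto simp: depends_on_def)
    finally show "f \<eta> = (\<Sum>X\<in>Pow A. f (\<lambda>x. x \<in> X) * (\<Prod>x\<in>A. of_bool (\<eta> x = (x \<in> X))))" ..
  qed
  show ?thesis
  proof (rule bcontfun_normI)
    have "continuous_on UNIV (\<lambda>\<eta> :: 'a config. of_bool (\<eta> x = b) :: real)" for x b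
    proof -
      have "continuous_on UNIV (\<lambda>a :: bool. of_bool (a = b) :: real)" by simp
      from continuous_on_compose2[OF this continuous_on_product_coordinates[of x]] show ?thesis by simp
    qed
    then show "continuous_on UNIV f"
      by (subst eq) (intro continuous_intros)
    show "norm (f \<eta>) \<le> (\<Sum>X\<in>Pow A. \<bar>f (\<lambda>x. x \<in> X)\<bar>)" for \<eta>
    proof -
      have "norm (f \<eta>) = \<bar>\<Sum>X\<in>Pow A. f (\<lambda>x. x \<in> X) * (\<Prod>x\<in>A. of_bool (\<eta> x = (x \<in> X)))\<bar>"
        by (subst eq) simp
      also have "\<dots> \<le> (\<Sum>X\<in>Pow A. \<bar>f (\<lambda>x. x \<in> X)\<bar> * 1)"
        by (intro order_trans[OF sum_abs] sum_mono)
           (auto simp: abs_mult abs_prod intro!: mult_left_le prod_le_1)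
      finally show ?thesis by simp
    qed
  qed
qed

lemma apply_local_fun: "local_fun f \<Longrightarrow> apply_bcontfun (Bcontfun f) = f"
  by (simp add: Bcontfun_inverse bcontfun_of_local_fun)

lemma exchange_sites:
  "exchange x y \<eta> x = \<eta> y" "exchange x y \<eta> y = \<eta> x" "z \<noteq> x \<Longrightarrow> z \<noteq> y \<Longrightarrow> exchange x y \<eta> z = \<eta> z"
  by (auto simp: exchange_def)

lemma ssep_op_eq_sum:
  fixes f :: "'n::finite config \<Rightarrow> real"
  assumes P: "finite P" "\<And>x e. (x, e) \<in> P \<Longrightarrow> e \<in> nbrs"
    and f: "\<And>x e. e \<in> nbrs \<Longrightarrow> (x, e) \<notin> P \<Longrightarrow> f (exchange x (x + e) \<eta>) = f \<eta>"
  shows "ssep_op f \<eta> = (\<Sum>(x, e)\<in>P. of_bool (\<eta> x) * (1 - of_bool (\<eta> (x + e))) * (f (exchange x (x + e) \<eta>) - f \<eta>))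
     / (2 * real CARD('n))"
proof -
  let ?t = "\<lambda>x e. of_bool (\<eta> x) * (1 - of_bool (\<eta> (x + e))) * (f (exchange x (x + e) \<eta>) - f \<eta>)"
  have "{y. nbr x y} = (+) x ` nbrs" for x :: "int ^ 'n"
    by (auto simp: nbr_iff image_iff) (metis add_diff_cancel_left' add.commute diff_add_cancel)
  then have 1: "(\<Sum>y | nbr x y. of_bool (\<eta> x) * (1 - of_bool (\<eta> y)) * (f (exchange x y \<eta>) - f \<eta>))
      = (\<Sum>e\<in>nbrs. ?t x e)" for x
    by (simp add: sum.reindex)
  have "(\<Sum>\<^sub>\<infinity>x. \<Sum>e\<in>nbrs. ?t x e) = (\<Sum>\<^sub>\<infinity>x\<in>fst ` P. \<Sum>e\<in>nbrs. ?t x e)"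
  proof (rule infsum_cong_neutral)
    fix x assume "x \<in> UNIV - fst ` P"
    then have "(x, e) \<notin> P" for e by force
    then show "(\<Sum>e\<in>nbrs. ?t x e) = 0" by (intro sum.neutral) (simp add: f)
  qed auto
  also have "\<dots> = (\<Sum>x\<in>fst ` P. \<Sum>e\<in>nbrs. ?t x e)" using P(1) by simp
  also have "\<dots> = (\<Sum>(x, e)\<in>fst ` P \<times> nbrs. ?t x e)" by (rule sum.cartesian_product)
  also have "\<dots> = (\<Sum>(x, e)\<in>P. ?t x e)"
    using P by (intro sum.mono_neutral_right) (force simp: f)+
  finally show ?thesis unfolding ssep_op_def 1 by simp
qed

text \<open>Dependence spreads by one step: G adds to A the ends of all bonds that touch it. This
  makes \<open>ssep_op f\<close> bounded and continuous, as needed to place its pair with f in the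
  generator.\<close>

lemma local_fun_ssep_op:
  fixes f :: "'n::finite config \<Rightarrow> real"
  assumes "local_fun f"
  shows "local_fun (ssep_op f)"
proof -
  obtain A where A: "finite A" "depends_on A f"
    using assms unfolding local_fun_def depends_on_def by blast
  define P where "P = (\<Union>e\<in>nbrs. (\<lambda>x. (x, e)) ` (A \<union> (\<lambda>x. x - e) ` A))"
  have P: "finite P" "\<And>x e. (x, e) \<in> P \<Longrightarrow> e \<in> nbrs" using A(1) by (auto simp: P_def)
  have f: "f (exchange x (x + e) \<eta>) = f \<eta>" if "e \<in> nbrs" "(x, e) \<notin> P" for x e \<eta>
  proof -
    have "x \<notin> A" "x + e \<notin> A" using that by (auto simp: P_def image_iff)
    then have "\<forall>z\<in>A. exchange x (x + e) \<eta> z = \<eta> z" by (auto simp: exchange_def)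
    then show ?thesis using A(2) by (auto simp: depends_on_def)
  qed
  define G where "G = A \<union> fst ` P \<union> (\<lambda>(x, e). x + e) ` P"
  have "depends_on G (ssep_op f)" unfolding depends_on_def
  proof (intro allI impI)
    fix \<eta> \<zeta> :: "'n config"
    assume eq: "\<forall>x\<in>G. \<eta> x = \<zeta> x"
    have "f \<eta> = f \<zeta>" using eq A(2) by (auto simp: depends_on_def G_def)
    moreover have "f (exchange x (x + e) \<eta>) = f (exchange x (x + e) \<zeta>)" "\<eta> x = \<zeta> x" "\<eta> (x + e) = \<zeta> (x + e)"
      if "(x, e) \<in> P" for x e
    proof -
      show *: "\<eta> x = \<zeta> x" "\<eta> (x + e) = \<zeta> (x + e)" using that eq by (force simp: G_def)+
      have "\<forall>z\<in>A. exchange x (x + e) \<eta> z = exchange x (x + e) \<zeta> z"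
        using * eq by (auto simp: exchange_def G_def)
      then show "f (exchange x (x + e) \<eta>) = f (exchange x (x + e) \<zeta>)" using A(2) by (auto simp: depends_on_def)
    qed
    moreover have "ssep_op f \<xi> = (\<Sum>(x, e)\<in>P. of_bool (\<xi> x) * (1 - of_bool (\<xi> (x + e))) * (f (exchange x (x + e) \<xi>) - f \<xi>))
        / (2 * real CARD('n))" for \<xi>
      using P f by (intro ssep_op_eq_sum) auto
    ultimately show "ssep_op f \<eta> = ssep_op f \<zeta>"
      by (auto intro!: arg_cong2[of _ _ _ _ "(/)"] sum.cong)
  qed
  moreover have "finite G" using A(1) P(1) by (simp add: G_def)
  ultimately show ?thesis by (rule local_funI[rotated])
qed

text \<open>With \<open>v\<close> constant equal to \<theta>, the mean is the generating function,
  at 1 - \<theta>, of the number of particles in \<Lambda>. With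
  \<open>v x = \<theta> * hit \<tau> B x\<close> it is the generating function for B after the
  particles of \<eta> in \<Lambda> have walked independently for a time \<tau>.\<close>

definition Phi :: "(int ^ 'n::finite) set \<Rightarrow> (int ^ 'n \<Rightarrow> real) \<Rightarrow> 'n config \<Rightarrow> real" where
  "Phi \<Lambda> v \<eta> = (\<Prod>x\<in>\<Lambda>. 1 - v x * of_bool (\<eta> x))"

lemma local_fun_Phi: "finite \<Lambda> \<Longrightarrow> local_fun (Phi \<Lambda> v)"
  by (rule local_funI[of \<Lambda>]) (auto simp: depends_on_def Phi_def intro!: prod.cong)

lemma Phi_nonneg: "(\<And>x. v x \<le> 1) \<Longrightarrow> 0 \<le> Phi \<Lambda> v \<eta>"
  by (auto simp: Phi_def intro!: prod_nonneg)

lemma Phi_le_1: "(\<And>x. 0 \<le> v x) \<Longrightarrow> (\<And>x. v x \<le> 1) \<Longrightarrow> Phi \<Lambda> v \<eta> \<le> 1"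
  by (auto simp: Phi_def intro!: prod_le_1)

lemma Phi_remove:
  assumes "finite \<Lambda>" "\<And>z. z \<notin> \<Lambda> \<Longrightarrow> v z = 0"
  shows "Phi \<Lambda> v \<eta> = (1 - v x * of_bool (\<eta> x)) * Phi (\<Lambda> - {x}) v \<eta>"
proof (cases "x \<in> \<Lambda>")
  case True then show ?thesis using assms by (simp add: Phi_def prod.remove)
next
  case False then show ?thesis using assms by simp
qed

lemma Phi_remove2:
  assumes "finite \<Lambda>" "\<And>z. z \<notin> \<Lambda> \<Longrightarrow> v z = 0" "x \<noteq> y"
  shows "Phi (\<Lambda> - {x}) v \<eta> = (1 - v y * of_bool (\<eta> y)) * Phi (\<Lambda> - {x, y}) v \<eta>"
proof -
  have eq: "\<Lambda> - {x, y} = \<Lambda> - {x} - {y}" by auto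
  show ?thesis
  proof (cases "y \<in> \<Lambda>")
    case True
    then show ?thesis using assms unfolding eq Phi_def by (subst prod.remove[of _ y]) auto
  next
    case False
    then show ?thesis using assms unfolding eq by simp
  qed
qed

text \<open>With x occupied and y empty the exchange moves a single particle, so the factor 1 - v x
  turns into 1 - v y and all others stay.\<close>

lemma Phi_exchange_diff:
  assumes "finite \<Lambda>" "\<And>z. z \<notin> \<Lambda> \<Longrightarrow> v z = 0" "x \<noteq> y"
  shows "of_bool (\<eta> x) * (1 - of_bool (\<eta> y)) * (Phi \<Lambda> v (exchange x y \<eta>) - Phi \<Lambda> v \<eta>)
     = of_bool (\<eta> x) * (1 - of_bool (\<eta> y)) * (Phi (\<Lambda> - {x, y}) v \<eta> * (v x - v y))"
proof -
  have ex: "Phi (\<Lambda> - {x, y}) v (exchange x y \<eta>) = Phi (\<Lambda> - {x, y}) v \<eta>"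
    unfolding Phi_def by (intro prod.cong) (auto simp: exchange_def)
  have split: "Phi \<Lambda> v \<zeta> = (1 - v x * of_bool (\<zeta> x)) * ((1 - v y * of_bool (\<zeta> y)) * Phi (\<Lambda> - {x, y}) v \<zeta>)" for \<zeta>
    using Phi_remove[OF assms(1,2), where x = x and \<eta> = \<zeta>] Phi_remove2[OF assms, where \<eta> = \<zeta>] by simp
  show ?thesis
    unfolding split[of "exchange x y \<eta>"] split[of \<eta>] ex
    by (simp add: exchange_sites algebra_simps)
qed

text \<open>Bonds are directed: each undirected one occurs as (x, e) and as (x + e, - e).\<close>

definition bonds :: "(int ^ 'n::finite) set \<Rightarrow> ((int ^ 'n) \<times> (int ^ 'n)) set" where
  "bonds \<Lambda> = {(x, e). e \<in> nbrs \<and> (x \<in> \<Lambda> \<or> x + e \<in> \<Lambda>)}"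

lemma finite_bonds: "finite \<Lambda> \<Longrightarrow> finite (bonds \<Lambda>)"
proof -
  assume "finite \<Lambda>"
  moreover have "bonds \<Lambda> \<subseteq> (\<Union>e\<in>nbrs. (\<lambda>x. (x, e)) ` (\<Lambda> \<union> (\<lambda>x. x - e) ` \<Lambda>))"
    by (auto simp: bonds_def image_iff) (metis add_diff_cancel_right')
  ultimately show ?thesis by (auto intro: finite_subset)
qed

lemma sum_bonds_reverse:
  "(\<Sum>(x, e)\<in>bonds \<Lambda>. g x (x + e)) = (\<Sum>(x, e)\<in>bonds \<Lambda>. g (x + e) x)"
  by (rule sum.reindex_bij_witness[of _ "\<lambda>(x, e). (x + e, - e)" "\<lambda>(x, e). (x + e, - e)"])
     (auto simp: bonds_def uminus_nbrs)

text \<open>The second sum is the amount by which two exclusion particles on a bond differ from two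
  independent ones; it is nonnegative.\<close>

lemma ssep_op_Phi:
  fixes v :: "int ^ 'n::finite \<Rightarrow> real"
  assumes "finite \<Lambda>" "\<And>z. z \<notin> \<Lambda> \<Longrightarrow> v z = 0"
  shows "ssep_op (Phi \<Lambda> v) \<eta> =
      (\<Sum>(x, e)\<in>bonds \<Lambda>. of_bool (\<eta> x) * Phi (\<Lambda> - {x}) v \<eta> * (v x - v (x + e))) / (2 * real CARD('n))
    - (\<Sum>(x, e)\<in>bonds \<Lambda>. of_bool (\<eta> x) * of_bool (\<eta> (x + e)) * Phi (\<Lambda> - {x, x + e}) v \<eta> * (v x - v (x + e))\<^sup>2) / (4 * real CARD('n))"
proof -
  let ?a = "\<lambda>x y. of_bool (\<eta> x) * of_bool (\<eta> y) * Phi (\<Lambda> - {x, y}) v \<eta> * ((1 - v y) * (v x - v y))"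
  let ?q = "\<lambda>x y. of_bool (\<eta> x) * of_bool (\<eta> y) * Phi (\<Lambda> - {x, y}) v \<eta> * (v x - v y)\<^sup>2"
  have ne: "x \<noteq> x + e" if "(x, e) \<in> bonds \<Lambda>" for x e
    using that by (auto simp: bonds_def)
  have "ssep_op (Phi \<Lambda> v) \<eta> = (\<Sum>(x, e)\<in>bonds \<Lambda>. of_bool (\<eta> x) * (1 - of_bool (\<eta> (x + e)))
       * (Phi \<Lambda> v (exchange x (x + e) \<eta>) - Phi \<Lambda> v \<eta>)) / (2 * real CARD('n))"
  proof (rule ssep_op_eq_sum[OF finite_bonds[OF assms(1)]])
    show "Phi \<Lambda> v (exchange x (x + e) \<eta>) = Phi \<Lambda> v \<eta>" if "e \<in> nbrs" "(x, e) \<notin> bonds \<Lambda>" for x e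
      using that unfolding Phi_def by (intro prod.cong) (auto simp: bonds_def exchange_def)
  qed (auto simp: bonds_def)
  also have "(\<Sum>(x, e)\<in>bonds \<Lambda>. of_bool (\<eta> x) * (1 - of_bool (\<eta> (x + e)))
       * (Phi \<Lambda> v (exchange x (x + e) \<eta>) - Phi \<Lambda> v \<eta>))
     = (\<Sum>(x, e)\<in>bonds \<Lambda>. of_bool (\<eta> x) * Phi (\<Lambda> - {x}) v \<eta> * (v x - v (x + e)) - ?a x (x + e))"
  proof (intro sum.cong refl, clarify)
    fix x e assume "(x, e) \<in> bonds \<Lambda>"
    from ne[OF this] have n: "x \<noteq> x + e" .
    have 1: "of_bool (\<eta> x) * (1 - of_bool (\<eta> (x + e))) * (Phi \<Lambda> v (exchange x (x + e) \<eta>) - Phi \<Lambda> v \<eta>)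
        = of_bool (\<eta> x) * (1 - of_bool (\<eta> (x + e))) * (Phi (\<Lambda> - {x, x + e}) v \<eta> * (v x - v (x + e)))"
      using assms n by (rule Phi_exchange_diff)
    have 2: "Phi (\<Lambda> - {x}) v \<eta> = (1 - v (x + e) * of_bool (\<eta> (x + e))) * Phi (\<Lambda> - {x, x + e}) v \<eta>"
      using assms n by (rule Phi_remove2)
    show "of_bool (\<eta> x) * (1 - of_bool (\<eta> (x + e))) * (Phi \<Lambda> v (exchange x (x + e) \<eta>) - Phi \<Lambda> v \<eta>)
      = of_bool (\<eta> x) * Phi (\<Lambda> - {x}) v \<eta> * (v x - v (x + e)) - ?a x (x + e)"
      unfolding 1 2 by (auto simp: algebra_simps)
  qed
  also have "\<dots> = (\<Sum>(x, e)\<in>bonds \<Lambda>. of_bool (\<eta> x) * Phi (\<Lambda> - {x}) v \<eta> * (v x - v (x + e))) - (\<Sum>(x, e)\<in>bonds \<Lambda>. ?a x (x + e))"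
    by (simp add: sum_subtractf case_prod_unfold)
  \<comment> \<open>Adding the two orientations of a bond: (1 - v y)(v x - v y) + (1 - v x)(v y - v
    x) = (v x - v y)^2.\<close>
  also have "(\<Sum>(x, e)\<in>bonds \<Lambda>. ?a x (x + e)) = (\<Sum>(x, e)\<in>bonds \<Lambda>. ?q x (x + e)) / 2"
  proof -
    have "2 * (\<Sum>(x, e)\<in>bonds \<Lambda>. ?a x (x + e)) = (\<Sum>(x, e)\<in>bonds \<Lambda>. ?a x (x + e)) + (\<Sum>(x, e)\<in>bonds \<Lambda>. ?a (x + e) x)"
      using sum_bonds_reverse[of ?a \<Lambda>] by simp
    also have "\<dots> = (\<Sum>(x, e)\<in>bonds \<Lambda>. ?q x (x + e))"
      unfolding sum.distrib[symmetric]
      by (intro sum.cong refl) (auto simp: algebra_simps power2_eq_square insert_commute)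
    finally show ?thesis by simp
  qed
  finally show ?thesis by (simp add: diff_divide_distrib)
qed

section \<open>Product functions with time-dependent weights\<close>

lemma has_real_derivative_prod:
  fixes f :: "'i \<Rightarrow> real \<Rightarrow> real"
  assumes "\<And>i. i \<in> I \<Longrightarrow> (f i has_real_derivative f' i) (at x within S)"
  shows "((\<lambda>x. \<Prod>i\<in>I. f i x) has_real_derivative (\<Sum>i\<in>I. f' i * (\<Prod>j\<in>I - {i}. f j x))) (at x within S)"
proof -
  have "((\<lambda>x. \<Prod>i\<in>I. f i x) has_derivative (\<lambda>y. \<Sum>i\<in>I. (f' i * y) * (\<Prod>j\<in>I - {i}. f j x))) (at x within S)"
    using assms unfolding has_field_derivative_def by (rule has_derivative_prod)
  moreover have "(\<lambda>y. \<Sum>i\<in>I. (f' i * y) * (\<Prod>j\<in>I - {i}. f j x)) = (*) (\<Sum>i\<in>I. f' i * (\<Prod>j\<in>I - {i}. f j x))"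
    by (auto simp: fun_eq_iff sum_distrib_left mult_ac)
  ultimately show ?thesis unfolding has_field_derivative_def by simp
qed

text \<open>The derivative is needed in the supremum norm. Expanding the product over subsets
  confines the time dependence to finitely many scalar coefficients, which gives existence; the
  value at each configuration then follows from differentiating the product directly, by uniqueness
  of derivatives.\<close>

lemma Phi_curve_derivative:
  fixes v v' :: "real \<Rightarrow> int ^ 'n::finite \<Rightarrow> real"
  assumes "finite \<Lambda>" "\<And>x \<tau>. \<tau> \<ge> 0 \<Longrightarrow> ((\<lambda>\<tau>. v \<tau> x) has_real_derivative v' \<tau> x) (at \<tau> within {0..})"
  obtains F' where
    "\<And>\<tau>. \<tau> \<ge> 0 \<Longrightarrow> ((\<lambda>\<tau>. Bcontfun (Phi \<Lambda> (v \<tau>))) has_vector_derivative F' \<tau>) (at \<tau> within {0..})"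
    "\<And>\<tau> \<eta>. \<tau> \<ge> 0 \<Longrightarrow> apply_bcontfun (F' \<tau>) \<eta> = - (\<Sum>x\<in>\<Lambda>. of_bool (\<eta> x) * Phi (\<Lambda> - {x}) (v \<tau>) \<eta> * v' \<tau> x)"
proof -
  define ch where "ch X = Bcontfun (\<lambda>\<eta>. \<Prod>x\<in>X. of_bool (\<eta> x) :: real)" for X :: "(int ^ 'n) set"
  have ch: "apply_bcontfun (ch X) = (\<lambda>\<eta>. \<Prod>x\<in>X. of_bool (\<eta> x))" if "finite X" for X
    unfolding ch_def by (intro apply_local_fun local_funI[OF that]) (auto simp: depends_on_def intro!: prod.cong)
  have exp: "Bcontfun (Phi \<Lambda> (v \<tau>)) = (\<Sum>X\<in>Pow \<Lambda>. (\<Prod>x\<in>X. - v \<tau> x) *\<^sub>R ch X)" for \<tau>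
  proof (rule bcontfun_eqI)
    fix \<eta>
    have "apply_bcontfun (\<Sum>X\<in>Pow \<Lambda>. (\<Prod>x\<in>X. - v \<tau> x) *\<^sub>R ch X) \<eta> = (\<Sum>X\<in>Pow \<Lambda>. apply_bcontfun ((\<Prod>x\<in>X. - v \<tau> x) *\<^sub>R ch X) \<eta>)"
      by (rule bounded_linear.linear[OF bounded_linear_apply_bcontfun, THEN linear_sum])
    also have "\<dots> = (\<Sum>X\<in>Pow \<Lambda>. (\<Prod>x\<in>X. - v \<tau> x * of_bool (\<eta> x)) * (\<Prod>x\<in>\<Lambda> - X. 1))"
      using assms(1) by (intro sum.cong refl) (auto simp: ch finite_subset simp flip: prod.distrib)
    also have "\<dots> = (\<Prod>x\<in>\<Lambda>. - v \<tau> x * of_bool (\<eta> x) + 1)"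
      by (rule prod_add[OF assms(1), symmetric])
    finally show "apply_bcontfun (Bcontfun (Phi \<Lambda> (v \<tau>))) \<eta> = apply_bcontfun (\<Sum>X\<in>Pow \<Lambda>. (\<Prod>x\<in>X. - v \<tau> x) *\<^sub>R ch X) \<eta>"
      using assms(1) by (simp add: apply_local_fun local_fun_Phi Phi_def)
  qed
  define F' where "F' \<tau> = (\<Sum>X\<in>Pow \<Lambda>. (\<Sum>x\<in>X. - v' \<tau> x * (\<Prod>y\<in>X - {x}. - v \<tau> y)) *\<^sub>R ch X)" for \<tau>
  have F': "((\<lambda>\<tau>. Bcontfun (Phi \<Lambda> (v \<tau>))) has_vector_derivative F' \<tau>) (at \<tau> within {0..})" if "\<tau> \<ge> 0" for \<tau>
    unfolding exp F'_def
  proof (rule has_vector_derivative_sum)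
    fix X
    have "((\<lambda>\<tau>. \<Prod>x\<in>X. - v \<tau> x) has_real_derivative (\<Sum>x\<in>X. - v' \<tau> x * (\<Prod>y\<in>X - {x}. - v \<tau> y))) (at \<tau> within {0..})"
      by (intro has_real_derivative_prod DERIV_minus assms(2) that)
    from has_vector_derivative_scaleR[OF this has_vector_derivative_const[of "ch X"]]
    show "((\<lambda>\<tau>. (\<Prod>x\<in>X. - v \<tau> x) *\<^sub>R ch X) has_vector_derivative (\<Sum>x\<in>X. - v' \<tau> x * (\<Prod>y\<in>X - {x}. - v \<tau> y)) *\<^sub>R ch X) (at \<tau> within {0..})"
      by simp
  qed
  moreover have "apply_bcontfun (F' \<tau>) \<eta> = - (\<Sum>x\<in>\<Lambda>. of_bool (\<eta> x) * Phi (\<Lambda> - {x}) (v \<tau>) \<eta> * v' \<tau> x)" if "\<tau> \<ge> 0" for \<tau> \<eta>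
  proof -
    have "((\<lambda>\<tau>. apply_bcontfun (Bcontfun (Phi \<Lambda> (v \<tau>))) \<eta>) has_vector_derivative apply_bcontfun (F' \<tau>) \<eta>) (at \<tau> within {0..})"
      by (rule bounded_linear.has_vector_derivative[OF bounded_linear_apply_bcontfun F'[OF that]])
    then have 1: "((\<lambda>\<tau>. Phi \<Lambda> (v \<tau>) \<eta>) has_real_derivative apply_bcontfun (F' \<tau>) \<eta>) (at \<tau> within {0..})"
      using assms(1) by (simp add: apply_local_fun local_fun_Phi has_real_derivative_iff_has_vector_derivative)
    have 2: "((\<lambda>\<tau>. Phi \<Lambda> (v \<tau>) \<eta>) has_real_derivative
        (\<Sum>x\<in>\<Lambda>. (0 - v' \<tau> x * of_bool (\<eta> x)) * (\<Prod>y\<in>\<Lambda> - {x}. 1 - v \<tau> y * of_bool (\<eta> y)))) (at \<tau> within {0..})"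
      unfolding Phi_def
      by (intro has_real_derivative_prod DERIV_diff DERIV_const DERIV_cmult_right assms(2) that)
    have "at \<tau> within {0..} \<noteq> bot"
    proof -
      have "at \<tau> within {\<tau>..} \<le> at \<tau> within {0..}" using that by (intro at_le) auto
      then show ?thesis using trivial_limit_at_right_real[of \<tau>]
        by (metis at_within_Ici_at_right bot.extremum_uniqueI)
    qed
    from vector_derivative_unique_within[OF this] 1 2
    have "apply_bcontfun (F' \<tau>) \<eta> = (\<Sum>x\<in>\<Lambda>. (0 - v' \<tau> x * of_bool (\<eta> x)) * (\<Prod>y\<in>\<Lambda> - {x}. 1 - v \<tau> y * of_bool (\<eta> y)))"
      unfolding has_real_derivative_iff_has_vector_derivative by blast
    then show ?thesis by (simp add: Phi_def sum_negf mult_ac)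
  qed
  ultimately show ?thesis using that by blast
qed

lemma walk_tight_finite:
  fixes B :: "(int ^ 'n::finite) set"
  assumes "finite B" "\<epsilon> > 0" "t \<ge> 0"
  obtains \<Lambda> where "finite \<Lambda>" "B \<subseteq> \<Lambda>" "\<And>\<tau>. \<tau> \<in> {0..t} \<Longrightarrow> (\<Sum>b\<in>B. hit \<tau> (- \<Lambda>) b) \<le> \<epsilon>"
proof -
  obtain V :: "(int ^ 'n) set" where V: "finite V" "\<forall>\<tau>\<in>{0..t}. measure (walk \<tau>) (- V) \<le> \<epsilon> / (card B + 1)"
    using walk_tight[of "\<epsilon> / (card B + 1)" t] assms by auto
  define \<Lambda> where "\<Lambda> = B \<union> (\<Union>b\<in>B. (+) b ` V)"
  have "(\<Sum>b\<in>B. hit \<tau> (- \<Lambda>) b) \<le> \<epsilon>" if "\<tau> \<in> {0..t}" for \<tau>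
  proof -
    have "(\<Sum>b\<in>B. hit \<tau> (- \<Lambda>) b) \<le> (\<Sum>b\<in>B. \<epsilon> / (card B + 1))"
    proof (rule sum_mono)
      fix b assume "b \<in> B"
      then have "hit \<tau> (- \<Lambda>) b \<le> measure (walk \<tau>) (- V)"
        unfolding hit_def by (intro measure_pmf.finite_measure_mono) (auto simp: \<Lambda>_def)
      then show "hit \<tau> (- \<Lambda>) b \<le> \<epsilon> / (card B + 1)" using V(2) that by fastforce
    qed
    also have "\<dots> \<le> \<epsilon>" using assms by (simp add: field_simps)
    finally show ?thesis .
  qed
  then show ?thesis using assms(1) V(1) by (intro that[of \<Lambda>]) (auto simp: \<Lambda>_def)
qed

text \<open>For a fixed direction the sites \<open>h x e\<close> are distinct and lie outside
  \<Lambda>0, so each of the 2 d directions contributes at most \<epsilon>.\<close>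

lemma sum_crossing_le:
  fixes w :: "int ^ 'n::finite \<Rightarrow> real" and h :: "int ^ 'n \<Rightarrow> int ^ 'n \<Rightarrow> int ^ 'n"
  assumes C: "finite C" "\<And>x e. (x, e) \<in> C \<Longrightarrow> e \<in> nbrs \<and> h x e \<notin> \<Lambda>0"
    and inj: "\<And>x y e. h x e = h y e \<Longrightarrow> x = y"
    and w: "\<And>F. finite F \<Longrightarrow> F \<inter> \<Lambda>0 = {} \<Longrightarrow> (\<Sum>x\<in>F. w x) \<le> \<epsilon>"
  shows "(\<Sum>(x, e)\<in>C. w (h x e)) \<le> 2 * real CARD('n) * \<epsilon>"
proof -
  have "(\<Sum>(x, e)\<in>C. w (h x e)) = (\<Sum>e\<in>nbrs. \<Sum>p\<in>{p\<in>C. snd p = e}. w (h (fst p) (snd p)))"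
    using C by (subst sum.group) (auto simp: case_prod_unfold)
  also have "\<dots> \<le> (\<Sum>e\<in>(nbrs :: (int ^ 'n) set). \<epsilon>)"
  proof (rule sum_mono)
    fix e :: "int ^ 'n"
    let ?P = "{p\<in>C. snd p = e}"
    have "(\<Sum>p\<in>?P. w (h (fst p) (snd p))) = (\<Sum>z\<in>(\<lambda>p. h (fst p) (snd p)) ` ?P. w z)"
      by (rule sum.reindex_cong[symmetric, OF _ refl refl]) (auto simp: inj_on_def dest: inj)
    also have "\<dots> \<le> \<epsilon>" using C by (intro w) auto
    finally show "(\<Sum>p\<in>?P. w (h (fst p) (snd p))) \<le> \<epsilon>" .
  qed
  also have "\<dots> = 2 * real CARD('n) * \<epsilon>" by (simp add: card_nbrs)
  finally show ?thesis .
qed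

text \<open>Truncation to a finite set. On bonds inside \<Lambda> the choice of \<open>v'\<close> by
  the backward equation cancels the first-order part of \<open>ssep_op_Phi\<close>; it survives only
  on bonds with exactly one end in \<Lambda>. Since \<Lambda> contains all neighbours of \<Lambda>0,
  both ends of such a bond lie outside \<Lambda>0, where \<open>w\<close> sums to at most
  \<epsilon>.\<close>

lemma ssep_op_Phi_bounds:
  fixes w v v' :: "int ^ 'n::finite \<Rightarrow> real" and \<Lambda> \<Lambda>0 :: "(int ^ 'n) set"
  assumes \<Lambda>_def: "\<Lambda> = \<Lambda>0 \<union> (\<Union>e\<in>nbrs. (\<lambda>x. x + e) ` \<Lambda>0)"
    and v_def: "\<And>x. v x = (if x \<in> \<Lambda> then \<theta> * w x else 0)"
    and v'_def: "\<And>x. v' x = (if x \<in> \<Lambda> then \<theta> * ((\<Sum>e\<in>nbrs. w (x + e)) / (2 * CARD('n)) - w x) else 0)"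
    and fin: "finite \<Lambda>0" and w01: "\<And>x. 0 \<le> w x" "\<And>x. w x \<le> 1" and \<theta>: "0 \<le> \<theta>" "\<theta> \<le> 1"
    and w: "\<And>F. finite F \<Longrightarrow> F \<inter> \<Lambda>0 = {} \<Longrightarrow> (\<Sum>x\<in>F. w x) \<le> \<epsilon>"
  shows "ssep_op (Phi \<Lambda> v) \<zeta> + (\<Sum>x\<in>\<Lambda>. of_bool (\<zeta> x) * Phi (\<Lambda> - {x}) v \<zeta> * v' x) \<le> \<theta> * \<epsilon>"
    (is "?L \<le> _")
    and "ssep_op (Phi \<Lambda> v) \<zeta> + (\<Sum>x\<in>\<Lambda>. of_bool (\<zeta> x) * Phi (\<Lambda> - {x}) v \<zeta> * v' x) \<ge> - 2 * \<theta> * \<epsilon> - (\<Sum>(x, e) | e \<in> nbrs \<and> x \<in> \<Lambda> \<and> x + e \<in> \<Lambda>. of_bool (\<zeta> x) * of_bool (\<zeta> (x + e)) * (\<theta> * (w x - w (x + e)))\<^sup>2) / (4 * CARD('n))"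
proof -
  have fin\<Lambda>: "finite \<Lambda>" using fin by (simp add: \<Lambda>_def)
  have v0: "z \<notin> \<Lambda> \<Longrightarrow> v z = 0" for z by (simp add: v_def)
  have v01: "0 \<le> v x" "v x \<le> 1" for x
    using \<theta> w01[of x] by (auto simp: v_def mult_le_one)
  have R01: "0 \<le> Phi X v \<zeta>" "Phi X v \<zeta> \<le> 1" for X
    using v01 by (auto intro!: Phi_nonneg Phi_le_1)
  define I where "I = {(x, e). e \<in> nbrs \<and> x \<in> \<Lambda> \<and> x + e \<in> \<Lambda>}"
  define C where "C = {(x, e). e \<in> nbrs \<and> (x \<in> \<Lambda>) \<noteq> (x + e \<in> \<Lambda>)}"
  have bonds: "bonds \<Lambda> = I \<union> C" "I \<inter> C = {}" by (auto simp: bonds_def I_def C_def)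
  then have finIC: "finite I" "finite C" using finite_bonds[OF fin\<Lambda>] by auto
  have C0: "x \<notin> \<Lambda>0 \<and> x + e \<notin> \<Lambda>0" if "(x, e) \<in> C" for x e
  proof -
    have 1: "x \<in> \<Lambda>0 \<Longrightarrow> x + e \<in> \<Lambda>" using that by (auto simp: C_def \<Lambda>_def)
    have 2: "x + e \<in> \<Lambda>0 \<Longrightarrow> x \<in> \<Lambda>"
    proof -
      assume "x + e \<in> \<Lambda>0"
      moreover have "-e \<in> nbrs" using that by (auto simp: C_def uminus_nbrs)
      moreover have "x = (x + e) + (-e)" by simp
      ultimately show "x \<in> \<Lambda>" unfolding \<Lambda>_def by blast
    qed
    show ?thesis using 1 2 that by (auto simp: C_def \<Lambda>_def)
  qed
  have sC1: "(\<Sum>(x, e)\<in>C. w (x + e)) \<le> 2 * real CARD('n) * \<epsilon>"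
    by (rule sum_crossing_le[OF finIC(2) _ _ w]) (use C0 in \<open>auto simp: C_def\<close>)
  have sC2: "(\<Sum>(x, e)\<in>C. w x) \<le> 2 * real CARD('n) * \<epsilon>"
    by (rule sum_crossing_le[OF finIC(2), where h = "\<lambda>x e. x", OF _ _ w]) (use C0 in \<open>auto simp: C_def\<close>)
  define Q where "Q = (\<Sum>(x, e)\<in>bonds \<Lambda>. of_bool (\<zeta> x) * of_bool (\<zeta> (x + e)) * Phi (\<Lambda> - {x, x + e}) v \<zeta> * (v x - v (x + e))\<^sup>2) / (4 * real CARD('n))"
  define br where "br x e = (v x - v (x + e)) + (if x \<in> \<Lambda> then \<theta> * (w (x + e) - w x) else 0)" for x e
  have part1: "?L = (\<Sum>(x, e)\<in>bonds \<Lambda>. of_bool (\<zeta> x) * Phi (\<Lambda> - {x}) v \<zeta> * br x e) / (2 * real CARD('n)) - Q"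
  proof -
    have "(\<Sum>x\<in>\<Lambda>. of_bool (\<zeta> x) * Phi (\<Lambda> - {x}) v \<zeta> * v' x)
       = (\<Sum>x\<in>\<Lambda>. \<Sum>e\<in>nbrs. of_bool (\<zeta> x) * Phi (\<Lambda> - {x}) v \<zeta> * (\<theta> * (w (x + e) - w x)) / (2 * real CARD('n)))"
    proof (intro sum.cong refl)
      fix x assume "x \<in> \<Lambda>"
      have "(\<Sum>e\<in>nbrs. c * (\<theta> * (w (x + e) - w x)) / (2 * real CARD('n)))
          = c * (\<theta> * ((\<Sum>e\<in>nbrs. w (x + e)) - 2 * real CARD('n) * w x)) / (2 * real CARD('n))" for c
        by (simp add: sum_divide_distrib[symmetric] sum_distrib_left[symmetric] sum_subtractf card_nbrs)
      then show "of_bool (\<zeta> x) * Phi (\<Lambda> - {x}) v \<zeta> * v' x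
          = (\<Sum>e\<in>nbrs. of_bool (\<zeta> x) * Phi (\<Lambda> - {x}) v \<zeta> * (\<theta> * (w (x + e) - w x)) / (2 * real CARD('n)))"
        using \<open>x \<in> \<Lambda>\<close> by (simp add: v'_def diff_divide_distrib right_diff_distrib)
    qed
    also have "\<dots> = (\<Sum>(x, e)\<in>\<Lambda> \<times> nbrs. of_bool (\<zeta> x) * Phi (\<Lambda> - {x}) v \<zeta> * (\<theta> * (w (x + e) - w x)) / (2 * real CARD('n)))"
      by (rule sum.cartesian_product)
    also have "\<dots> = (\<Sum>(x, e)\<in>bonds \<Lambda>. of_bool (\<zeta> x) * Phi (\<Lambda> - {x}) v \<zeta> * (if x \<in> \<Lambda> then \<theta> * (w (x + e) - w x) else 0) / (2 * real CARD('n)))"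
      by (rule sum.mono_neutral_cong_left[OF finite_bonds[OF fin\<Lambda>]]) (auto simp: bonds_def split: if_splits)
    finally have "(\<Sum>x\<in>\<Lambda>. of_bool (\<zeta> x) * Phi (\<Lambda> - {x}) v \<zeta> * v' x)
       = (\<Sum>(x, e)\<in>bonds \<Lambda>. of_bool (\<zeta> x) * Phi (\<Lambda> - {x}) v \<zeta> * (if x \<in> \<Lambda> then \<theta> * (w (x + e) - w x) else 0) / (2 * real CARD('n)))" .
    moreover have "ssep_op (Phi \<Lambda> v) \<zeta> =
        (\<Sum>(x, e)\<in>bonds \<Lambda>. of_bool (\<zeta> x) * Phi (\<Lambda> - {x}) v \<zeta> * (v x - v (x + e))) / (2 * real CARD('n)) - Q"
      unfolding Q_def by (rule ssep_op_Phi) (use fin\<Lambda> v0 in auto)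
    ultimately show ?thesis
      unfolding br_def
      by (simp add: case_prod_unfold sum_divide_distrib[symmetric] distrib_left sum.distrib add_divide_distrib)
  qed
  have br: "\<bar>br x e\<bar> = (if (x, e) \<in> C then \<theta> * w (x + e) else 0)" if "(x, e) \<in> bonds \<Lambda>" for x e
    using that \<theta> w01[of "x + e"] by (auto simp: br_def v_def C_def bonds_def algebra_simps)
  have "\<bar>\<Sum>(x, e)\<in>bonds \<Lambda>. of_bool (\<zeta> x) * Phi (\<Lambda> - {x}) v \<zeta> * br x e\<bar> \<le> (\<Sum>(x, e)\<in>bonds \<Lambda>. if (x, e) \<in> C then \<theta> * w (x + e) else 0)"
  proof (rule order_trans[OF sum_abs sum_mono], clarify)
    fix x e assume b: "(x, e) \<in> bonds \<Lambda>"
    have "\<bar>of_bool (\<zeta> x) * Phi (\<Lambda> - {x}) v \<zeta> * br x e\<bar> = of_bool (\<zeta> x) * Phi (\<Lambda> - {x}) v \<zeta> * \<bar>br x e\<bar>"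
      using R01(1) by (simp add: abs_mult)
    also have "\<dots> \<le> 1 * \<bar>br x e\<bar>" using R01 by (intro mult_right_mono) auto
    finally show "\<bar>of_bool (\<zeta> x) * Phi (\<Lambda> - {x}) v \<zeta> * br x e\<bar> \<le> (if (x, e) \<in> C then \<theta> * w (x + e) else 0)"
      by (simp add: br[OF b])
  qed
  also have "\<dots> = \<theta> * (\<Sum>(x, e)\<in>C. w (x + e))"
    unfolding sum_distrib_left bonds
    by (rule sum.mono_neutral_cong_right) (use finIC bonds in auto)
  also have "\<dots> \<le> \<theta> * (2 * real CARD('n) * \<epsilon>)" using \<theta> by (intro mult_left_mono sC1)
  finally have part2: "\<bar>(\<Sum>(x, e)\<in>bonds \<Lambda>. of_bool (\<zeta> x) * Phi (\<Lambda> - {x}) v \<zeta> * br x e) / (2 * real CARD('n))\<bar> \<le> \<theta> * \<epsilon>"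
    by (simp add: field_simps)
  have Q0: "Q \<ge> 0"
    unfolding Q_def using R01 by (intro divide_nonneg_nonneg sum_nonneg) (auto intro!: mult_nonneg_nonneg)
  show "?L \<le> \<theta> * \<epsilon>" using part1 part2 Q0 by linarith
  have "(\<Sum>(x, e)\<in>bonds \<Lambda>. of_bool (\<zeta> x) * of_bool (\<zeta> (x + e)) * Phi (\<Lambda> - {x, x + e}) v \<zeta> * (v x - v (x + e))\<^sup>2)
     \<le> (\<Sum>(x, e)\<in>bonds \<Lambda>. of_bool (\<zeta> x) * of_bool (\<zeta> (x + e)) * (v x - v (x + e))\<^sup>2)"
    using R01 by (intro sum_mono) (auto intro!: mult_left_le_one_le)
  also have "\<dots> = (\<Sum>(x, e)\<in>I. of_bool (\<zeta> x) * of_bool (\<zeta> (x + e)) * (v x - v (x + e))\<^sup>2)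
      + (\<Sum>(x, e)\<in>C. of_bool (\<zeta> x) * of_bool (\<zeta> (x + e)) * (v x - v (x + e))\<^sup>2)"
    unfolding bonds using finIC bonds by (intro sum.union_disjoint) auto
  also have "(\<Sum>(x, e)\<in>I. of_bool (\<zeta> x) * of_bool (\<zeta> (x + e)) * (v x - v (x + e))\<^sup>2)
      = (\<Sum>(x, e)\<in>I. of_bool (\<zeta> x) * of_bool (\<zeta> (x + e)) * (\<theta> * (w x - w (x + e)))\<^sup>2)"
    by (intro sum.cong refl) (auto simp: I_def v_def right_diff_distrib)
  also have "(\<Sum>(x, e)\<in>C. of_bool (\<zeta> x) * of_bool (\<zeta> (x + e)) * (v x - v (x + e))\<^sup>2)
      \<le> (\<Sum>(x, e)\<in>C. \<theta> * w x + \<theta> * w (x + e))"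
  proof (intro sum_mono, clarify)
    fix x e assume c: "(x, e) \<in> C"
    have sq: "(\<theta> * w y)\<^sup>2 \<le> \<theta> * w y" for y
      using \<theta> w01[of y] by (auto simp: power2_eq_square intro!: mult_left_le_one_le mult_le_one)
    have "(v x - v (x + e))\<^sup>2 \<le> \<theta> * w x + \<theta> * w (x + e)"
      using c sq[of x] sq[of "x + e"] \<theta> w01[of x] w01[of "x + e"] by (auto simp: C_def v_def add_increasing add_increasing2)
    moreover have "of_bool (\<zeta> x) * of_bool (\<zeta> (x + e)) * (v x - v (x + e))\<^sup>2 \<le> (v x - v (x + e))\<^sup>2"
      by (intro mult_left_le_one_le) auto
    ultimately show "of_bool (\<zeta> x) * of_bool (\<zeta> (x + e)) * (v x - v (x + e))\<^sup>2 \<le> \<theta> * w x + \<theta> * w (x + e)" by linarith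
  qed
  also have "\<dots> = \<theta> * ((\<Sum>(x, e)\<in>C. w x) + (\<Sum>(x, e)\<in>C. w (x + e)))"
    by (simp add: case_prod_unfold sum.distrib sum_distrib_left distrib_left)
  \<comment> \<open>Both ends of the crossing bonds contribute 2 d \<epsilon>. After division by 4 d
    this is \<theta> * \<epsilon>, which together with the \<theta> * \<epsilon> of the first-order
    part makes the constant 2.\<close>
  also have "\<dots> \<le> \<theta> * (4 * real CARD('n) * \<epsilon>)" using sC1 sC2 \<theta> by (intro mult_left_mono) auto
  finally have "Q \<le> ((\<Sum>(x, e)\<in>I. of_bool (\<zeta> x) * of_bool (\<zeta> (x + e)) * (\<theta> * (w x - w (x + e)))\<^sup>2) + \<theta> * (4 * real CARD('n) * \<epsilon>)) / (4 * real CARD('n))"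
    unfolding Q_def by (simp add: divide_right_mono)
  then have "Q \<le> (\<Sum>(x, e)\<in>I. of_bool (\<zeta> x) * of_bool (\<zeta> (x + e)) * (\<theta> * (w x - w (x + e)))\<^sup>2) / (4 * real CARD('n)) + \<theta> * \<epsilon>"
    by (simp add: add_divide_distrib)
  then show "?L \<ge> - 2 * \<theta> * \<epsilon> - (\<Sum>(x, e) | e \<in> nbrs \<and> x \<in> \<Lambda> \<and> x + e \<in> \<Lambda>. of_bool (\<zeta> x) * of_bool (\<zeta> (x + e)) * (\<theta> * (w x - w (x + e)))\<^sup>2) / (4 * CARD('n))"
    using part1 part2 unfolding I_def by linarith
qed

section \<open>Comparison of the exclusion process with independent walks\<close>

locale ssep_process = fixes S :: "real \<Rightarrow> ('n::finite config \<Rightarrow>\<^sub>C real) \<Rightarrow> ('n config \<Rightarrow>\<^sub>C real)"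
    and \<eta>0 :: "'n config"
  assumes ssep: "ssep_semigroup S"
begin

sublocale semigroup S
  by standard (use ssep in \<open>simp add: ssep_semigroup_def\<close>)

lemma generator_local:
  assumes "local_fun f"
  shows "(Bcontfun f, Bcontfun (ssep_op f)) \<in> generator_graph S"
proof -
  have "(Bcontfun f, Bcontfun (ssep_op f)) \<in> {(f, h). local_fun (apply_bcontfun f) \<and> apply_bcontfun h = ssep_op (apply_bcontfun f)}"
    using assms by (simp add: apply_local_fun local_fun_ssep_op)
  then have "(Bcontfun f, Bcontfun (ssep_op f)) \<in> closure {(f, h). local_fun (apply_bcontfun f) \<and> apply_bcontfun h = ssep_op (apply_bcontfun f)}"
    by (rule subsetD[OF closure_subset])
  moreover have "generator_graph S = closure {(f, h). local_fun (apply_bcontfun f) \<and> apply_bcontfun h = ssep_op (apply_bcontfun f)}"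
    using ssep unfolding ssep_semigroup_def by (rule conjunct2)
  ultimately show ?thesis by (simp only:)
qed

text \<open>The expectation at time t from \<eta>0, read off the semigroup, so that the comparison
  is made without a probability space. It is meaningful for f in \<open>bcontfun\<close>, in
  particular for local f.\<close>

definition mean :: "real \<Rightarrow> ('n config \<Rightarrow> real) \<Rightarrow> real" where
  "mean t f = apply_bcontfun (S t (Bcontfun f)) \<eta>0"

definition init :: "(int ^ 'n) set" where
  "init = {x. \<eta>0 x}"

definition inner_bonds :: "(int ^ 'n) set \<Rightarrow> ((int ^ 'n) \<times> (int ^ 'n)) set" where
  "inner_bonds \<Lambda> = {(x, e). e \<in> nbrs \<and> x \<in> \<Lambda> \<and> x + e \<in> \<Lambda>}"

lemma card_inner_bonds: "finite \<Lambda> \<Longrightarrow> card (inner_bonds \<Lambda>) \<le> card \<Lambda> * (2 * CARD('n))"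
proof -
  assume "finite \<Lambda>"
  then have "card (inner_bonds \<Lambda>) \<le> card (\<Lambda> \<times> (nbrs :: (int ^ 'n) set))"
    by (intro card_mono) (auto simp: inner_bonds_def)
  then show ?thesis by (simp add: card_cartesian_product card_nbrs)
qed

lemma local_fun_pair: "local_fun (\<lambda>\<eta>. of_bool (\<eta> x) * of_bool (\<eta> y) :: real)"
  by (rule local_funI[of "{x, y}"]) (auto simp: depends_on_def)

text \<open>The function \<open>D\<close> is a primitive of an upper bound for the two-particle error, which avoids
  integrating expectations over time: their measurability is not needed.\<close>

lemma duhamel:
  assumes B: "finite B" and \<epsilon>: "\<epsilon> > 0" and t: "t \<ge> 0"
  obtains \<Lambda> where "finite \<Lambda>"
    "(\<Sum>b\<in>B. hit t init b) - \<epsilon> \<le> (\<Sum>x\<in>\<Lambda> \<inter> init. hit t B x)"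
    "(\<Sum>x\<in>\<Lambda> \<inter> init. hit t B x) \<le> (\<Sum>b\<in>B. hit t init b)"
    "\<And>\<theta>. 0 \<le> \<theta> \<Longrightarrow> \<theta> \<le> 1 \<Longrightarrow> mean t (Phi B (\<lambda>_. \<theta>)) \<le> Phi \<Lambda> (\<lambda>x. \<theta> * hit t B x) \<eta>0 + \<theta> * \<epsilon> * t"
    "\<And>\<theta> D D'. 0 \<le> \<theta> \<Longrightarrow> \<theta> \<le> 1 \<Longrightarrow> continuous_on {0..t} D \<Longrightarrow>
       (\<And>s. 0 < s \<Longrightarrow> s < t \<Longrightarrow> (D has_real_derivative D' s) (at s)) \<Longrightarrow>
       (\<And>s. 0 < s \<Longrightarrow> s < t \<Longrightarrow> (\<Sum>(x, e)\<in>inner_bonds \<Lambda>. mean s (\<lambda>\<eta>. of_bool (\<eta> x) * of_bool (\<eta> (x + e)))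
           * (\<theta> * (hit (t - s) B x - hit (t - s) B (x + e)))\<^sup>2) / (4 * CARD('n)) \<le> D' s) \<Longrightarrow>
       mean t (Phi B (\<lambda>_. \<theta>)) \<ge> Phi \<Lambda> (\<lambda>x. \<theta> * hit t B x) \<eta>0 - 2 * \<theta> * \<epsilon> * t - (D t - D 0)"
proof -
  obtain \<Lambda>0 where \<Lambda>0: "finite \<Lambda>0" "B \<subseteq> \<Lambda>0" "\<And>\<tau>. \<tau> \<in> {0..t} \<Longrightarrow> (\<Sum>b\<in>B. hit \<tau> (- \<Lambda>0) b) \<le> \<epsilon>"
    using walk_tight_finite[OF B \<epsilon> t] by blast
  define \<Lambda> where "\<Lambda> = \<Lambda>0 \<union> (\<Union>e\<in>nbrs. (\<lambda>x. x + e) ` \<Lambda>0)"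
  have fin: "finite \<Lambda>" and B\<Lambda>: "B \<subseteq> \<Lambda>" using \<Lambda>0 by (auto simp: \<Lambda>_def)
  have out: "(\<Sum>x\<in>F. hit \<tau> B x) \<le> \<epsilon>" if "\<tau> \<in> {0..t}" "finite F" "F \<inter> \<Lambda>0 = {}" for \<tau> F
  proof -
    have "(\<Sum>x\<in>F. hit \<tau> B x) = (\<Sum>b\<in>B. hit \<tau> F b)" using that B by (intro sum_hit_commute) auto
    also have "\<dots> \<le> (\<Sum>b\<in>B. hit \<tau> (- \<Lambda>0) b)" using that by (intro sum_mono hit_mono) auto
    finally show ?thesis using \<Lambda>0(3)[OF that(1)] by simp
  qed
  have sum_eq: "(\<Sum>x\<in>\<Lambda> \<inter> init. hit t B x) = (\<Sum>b\<in>B. hit t (\<Lambda> \<inter> init) b)"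
    using fin B t by (intro sum_hit_commute) auto
  have le1: "(\<Sum>x\<in>\<Lambda> \<inter> init. hit t B x) \<le> (\<Sum>b\<in>B. hit t init b)"
    unfolding sum_eq by (intro sum_mono hit_mono) auto
  have "(\<Sum>b\<in>B. hit t init b) \<le> (\<Sum>b\<in>B. hit t (\<Lambda> \<inter> init) b + hit t (- \<Lambda>0) b)"
    by (intro sum_mono order_trans[OF hit_mono hit_Un_le]) (auto simp: \<Lambda>_def)
  also have "\<dots> \<le> (\<Sum>x\<in>\<Lambda> \<inter> init. hit t B x) + \<epsilon>"
    using \<Lambda>0(3)[of t] t by (simp add: sum.distrib sum_eq)
  finally have le2: "(\<Sum>b\<in>B. hit t init b) - \<epsilon> \<le> (\<Sum>x\<in>\<Lambda> \<inter> init. hit t B x)" by simp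
  define v where "v \<theta> \<tau> x = (if x \<in> \<Lambda> then \<theta> * hit \<tau> B x else 0)" for \<theta> \<tau> x
  define v' where "v' \<theta> \<tau> x = (if x \<in> \<Lambda> then \<theta> * ((\<Sum>e\<in>nbrs. hit \<tau> B (x + e)) / (2 * CARD('n)) - hit \<tau> B x) else 0)" for \<theta> \<tau> x
  have v': "((\<lambda>\<tau>. v \<theta> \<tau> x) has_real_derivative v' \<theta> \<tau> x) (at \<tau> within {0..})" if "\<tau> \<ge> 0" for \<theta> \<tau> x
    unfolding v_def v'_def using hit_has_derivative[OF that, of B x]
    by (auto intro!: DERIV_cmult)
  have Phi_v: "Phi \<Lambda> (v \<theta> \<tau>) \<eta> = Phi \<Lambda> (\<lambda>x. \<theta> * hit \<tau> B x) \<eta>" for \<theta> \<tau> \<eta>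
    unfolding Phi_def v_def by (intro prod.cong) auto
  have Phi_v0: "Phi \<Lambda> (v \<theta> 0) \<eta> = Phi B (\<lambda>_. \<theta>) \<eta>" for \<theta> \<eta>
    unfolding Phi_def v_def using fin B\<Lambda> by (intro prod.mono_neutral_cong_right) (auto simp: hit_0)
  define H where "H \<theta> \<tau> = Bcontfun (ssep_op (Phi \<Lambda> (v \<theta> \<tau>)))" for \<theta> \<tau>
  \<comment> \<open>Interpolation: exclusion up to time s, independent walks for the remaining time
    t - s. At s = 0 this is the product over the initial sites, at s = t the exclusion mean.\<close>
  define g where "g \<theta> s = apply_bcontfun (S s (Bcontfun (Phi \<Lambda> (v \<theta> (t - s))))) \<eta>0" for \<theta> s
  have g0: "g \<theta> 0 = Phi \<Lambda> (\<lambda>x. \<theta> * hit t B x) \<eta>0" for \<theta>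
    unfolding g_def by (simp add: apply_local_fun local_fun_Phi fin Phi_v)
  have gt: "g \<theta> t = mean t (Phi B (\<lambda>_. \<theta>))" for \<theta>
  proof -
    have "Phi \<Lambda> (v \<theta> 0) = Phi B (\<lambda>_. \<theta>)" by (rule ext) (rule Phi_v0)
    then show ?thesis unfolding g_def mean_def by simp
  qed
  have key: "\<exists>g'. (\<forall>s\<in>{0..t}. (g \<theta> has_real_derivative g' s) (at s within {0..t})) \<and>
      (\<forall>s\<in>{0..t}. g' s \<le> \<theta> * \<epsilon>) \<and>
      (\<forall>s\<in>{0..t}. g' s \<ge> - 2 * \<theta> * \<epsilon> - (\<Sum>(x, e)\<in>inner_bonds \<Lambda>. mean s (\<lambda>\<eta>. of_bool (\<eta> x) * of_bool (\<eta> (x + e)))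
           * (\<theta> * (hit (t - s) B x - hit (t - s) B (x + e)))\<^sup>2) / (4 * CARD('n)))"
    if \<theta>: "0 \<le> \<theta>" "\<theta> \<le> 1" for \<theta>
  proof -
    obtain F' where F': "\<And>\<tau>. \<tau> \<ge> 0 \<Longrightarrow> ((\<lambda>\<tau>. Bcontfun (Phi \<Lambda> (v \<theta> \<tau>))) has_vector_derivative F' \<tau>) (at \<tau> within {0..})"
      "\<And>\<tau> \<eta>. \<tau> \<ge> 0 \<Longrightarrow> apply_bcontfun (F' \<tau>) \<eta> = - (\<Sum>x\<in>\<Lambda>. of_bool (\<eta> x) * Phi (\<Lambda> - {x}) (v \<theta> \<tau>) \<eta> * v' \<theta> \<tau> x)"
      by (rule Phi_curve_derivative[where v = "v \<theta>" and v' = "v' \<theta>", OF fin v'], assumption, rule that)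
    define g' where "g' s = apply_bcontfun (S s (H \<theta> (t - s) - F' (t - s))) \<eta>0" for s
    have bounds: "apply_bcontfun (H \<theta> \<tau> - F' \<tau>) \<zeta> \<le> \<theta> * \<epsilon>"
      "apply_bcontfun (H \<theta> \<tau> - F' \<tau>) \<zeta> \<ge> - 2 * \<theta> * \<epsilon> - (\<Sum>(x, e)\<in>inner_bonds \<Lambda>. of_bool (\<zeta> x) * of_bool (\<zeta> (x + e)) * (\<theta> * (hit \<tau> B x - hit \<tau> B (x + e)))\<^sup>2) / (4 * CARD('n))"
      if \<tau>: "\<tau> \<in> {0..t}" for \<tau> \<zeta>
    proof -
      have eq: "apply_bcontfun (H \<theta> \<tau> - F' \<tau>) \<zeta> = ssep_op (Phi \<Lambda> (v \<theta> \<tau>)) \<zeta> + (\<Sum>x\<in>\<Lambda>. of_bool (\<zeta> x) * Phi (\<Lambda> - {x}) (v \<theta> \<tau>) \<zeta> * v' \<theta> \<tau> x)"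
        using F'(2)[of \<tau> \<zeta>] \<tau> by (simp add: H_def apply_local_fun local_fun_ssep_op local_fun_Phi fin)
      note b = ssep_op_Phi_bounds[OF \<Lambda>_def v_def v'_def \<Lambda>0(1) hit_nonneg hit_le_1 \<theta> out[OF \<tau>], where \<zeta> = \<zeta>]
      show "apply_bcontfun (H \<theta> \<tau> - F' \<tau>) \<zeta> \<le> \<theta> * \<epsilon>"
        unfolding eq using b(1) by simp
      show "apply_bcontfun (H \<theta> \<tau> - F' \<tau>) \<zeta> \<ge> - 2 * \<theta> * \<epsilon> - (\<Sum>(x, e)\<in>inner_bonds \<Lambda>. of_bool (\<zeta> x) * of_bool (\<zeta> (x + e)) * (\<theta> * (hit \<tau> B x - hit \<tau> B (x + e)))\<^sup>2) / (4 * CARD('n))"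
        unfolding eq inner_bonds_def using b(2) by simp
    qed
    have r1: "(g \<theta> has_real_derivative g' s) (at s within {0..t})" if s: "s \<in> {0..t}" for s
      unfolding g_def g'_def has_real_derivative_iff_has_vector_derivative
      by (rule bounded_linear.has_vector_derivative[OF bounded_linear_apply_bcontfun],
          rule S_curve_has_derivative[OF F'(1) _ s])
         (auto simp: H_def intro!: generator_local local_fun_Phi fin)
    have r2: "g' s \<le> \<theta> * \<epsilon>" if s: "s \<in> {0..t}" for s
    proof -
      have "g' s \<le> apply_bcontfun (S s (const_bcontfun (\<theta> * \<epsilon>))) \<eta>0"
        unfolding g'_def using s bounds(1)[of "t - s"] by (intro S_mono) auto
      then show ?thesis using s by (simp add: S_const')
    qed
    have r3: "g' s \<ge> - 2 * \<theta> * \<epsilon> - (\<Sum>(x, e)\<in>inner_bonds \<Lambda>. mean s (\<lambda>\<eta>. of_bool (\<eta> x) * of_bool (\<eta> (x + e)))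
           * (\<theta> * (hit (t - s) B x - hit (t - s) B (x + e)))\<^sup>2) / (4 * CARD('n))" if s: "s \<in> {0..t}" for s
    proof -
      define c where "c p = (\<theta> * (hit (t - s) B (fst p) - hit (t - s) B (fst p + snd p)))\<^sup>2 / (4 * CARD('n))" for p
      define f where "f p = Bcontfun (\<lambda>\<eta> :: 'n config. of_bool (\<eta> (fst p)) * of_bool (\<eta> (fst p + snd p)) :: real)" for p
      \<comment> \<open>The lower bound for the derivative as a function of the configuration;
        monotonicity and linearity of \<open>S s\<close> turn its pair products into pair
        means.\<close>
      define K where "K = const_bcontfun (- 2 * \<theta> * \<epsilon>) - (\<Sum>p\<in>inner_bonds \<Lambda>. c p *\<^sub>R f p)"
      have s0: "s \<ge> 0" using s by simp
      have ev: "apply_bcontfun (\<Sum>p\<in>I. h p) \<zeta> = (\<Sum>p\<in>I. apply_bcontfun (h p) \<zeta>)" for I \<zeta> and h :: "(int ^ 'n) \<times> (int ^ 'n) \<Rightarrow> ('n config \<Rightarrow>\<^sub>C real)"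
        by (rule bounded_linear.linear[OF bounded_linear_apply_bcontfun, THEN linear_sum])
      have K: "apply_bcontfun K \<zeta> = - 2 * \<theta> * \<epsilon> - (\<Sum>(x, e)\<in>inner_bonds \<Lambda>. of_bool (\<zeta> x) * of_bool (\<zeta> (x + e)) * (\<theta> * (hit (t - s) B x - hit (t - s) B (x + e)))\<^sup>2) / (4 * CARD('n))" for \<zeta>
        by (simp add: K_def ev f_def apply_local_fun local_fun_pair c_def case_prod_unfold sum_divide_distrib mult.commute)
      have "apply_bcontfun (S s K) \<eta>0 \<le> g' s"
        unfolding g'_def using s bounds(2)[of "t - s"] by (intro S_mono) (auto simp: K)
      moreover have "S s K = const_bcontfun (- 2 * \<theta> * \<epsilon>) - (\<Sum>p\<in>inner_bonds \<Lambda>. c p *\<^sub>R S s (f p))"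
        unfolding K_def by (simp add: linear_diff[OF lin[OF s0]] linear_sum[OF lin[OF s0]] linear_cmul[OF lin[OF s0]] S_const'[OF s0])
      then have "apply_bcontfun (S s K) \<eta>0 = - 2 * \<theta> * \<epsilon> - (\<Sum>(x, e)\<in>inner_bonds \<Lambda>. mean s (\<lambda>\<eta>. of_bool (\<eta> x) * of_bool (\<eta> (x + e)))
           * (\<theta> * (hit (t - s) B x - hit (t - s) B (x + e)))\<^sup>2) / (4 * CARD('n))"
        by (simp add: ev f_def mean_def c_def case_prod_unfold sum_divide_distrib mult.commute)
      ultimately show ?thesis by simp
    qed
    show ?thesis by (intro exI[of _ g'] conjI ballI r1 r2 r3)
  qed
  show ?thesis
  proof (rule that[OF fin le2 le1])
    fix \<theta> :: real assume \<theta>: "0 \<le> \<theta>" "\<theta> \<le> 1"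
    from key[OF \<theta>] obtain g' where g': "\<forall>s\<in>{0..t}. (g \<theta> has_real_derivative g' s) (at s within {0..t})"
      "\<forall>s\<in>{0..t}. g' s \<le> \<theta> * \<epsilon>"
      "\<forall>s\<in>{0..t}. g' s \<ge> - 2 * \<theta> * \<epsilon> - (\<Sum>(x, e)\<in>inner_bonds \<Lambda>. mean s (\<lambda>\<eta>. of_bool (\<eta> x) * of_bool (\<eta> (x + e)))
           * (\<theta> * (hit (t - s) B x - hit (t - s) B (x + e)))\<^sup>2) / (4 * CARD('n))"
      by (elim exE conjE) (rule that)
    have cont: "continuous_on {0..t} (g \<theta>)"
      using g'(1) by (intro DERIV_continuous_on) auto
    have der: "(g \<theta> has_real_derivative g' s) (at s)" if "0 < s" "s < t" for s
      using bspec[OF g'(1), of s] that by (simp add: at_within_Icc_at)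
    have "\<theta> * \<epsilon> * 0 - g \<theta> 0 \<le> \<theta> * \<epsilon> * t - g \<theta> t"
    proof (rule DERIV_nonneg_imp_increasing_open[OF t])
      show "\<exists>y. ((\<lambda>s. \<theta> * \<epsilon> * s - g \<theta> s) has_real_derivative y) (at s) \<and> 0 \<le> y" if "0 < s" "s < t" for s
        using bspec[OF g'(2), of s] der[OF that] that
        by (intro exI[of _ "\<theta> * \<epsilon> - g' s"] conjI) (auto intro!: derivative_eq_intros)
    qed (intro continuous_intros cont)
    then show "mean t (Phi B (\<lambda>_. \<theta>)) \<le> Phi \<Lambda> (\<lambda>x. \<theta> * hit t B x) \<eta>0 + \<theta> * \<epsilon> * t"
      by (simp add: g0 gt)
    fix D D' assume D: "continuous_on {0..t} D"
      "\<And>s. 0 < s \<Longrightarrow> s < t \<Longrightarrow> (D has_real_derivative D' s) (at s)"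
      "\<And>s. 0 < s \<Longrightarrow> s < t \<Longrightarrow> (\<Sum>(x, e)\<in>inner_bonds \<Lambda>. mean s (\<lambda>\<eta>. of_bool (\<eta> x) * of_bool (\<eta> (x + e)))
           * (\<theta> * (hit (t - s) B x - hit (t - s) B (x + e)))\<^sup>2) / (4 * CARD('n)) \<le> D' s"
    have "g \<theta> 0 + 2 * \<theta> * \<epsilon> * 0 + D 0 \<le> g \<theta> t + 2 * \<theta> * \<epsilon> * t + D t"
    proof (rule DERIV_nonneg_imp_increasing_open[OF t])
      show "\<exists>y. ((\<lambda>s. g \<theta> s + 2 * \<theta> * \<epsilon> * s + D s) has_real_derivative y) (at s) \<and> 0 \<le> y" if "0 < s" "s < t" for s
        using bspec[OF g'(3), of s] der[OF that] D(2,3)[OF that] that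
        by (intro exI[of _ "g' s + 2 * \<theta> * \<epsilon> + D' s"] conjI) (auto intro!: derivative_eq_intros)
    qed (intro continuous_intros cont D)
    then show "mean t (Phi B (\<lambda>_. \<theta>)) \<ge> Phi \<Lambda> (\<lambda>x. \<theta> * hit t B x) \<eta>0 - 2 * \<theta> * \<epsilon> * t - (D t - D 0)"
      by (simp add: g0 gt)
  qed
qed

end

section \<open>Moment and generating function bounds for the exclusion process\<close>

lemma prod_one_minus_ge: "finite A \<Longrightarrow> (\<And>x. x \<in> A \<Longrightarrow> 0 \<le> a x \<and> a x \<le> 1) \<Longrightarrow> 1 - (\<Sum>x\<in>A. a x) \<le> (\<Prod>x\<in>A. 1 - a x)"
  for a :: "'a \<Rightarrow> real"
proof (induction A rule: finite_induct)
  case (insert x A)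
  have p: "0 \<le> (\<Prod>x\<in>A. 1 - a x)" "(\<Prod>x\<in>A. 1 - a x) \<le> 1"
    using insert.prems by (auto intro!: prod_nonneg prod_le_1)
  have "1 - (\<Sum>x\<in>insert x A. a x) \<le> (\<Prod>x\<in>A. 1 - a x) - a x * 1" using insert by simp
  also have "\<dots> \<le> (\<Prod>x\<in>A. 1 - a x) - a x * (\<Prod>x\<in>A. 1 - a x)"
    using p insert.prems by (intro diff_left_mono mult_left_mono) auto
  also have "\<dots> = (\<Prod>x\<in>insert x A. 1 - a x)" using insert.hyps by (simp add: algebra_simps)
  finally show ?case .
qed simp

lemma Phi_eq_prod: "finite \<Lambda> \<Longrightarrow> Phi \<Lambda> v \<eta> = (\<Prod>x\<in>\<Lambda> \<inter> {x. \<eta> x}. 1 - v x)"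
  unfolding Phi_def by (rule prod.mono_neutral_cong_right) auto

lemma Phi_ge: "finite \<Lambda> \<Longrightarrow> (\<And>x. 0 \<le> v x \<and> v x \<le> 1) \<Longrightarrow> 1 - (\<Sum>x\<in>\<Lambda> \<inter> {x. \<eta> x}. v x) \<le> Phi \<Lambda> v \<eta>"
  by (simp add: Phi_eq_prod prod_one_minus_ge)

lemma Phi_le_exp:
  assumes "finite \<Lambda>" "\<And>x. v x \<le> 1"
  shows "Phi \<Lambda> v \<eta> \<le> exp (- (\<Sum>x\<in>\<Lambda> \<inter> {x. \<eta> x}. v x))"
proof -
  have "Phi \<Lambda> v \<eta> \<le> (\<Prod>x\<in>\<Lambda> \<inter> {x. \<eta> x}. exp (- v x))"
    unfolding Phi_eq_prod[OF assms(1)]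
    using assms(2) exp_ge_add_one_self[of "- v _"] by (intro prod_mono) (auto simp: algebra_simps)
  then show ?thesis using assms(1) by (simp add: exp_sum[symmetric] sum_negf)
qed

text \<open>ln (1 - v) \<ge> - v - 2 v^2 for 0 \<le> v \<le> 1 / 2; when v \<le> m, the quadratic
  term costs only the factor 1 + 2 m in the exponent.\<close>

lemma Phi_ge_exp:
  assumes "finite \<Lambda>" "\<And>x. x \<in> \<Lambda> \<Longrightarrow> \<eta> x \<Longrightarrow> 0 \<le> v x \<and> v x \<le> m" "m \<le> 1 / 2"
  shows "exp (- ((1 + 2 * m) * (\<Sum>x\<in>\<Lambda> \<inter> {x. \<eta> x}. v x))) \<le> Phi \<Lambda> v \<eta>"
proof -
  have "exp (- ((1 + 2 * m) * v x)) \<le> 1 - v x" if "x \<in> \<Lambda> \<inter> {x. \<eta> x}" for x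
  proof -
    have v: "0 \<le> v x" "v x \<le> m" using assms(2)[of x] that by auto
    have "- v x - 2 * (v x)\<^sup>2 \<le> ln (1 - v x)"
      using v assms(3) by (intro ln_one_minus_pos_lower_bound) auto
    moreover have "(v x)\<^sup>2 \<le> m * v x" using v by (simp add: power2_eq_square mult_right_mono)
    ultimately have "- ((1 + 2 * m) * v x) \<le> ln (1 - v x)" by (simp add: algebra_simps)
    then show ?thesis using v assms(3) by (subst (asm) ln_ge_iff) auto
  qed
  then have "(\<Prod>x\<in>\<Lambda> \<inter> {x. \<eta> x}. exp (- ((1 + 2 * m) * v x))) \<le> Phi \<Lambda> v \<eta>"
    unfolding Phi_eq_prod[OF assms(1)] by (intro prod_mono) auto
  then show ?thesis using assms(1) by (simp add: exp_sum[symmetric] sum_negf sum_distrib_left)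
qed

definition bdry :: "(int ^ 'n::finite) set \<Rightarrow> (int ^ 'n) set" where
  "bdry B = {v. \<exists>e\<in>nbrs. (v \<in> B) \<noteq> (v + e \<in> B)}"

text \<open>Coupling: walkers from x and x + e with the same increments can disagree about
  membership in B only when the first one is in \<open>bdry B\<close>.\<close>

lemma hit_gradient_le:
  assumes "e \<in> nbrs"
  shows "\<bar>hit r B x - hit r B (x + e)\<bar> \<le> hit r (bdry B) x"
proof -
  have 1: "hit r B x \<le> hit r B (x + e) + hit r (bdry B) x"
  proof -
    have "hit r B x \<le> measure (walk r) ({v. x + e + v \<in> B} \<union> {v. x + v \<in> bdry B})"
      unfolding hit_def using assms
      by (intro measure_pmf.finite_measure_mono) (auto simp: bdry_def algebra_simps)
    then show ?thesis unfolding hit_def using measure_Un_le[of "{v. x + e + v \<in> B}" "walk r" "{v. x + v \<in> bdry B}"] by simp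
  qed
  have 2: "hit r B (x + e) \<le> hit r B x + hit r (bdry B) x"
  proof -
    have "hit r B (x + e) \<le> measure (walk r) ({v. x + v \<in> B} \<union> {v. x + v \<in> bdry B})"
      unfolding hit_def using assms
      by (intro measure_pmf.finite_measure_mono) (auto simp: bdry_def algebra_simps)
    then show ?thesis unfolding hit_def using measure_Un_le[of "{v. x + v \<in> B}" "walk r" "{v. x + v \<in> bdry B}"] by simp
  qed
  show ?thesis using 1 2 by linarith
qed

context ssep_process
begin

lemma mean_affine:
  assumes "t \<ge> 0" "finite I" "\<And>i. i \<in> I \<Longrightarrow> local_fun (f i)" "\<And>\<eta>. g \<eta> = a + (\<Sum>i\<in>I. c i * f i \<eta>)" "local_fun g"
  shows "mean t g = a + (\<Sum>i\<in>I. c i * mean t (f i))"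
proof -
  have "Bcontfun g = const_bcontfun a + (\<Sum>i\<in>I. c i *\<^sub>R Bcontfun (f i))"
  proof (rule bcontfun_eqI)
    fix \<eta>
    have "apply_bcontfun (\<Sum>i\<in>I. c i *\<^sub>R Bcontfun (f i)) \<eta> = (\<Sum>i\<in>I. apply_bcontfun (c i *\<^sub>R Bcontfun (f i)) \<eta>)"
      by (rule bounded_linear.linear[OF bounded_linear_apply_bcontfun, THEN linear_sum])
    then show "apply_bcontfun (Bcontfun g) \<eta> = apply_bcontfun (const_bcontfun a + (\<Sum>i\<in>I. c i *\<^sub>R Bcontfun (f i))) \<eta>"
      using assms by (simp add: apply_local_fun)
  qed
  then have "S t (Bcontfun g) = const_bcontfun a + (\<Sum>i\<in>I. c i *\<^sub>R S t (Bcontfun (f i)))"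
    using lin[OF assms(1)] assms(1) by (simp add: linear_add linear_sum linear_cmul S_const')
  moreover have "apply_bcontfun (\<Sum>i\<in>I. c i *\<^sub>R S t (Bcontfun (f i))) \<eta>0 = (\<Sum>i\<in>I. apply_bcontfun (c i *\<^sub>R S t (Bcontfun (f i))) \<eta>0)"
    by (rule bounded_linear.linear[OF bounded_linear_apply_bcontfun, THEN linear_sum])
  ultimately show ?thesis by (simp add: mean_def)
qed

lemma mean_le_1:
  assumes "t \<ge> 0" "local_fun f" "\<And>\<eta>. f \<eta> \<le> 1"
  shows "mean t f \<le> 1"
proof -
  have "mean t f \<le> apply_bcontfun (S t (const_bcontfun 1)) \<eta>0"
    unfolding mean_def using assms by (intro S_mono) (auto simp: apply_local_fun)
  then show ?thesis using assms(1) by (simp add: S_const)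
qed

lemma local_fun_site: "local_fun (\<lambda>\<eta>. of_bool (\<eta> x) :: real)"
  by (rule local_funI[of "{x}"]) (auto simp: depends_on_def)

text \<open>The two-particle error is quadratic in \<open>\<theta>\<close>, so that dividing by \<open>\<theta>\<close> and letting it tend to
  \<open>0\<close> leaves the first moment.\<close>

lemma mean_site_le:
  assumes t: "t \<ge> 0"
  shows "mean t (\<lambda>\<eta>. of_bool (\<eta> x)) \<le> hit t init x"
proof -
  let ?u = "mean t (\<lambda>\<eta>. of_bool (\<eta> x))"
  have Phi1: "mean t (Phi {x} (\<lambda>_. \<theta>)) = 1 - \<theta> * ?u" for \<theta>
    using mean_affine[OF t, of "{x}" "\<lambda>x \<eta>. of_bool (\<eta> x)" "Phi {x} (\<lambda>_. \<theta>)" 1 "\<lambda>_. - \<theta>"]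
    by (simp add: local_fun_site local_fun_Phi Phi_def)
  have "?u \<le> hit t init x + 2 * \<epsilon> * t" if \<epsilon>: "\<epsilon> > 0" for \<epsilon>
  proof -
    obtain \<Lambda> where \<Lambda>: "finite \<Lambda>" "(\<Sum>a\<in>\<Lambda> \<inter> init. hit t {x} a) \<le> (\<Sum>b\<in>{x}. hit t init b)"
      and low: "\<And>\<theta> D D'. 0 \<le> \<theta> \<Longrightarrow> \<theta> \<le> 1 \<Longrightarrow> continuous_on {0..t} D \<Longrightarrow>
       (\<And>s. 0 < s \<Longrightarrow> s < t \<Longrightarrow> (D has_real_derivative D' s) (at s)) \<Longrightarrow>
       (\<And>s. 0 < s \<Longrightarrow> s < t \<Longrightarrow> (\<Sum>(x', e)\<in>inner_bonds \<Lambda>. mean s (\<lambda>\<eta>. of_bool (\<eta> x') * of_bool (\<eta> (x' + e)))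
           * (\<theta> * (hit (t - s) {x} x' - hit (t - s) {x} (x' + e)))\<^sup>2) / (4 * CARD('n)) \<le> D' s) \<Longrightarrow>
       mean t (Phi {x} (\<lambda>_. \<theta>)) \<ge> Phi \<Lambda> (\<lambda>a. \<theta> * hit t {x} a) \<eta>0 - 2 * \<theta> * \<epsilon> * t - (D t - D 0)"
      by (rule duhamel[OF _ \<epsilon> t, of "{x}"]) auto
    \<comment> \<open>At most 2 d * card \<Lambda> inner bonds, each contributing at most
      \<theta>^2, divided by 4 d. C may depend on \<epsilon> through \<Lambda>, since \<theta> goes
      to 0 first.\<close>
    define C where "C = real (card \<Lambda>) / 2"
    have main: "?u \<le> hit t init x + 2 * \<epsilon> * t + \<theta> * C * t" if \<theta>: "0 < \<theta>" "\<theta> \<le> 1" for \<theta>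
    proof -
      have "mean t (Phi {x} (\<lambda>_. \<theta>)) \<ge> Phi \<Lambda> (\<lambda>a. \<theta> * hit t {x} a) \<eta>0 - 2 * \<theta> * \<epsilon> * t - (\<theta>\<^sup>2 * C * t - \<theta>\<^sup>2 * C * 0)"
      proof (rule low[where D' = "\<lambda>_. \<theta>\<^sup>2 * C"])
        fix s assume s: "0 < s" "s < t"
        have "(\<Sum>(x', e)\<in>inner_bonds \<Lambda>. mean s (\<lambda>\<eta>. of_bool (\<eta> x') * of_bool (\<eta> (x' + e)))
           * (\<theta> * (hit (t - s) {x} x' - hit (t - s) {x} (x' + e)))\<^sup>2) \<le> (\<Sum>p\<in>inner_bonds \<Lambda>. 1 * \<theta>\<^sup>2)"
        proof (intro sum_mono, clarify)
          fix x' e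
          have "\<bar>hit (t - s) {x} x' - hit (t - s) {x} (x' + e)\<bar> \<le> 1"
            using hit_nonneg[of "t - s" "{x}"] hit_le_1[of "t - s" "{x}"] by (smt (verit))
          then have "(hit (t - s) {x} x' - hit (t - s) {x} (x' + e))\<^sup>2 \<le> 1"
            by (simp add: abs_square_le_1)
          then have "(\<theta> * (hit (t - s) {x} x' - hit (t - s) {x} (x' + e)))\<^sup>2 \<le> \<theta>\<^sup>2"
            unfolding power_mult_distrib by (intro mult_left_le) auto
          then show "mean s (\<lambda>\<eta>. of_bool (\<eta> x') * of_bool (\<eta> (x' + e))) * (\<theta> * (hit (t - s) {x} x' - hit (t - s) {x} (x' + e)))\<^sup>2 \<le> 1 * \<theta>\<^sup>2"
            using s by (intro mult_mono mean_le_1 local_fun_pair) auto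
        qed
        also have "\<dots> = real (card (inner_bonds \<Lambda>)) * \<theta>\<^sup>2" by simp
        also have "\<dots> \<le> real (card \<Lambda> * (2 * CARD('n))) * \<theta>\<^sup>2"
          using card_inner_bonds[OF \<Lambda>(1)] by (intro mult_right_mono) (auto simp only: of_nat_le_iff zero_le_power2)
        finally show "(\<Sum>(x', e)\<in>inner_bonds \<Lambda>. mean s (\<lambda>\<eta>. of_bool (\<eta> x') * of_bool (\<eta> (x' + e)))
           * (\<theta> * (hit (t - s) {x} x' - hit (t - s) {x} (x' + e)))\<^sup>2) / (4 * CARD('n)) \<le> \<theta>\<^sup>2 * C"
          by (simp add: C_def field_simps)
      qed (use \<theta> in \<open>auto intro!: continuous_intros derivative_eq_intros\<close>)
      moreover have "Phi \<Lambda> (\<lambda>a. \<theta> * hit t {x} a) \<eta>0 \<ge> 1 - (\<Sum>a\<in>\<Lambda> \<inter> init. \<theta> * hit t {x} a)"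
        unfolding init_def using \<theta> by (intro Phi_ge \<Lambda>) (auto simp: mult_le_one)
      moreover have "(\<Sum>a\<in>\<Lambda> \<inter> init. \<theta> * hit t {x} a) \<le> \<theta> * hit t init x"
        using \<Lambda>(2) \<theta> by (simp flip: sum_distrib_left)
      ultimately have "\<theta> * ?u \<le> \<theta> * (hit t init x + 2 * \<epsilon> * t + \<theta> * C * t)"
        unfolding Phi1 by (simp add: algebra_simps power2_eq_square)
      then show ?thesis using \<theta> by simp
    qed
    have "((\<lambda>\<theta>. hit t init x + 2 * \<epsilon> * t + \<theta> * C * t) \<longlongrightarrow> hit t init x + 2 * \<epsilon> * t + 0 * C * t) (at_right 0)"
      by (intro tendsto_intros)
    moreover have "\<forall>\<^sub>F \<theta> in at_right 0. ?u \<le> hit t init x + 2 * \<epsilon> * t + \<theta> * C * t"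
      using main by (intro eventually_at_rightI[of 0 1]) auto
    ultimately show ?thesis using tendsto_lowerbound[of _ _ "at_right (0::real)"] by fastforce
  qed
  then have ev: "\<forall>\<^sub>F \<epsilon> in at_right 0. ?u \<le> hit t init x + 2 * \<epsilon> * t"
    by (intro eventually_at_rightI[of 0 1]) auto
  have "((\<lambda>\<epsilon>. hit t init x + 2 * \<epsilon> * t) \<longlongrightarrow> hit t init x + 2 * 0 * t) (at_right 0)"
    by (intro tendsto_intros)
  from tendsto_lowerbound[OF this ev] show ?thesis by simp
qed

text \<open>The two-particle error only lowers the mean and is dropped. What remains is 1 - u \<le>
  exp (- u), factor by factor, and the limit \<epsilon> to 0.\<close>

lemma mean_Phi_le:
  assumes t: "t \<ge> 0" and B: "finite B" and \<theta>: "0 \<le> \<theta>" "\<theta> \<le> 1"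
  shows "mean t (Phi B (\<lambda>_. \<theta>)) \<le> exp (- (\<theta> * (\<Sum>b\<in>B. hit t init b)))"
proof -
  let ?W = "\<Sum>b\<in>B. hit t init b"
  have *: "mean t (Phi B (\<lambda>_. \<theta>)) \<le> exp (- (\<theta> * (?W - \<epsilon>))) + \<theta> * \<epsilon> * t" if \<epsilon>: "\<epsilon> > 0" for \<epsilon>
  proof -
    obtain \<Lambda> where \<Lambda>: "finite \<Lambda>" "?W - \<epsilon> \<le> (\<Sum>x\<in>\<Lambda> \<inter> init. hit t B x)"
      and up: "\<And>\<theta>. 0 \<le> \<theta> \<Longrightarrow> \<theta> \<le> 1 \<Longrightarrow> mean t (Phi B (\<lambda>_. \<theta>)) \<le> Phi \<Lambda> (\<lambda>x. \<theta> * hit t B x) \<eta>0 + \<theta> * \<epsilon> * t"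
      by (rule duhamel[OF B \<epsilon> t]) auto
    have "Phi \<Lambda> (\<lambda>x. \<theta> * hit t B x) \<eta>0 \<le> exp (- (\<Sum>x\<in>\<Lambda> \<inter> init. \<theta> * hit t B x))"
      unfolding init_def using \<theta> by (intro Phi_le_exp \<Lambda>) (auto simp: mult_le_one)
    also have "(\<Sum>x\<in>\<Lambda> \<inter> init. \<theta> * hit t B x) \<ge> \<theta> * (?W - \<epsilon>)"
      using \<Lambda>(2) \<theta> by (simp flip: sum_distrib_left add: mult_left_mono)
    then have "exp (- (\<Sum>x\<in>\<Lambda> \<inter> init. \<theta> * hit t B x)) \<le> exp (- (\<theta> * (?W - \<epsilon>)))" by simp
    finally show ?thesis using up[OF \<theta>] by linarith
  qed
  then have ev: "\<forall>\<^sub>F \<epsilon> in at_right 0. mean t (Phi B (\<lambda>_. \<theta>)) \<le> exp (- (\<theta> * (?W - \<epsilon>))) + \<theta> * \<epsilon> * t"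
    by (intro eventually_at_rightI[of 0 1]) auto
  have "((\<lambda>\<epsilon>. exp (- (\<theta> * (?W - \<epsilon>))) + \<theta> * \<epsilon> * t) \<longlongrightarrow> exp (- (\<theta> * (?W - 0))) + \<theta> * 0 * t) (at_right 0)"
    by (intro tendsto_intros)
  from tendsto_lowerbound[OF this ev] show ?thesis by simp
qed

text \<open>Inclusion-exclusion on the probability that both sites are empty, which is the case \<open>\<theta> = 1\<close>
  of the generating function.\<close>

lemma mean_pair_le:
  assumes t: "t \<ge> 0" and ne: "x \<noteq> y"
  shows "mean t (\<lambda>\<eta>. of_bool (\<eta> x) * of_bool (\<eta> y)) \<le> (hit t init x)\<^sup>2 + (hit t init y)\<^sup>2"
proof -
  let ?m = "mean t (\<lambda>\<eta>. of_bool (\<eta> x) * of_bool (\<eta> y))"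
  let ?W = "hit t init x + hit t init y"
  have "mean t (Phi {x, y} (\<lambda>_. 1)) = 1 + (\<Sum>i\<in>{0, 1, 2 :: nat}. [-1, -1, 1] ! i *
      mean t ([\<lambda>\<eta>. of_bool (\<eta> x), \<lambda>\<eta>. of_bool (\<eta> y), \<lambda>\<eta>. of_bool (\<eta> x) * of_bool (\<eta> y)] ! i))"
    using ne by (intro mean_affine[OF t])
       (auto simp: local_fun_Phi local_fun_site local_fun_pair Phi_def algebra_simps)
  then have "?m = mean t (Phi {x, y} (\<lambda>_. 1)) - 1 + mean t (\<lambda>\<eta>. of_bool (\<eta> x)) + mean t (\<lambda>\<eta>. of_bool (\<eta> y))"
    by simp
  also have "\<dots> \<le> exp (- ?W) - 1 + hit t init x + hit t init y"
    using mean_Phi_le[OF t, of "{x, y}" 1] ne mean_site_le[OF t, of x] mean_site_le[OF t, of y] by simp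
  also have "\<dots> \<le> ?W\<^sup>2 / 2" using exp_minus_le_quadratic[of ?W] by simp
  also have "\<dots> \<le> (hit t init x)\<^sup>2 + (hit t init y)\<^sup>2"
    using sum_squares_bound[of "hit t init x" "hit t init y"] by (simp add: power2_sum)
  finally show ?thesis .
qed

lemma sum_inner_bonds_le:
  fixes f :: "int ^ 'n \<Rightarrow> real"
  assumes "finite \<Lambda>" "\<And>x. 0 \<le> f x"
  shows "(\<Sum>(x, e)\<in>inner_bonds \<Lambda>. f x + f (x + e)) \<le> 4 * real CARD('n) * (\<Sum>x\<in>\<Lambda>. f x)"
proof -
  have 1: "(\<Sum>(x, e)\<in>inner_bonds \<Lambda>. f (x + e)) = (\<Sum>(x, e)\<in>inner_bonds \<Lambda>. f x)"
    by (rule sum.reindex_bij_witness[of _ "\<lambda>(x, e). (x + e, - e)" "\<lambda>(x, e). (x + e, - e)"])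
       (auto simp: inner_bonds_def uminus_nbrs)
  have "(\<Sum>(x, e)\<in>inner_bonds \<Lambda>. f x) \<le> (\<Sum>(x, e)\<in>\<Lambda> \<times> (nbrs :: (int ^ 'n) set). f x)"
    by (rule sum_mono2) (use assms in \<open>auto simp: inner_bonds_def\<close>)
  also have "\<dots> = 2 * real CARD('n) * (\<Sum>x\<in>\<Lambda>. f x)"
    by (simp add: sum.cartesian_product[symmetric] card_nbrs sum_distrib_left)
  finally show ?thesis using 1 by (simp add: case_prod_unfold sum.distrib mult_ac)
qed

text \<open>The singularity K / sqrt (t - s) allowed in the last hypothesis is the size of a
  one-coordinate kernel at time t - s; it integrates to 2 K sqrt t. The bound m on the hitting
  probabilities controls the gap between 1 - u and exp (- u).\<close>

lemma mean_Phi_ge: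
  assumes t: "t \<ge> 0" and B: "finite B" and \<theta>: "0 \<le> \<theta>" "\<theta> \<le> 1" and K: "K \<ge> 0"
    and m: "\<And>x. x \<in> init \<Longrightarrow> hit t B x \<le> m" "m \<le> 1 / 2"
    and e: "\<And>s \<Lambda>. 0 < s \<Longrightarrow> s < t \<Longrightarrow> finite \<Lambda> \<Longrightarrow>
        (\<Sum>x\<in>\<Lambda>. (hit s init x)\<^sup>2 * (hit (t - s) (bdry B) x)\<^sup>2) \<le> K / sqrt (t - s) + \<delta>"
  shows "mean t (Phi B (\<lambda>_. \<theta>)) \<ge> exp (- ((1 + 2 * m) * (\<theta> * (\<Sum>b\<in>B. hit t init b)))) - 2 * K * sqrt t - \<delta> * t"
proof -
  let ?W = "\<Sum>b\<in>B. hit t init b"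
  have *: "exp (- ((1 + 2 * m) * (\<theta> * ?W))) - 2 * K * sqrt t - \<delta> * t - 2 * \<theta> * \<epsilon> * t \<le> mean t (Phi B (\<lambda>_. \<theta>))" if \<epsilon>: "\<epsilon> > 0" for \<epsilon>
  proof -
    obtain \<Lambda> where \<Lambda>: "finite \<Lambda>" "(\<Sum>x\<in>\<Lambda> \<inter> init. hit t B x) \<le> ?W"
      and low: "\<And>\<theta> D D'. 0 \<le> \<theta> \<Longrightarrow> \<theta> \<le> 1 \<Longrightarrow> continuous_on {0..t} D \<Longrightarrow>
       (\<And>s. 0 < s \<Longrightarrow> s < t \<Longrightarrow> (D has_real_derivative D' s) (at s)) \<Longrightarrow>
       (\<And>s. 0 < s \<Longrightarrow> s < t \<Longrightarrow> (\<Sum>(x, e)\<in>inner_bonds \<Lambda>. mean s (\<lambda>\<eta>. of_bool (\<eta> x) * of_bool (\<eta> (x + e)))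
           * (\<theta> * (hit (t - s) B x - hit (t - s) B (x + e)))\<^sup>2) / (4 * CARD('n)) \<le> D' s) \<Longrightarrow>
       mean t (Phi B (\<lambda>_. \<theta>)) \<ge> Phi \<Lambda> (\<lambda>x. \<theta> * hit t B x) \<eta>0 - 2 * \<theta> * \<epsilon> * t - (D t - D 0)"
      by (rule duhamel[OF B \<epsilon> t]) auto
    define D where "D s = - 2 * K * sqrt (t - s) + \<delta> * s" for s
    have "mean t (Phi B (\<lambda>_. \<theta>)) \<ge> Phi \<Lambda> (\<lambda>x. \<theta> * hit t B x) \<eta>0 - 2 * \<theta> * \<epsilon> * t - (D t - D 0)"
    proof (rule low[OF \<theta>, where D' = "\<lambda>s. K / sqrt (t - s) + \<delta>"])
      show "continuous_on {0..t} D" unfolding D_def by (intro continuous_intros)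
      fix s assume s: "0 < s" "s < t"
      show "(D has_real_derivative K / sqrt (t - s) + \<delta>) (at s)"
        unfolding D_def using s by (auto intro!: derivative_eq_intros simp: field_simps)
      let ?f = "\<lambda>x. (hit s init x)\<^sup>2 * (hit (t - s) (bdry B) x)\<^sup>2"
      have "(\<Sum>(x, e)\<in>inner_bonds \<Lambda>. mean s (\<lambda>\<eta>. of_bool (\<eta> x) * of_bool (\<eta> (x + e)))
           * (\<theta> * (hit (t - s) B x - hit (t - s) B (x + e)))\<^sup>2) \<le> (\<Sum>(x, e)\<in>inner_bonds \<Lambda>. ?f x + ?f (x + e))"
      proof (intro sum_mono, clarify)
        fix x e assume xe: "(x, e) \<in> inner_bonds \<Lambda>"
        then have en: "e \<in> nbrs" "- e \<in> nbrs" by (auto simp: inner_bonds_def uminus_nbrs)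
        let ?g = "hit (t - s) B x - hit (t - s) B (x + e)"
        \<comment> \<open>The gradient is bounded at both ends of the bond, so that each squared
          density of \<open>mean_pair_le\<close> is paired with the boundary probability at its own
          site.\<close>
        have g1: "\<bar>?g\<bar> \<le> hit (t - s) (bdry B) x" by (rule hit_gradient_le[OF en(1)])
        have g2: "\<bar>?g\<bar> \<le> hit (t - s) (bdry B) (x + e)"
          using hit_gradient_le[OF en(2), of "t - s" B "x + e"] by (simp add: abs_minus_commute)
        have sq: "?g\<^sup>2 \<le> (hit (t - s) (bdry B) x)\<^sup>2" "?g\<^sup>2 \<le> (hit (t - s) (bdry B) (x + e))\<^sup>2"
          using power_mono[OF g1, of 2] power_mono[OF g2, of 2] by simp_all
        have "x \<noteq> x + e" using en by auto
        then have "mean s (\<lambda>\<eta>. of_bool (\<eta> x) * of_bool (\<eta> (x + e))) * (\<theta> * ?g)\<^sup>2 \<le> ((hit s init x)\<^sup>2 + (hit s init (x + e))\<^sup>2) * (\<theta> * ?g)\<^sup>2"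
          using s by (intro mult_right_mono mean_pair_le) auto
        also have "\<dots> \<le> ((hit s init x)\<^sup>2 + (hit s init (x + e))\<^sup>2) * ?g\<^sup>2"
          using \<theta> by (intro mult_left_mono) (auto simp: power_mult_distrib intro!: mult_left_le_one_le power_le_one)
        also have "\<dots> \<le> ?f x + ?f (x + e)"
          unfolding distrib_right by (intro add_mono mult_left_mono sq) auto
        finally show "mean s (\<lambda>\<eta>. of_bool (\<eta> x) * of_bool (\<eta> (x + e))) * (\<theta> * ?g)\<^sup>2 \<le> ?f x + ?f (x + e)" .
      qed
      also have "\<dots> \<le> 4 * real CARD('n) * (\<Sum>x\<in>\<Lambda>. ?f x)"
        by (rule sum_inner_bonds_le[OF \<Lambda>(1)]) simp
      also have "\<dots> \<le> 4 * real CARD('n) * (K / sqrt (t - s) + \<delta>)"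
        using e[OF s \<Lambda>(1)] by (intro mult_left_mono) auto
      finally show "(\<Sum>(x, e)\<in>inner_bonds \<Lambda>. mean s (\<lambda>\<eta>. of_bool (\<eta> x) * of_bool (\<eta> (x + e)))
           * (\<theta> * (hit (t - s) B x - hit (t - s) B (x + e)))\<^sup>2) / (4 * CARD('n)) \<le> K / sqrt (t - s) + \<delta>"
        by (simp add: field_simps)
    qed
    moreover have "D t - D 0 = 2 * K * sqrt t + \<delta> * t" by (simp add: D_def)
    moreover have "Phi \<Lambda> (\<lambda>x. \<theta> * hit t B x) \<eta>0 \<ge> exp (- ((1 + 2 * m) * (\<theta> * ?W)))"
    proof (cases "init = {}")
      case True
      then have "Phi \<Lambda> (\<lambda>x. \<theta> * hit t B x) \<eta>0 = 1" "?W = 0"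
        by (auto simp: init_def Phi_def hit_def)
      then show ?thesis by simp
    next
      case False
      \<comment> \<open>Only a nonempty initial set forces m \<ge> 0, hence the case
        distinction.\<close>
      then have m0: "m \<ge> 0" using m(1) hit_nonneg order_trans by (metis ex_in_conv)
      have "(1 + 2 * m) * (\<Sum>x\<in>\<Lambda> \<inter> init. \<theta> * hit t B x) \<le> (1 + 2 * m) * (\<theta> * ?W)"
        using \<Lambda>(2) \<theta> m0 by (intro mult_left_mono) (auto simp flip: sum_distrib_left intro!: mult_left_mono)
      then have "exp (- ((1 + 2 * m) * (\<theta> * ?W))) \<le> exp (- ((1 + 2 * m) * (\<Sum>x\<in>\<Lambda> \<inter> init. \<theta> * hit t B x)))"
        by simp
      also have "\<dots> \<le> Phi \<Lambda> (\<lambda>x. \<theta> * hit t B x) \<eta>0"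
        unfolding init_def
      proof (rule Phi_ge_exp[OF \<Lambda>(1) _ m(2)])
        show "0 \<le> \<theta> * hit t B x \<and> \<theta> * hit t B x \<le> m" if "\<eta>0 x" for x
          using m(1)[of x] that \<theta> m0 mult_left_le_one_le[of "hit t B x" \<theta>] by (auto simp: init_def)
      qed
      finally show ?thesis .
    qed
    ultimately show ?thesis by linarith
  qed
  have ev: "\<forall>\<^sub>F \<epsilon> in at_right 0. exp (- ((1 + 2 * m) * (\<theta> * ?W))) - 2 * K * sqrt t - \<delta> * t - 2 * \<theta> * \<epsilon> * t \<le> mean t (Phi B (\<lambda>_. \<theta>))"
    using * by (intro eventually_at_rightI[of 0 1]) auto
  have "((\<lambda>\<epsilon>. exp (- ((1 + 2 * m) * (\<theta> * ?W))) - 2 * K * sqrt t - \<delta> * t - 2 * \<theta> * \<epsilon> * t) \<longlongrightarrow>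
      exp (- ((1 + 2 * m) * (\<theta> * ?W))) - 2 * K * sqrt t - \<delta> * t - 2 * \<theta> * 0 * t) (at_right 0)"
    by (intro tendsto_intros)
  from tendsto_upperbound[OF this ev] show ?thesis by simp
qed

end

section \<open>Poisson limit of the number of particles in the half-space\<close>

text \<open>The Markov property at time 0, averaged: the conditional expectation is
  \<open>S t f\<close> at the initial configuration, almost surely a constant. From here on the
  process enters through its laws at single times.\<close>

lemma ssep_from_expectation:
  fixes \<eta> :: "real \<Rightarrow> 'w \<Rightarrow> 'n::finite config"
  assumes "ssep_from \<eta>0 P \<eta>"
  obtains S where "ssep_semigroup S"
    "\<And>t f. t \<ge> 0 \<Longrightarrow> (\<integral>\<omega>. apply_bcontfun f (\<eta> t \<omega>) \<partial>P) = apply_bcontfun (S t f) \<eta>0"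
proof -
  interpret prob_space P using assms by (simp add: ssep_from_def)
  have meas: "\<eta> t \<in> borel_measurable P" if "t \<ge> 0" for t
    using assms that by (simp add: ssep_from_def)
  have start: "AE \<omega> in P. \<eta> 0 \<omega> = \<eta>0" using assms by (simp add: ssep_from_def)
  from assms obtain S where S: "ssep_semigroup S"
    "\<And>f s t. 0 \<le> s \<Longrightarrow> s \<le> t \<Longrightarrow> (AE \<omega> in P. real_cond_exp P (past P \<eta> s) (\<lambda>\<omega>'. apply_bcontfun f (\<eta> t \<omega>')) \<omega>
                        = apply_bcontfun (S (t - s) f) (\<eta> s \<omega>))"
    unfolding ssep_from_def by (elim conjE exE) (rule that, assumption, blast)
  have sub: "subalgebra P (past P \<eta> 0)"
  proof -
    have "{\<eta> u -` B \<inter> space P |u B. 0 \<le> u \<and> u \<le> 0 \<and> B \<in> sets borel} \<subseteq> sets P"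
      using meas by (auto intro: measurable_sets)
    then have "sigma_sets (space P) {\<eta> u -` B \<inter> space P |u B. 0 \<le> u \<and> u \<le> 0 \<and> B \<in> sets borel} \<subseteq> sets P"
      by (rule sets.sigma_sets_subset)
    moreover have "{\<eta> u -` B \<inter> space P |u B. 0 \<le> u \<and> u \<le> 0 \<and> B \<in> sets borel} \<subseteq> Pow (space P)" by auto
    ultimately show ?thesis by (simp add: subalgebra_def past_def)
  qed
  interpret F: finite_measure_subalgebra P "past P \<eta> 0"
    by standard (rule sub)
  have "(\<integral>\<omega>. apply_bcontfun f (\<eta> t \<omega>) \<partial>P) = apply_bcontfun (S t f) \<eta>0" if t: "t \<ge> 0" for t f
  proof -
    have fm: "apply_bcontfun f \<in> borel_measurable borel"
      by (intro borel_measurable_continuous_onI) simp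
    have int: "integrable P (\<lambda>\<omega>. apply_bcontfun f (\<eta> t \<omega>))"
    proof (rule integrable_const_bound[where B = "norm f"])
      show "AE \<omega> in P. norm (apply_bcontfun f (\<eta> t \<omega>)) \<le> norm f" by (intro AE_I2 norm_bounded)
      show "(\<lambda>\<omega>. apply_bcontfun f (\<eta> t \<omega>)) \<in> borel_measurable P"
        by (rule measurable_compose[OF meas[OF t] fm])
    qed
    have "(\<integral>\<omega>. apply_bcontfun f (\<eta> t \<omega>) \<partial>P) = (\<integral>\<omega>. real_cond_exp P (past P \<eta> 0) (\<lambda>\<omega>'. apply_bcontfun f (\<eta> t \<omega>')) \<omega> \<partial>P)"
      by (rule F.real_cond_exp_int(2)[OF int, symmetric])
    also have "\<dots> = (\<integral>\<omega>. apply_bcontfun (S t f) \<eta>0 \<partial>P)"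
    proof (rule integral_cong_AE)
      show "AE \<omega> in P. real_cond_exp P (past P \<eta> 0) (\<lambda>\<omega>'. apply_bcontfun f (\<eta> t \<omega>')) \<omega> = apply_bcontfun (S t f) \<eta>0"
        using S(2)[of 0 t f] start t by auto
    qed (simp_all add: borel_measurable_cond_exp2)
    finally show ?thesis by (simp add: prob_space)
  qed
  with S(1) show ?thesis by (rule that)
qed

lemma measurable_site:
  fixes X :: "'w \<Rightarrow> 'n::finite config"
  assumes "X \<in> borel_measurable P"
  shows "Measurable.pred P (\<lambda>\<omega>. X \<omega> v)"
proof -
  have "(\<lambda>\<zeta> :: 'n config. \<zeta> v) \<in> borel_measurable borel"
    by (intro borel_measurable_continuous_onI) simp
  from measurable_compose[OF assms this] have "(\<lambda>\<omega>. X \<omega> v) \<in> borel_measurable P" .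
  also have "borel_measurable P = measurable P (count_space (UNIV :: bool set))"
    by (rule measurable_cong_sets) (simp_all add: sets_borel_eq_count_space)
  finally show ?thesis .
qed

lemma poisson_pgf:
  assumes "l > 0" "0 \<le> s"
  shows "(\<integral>k. s ^ k \<partial>poisson_pmf l) = exp (- (l * (1 - s)))" "integrable (poisson_pmf l) (\<lambda>k. s ^ k)"
proof -
  have "(\<integral>\<^sup>+k. ennreal (s ^ k) \<partial>poisson_pmf l) = (\<Sum>k. ennreal (exp (-l) * ((l * s) ^ k / fact k)))"
    using assms
    by (simp add: nn_integral_measure_pmf nn_integral_count_space_nat power_mult_distrib mult_ac flip: ennreal_mult)
  also have "\<dots> = ennreal (exp (-l) * exp (l * s))"
  proof (rule suminf_ennreal_eq)
    show "(\<lambda>k. exp (-l) * ((l * s) ^ k / fact k)) sums (exp (-l) * exp (l * s))"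
      using exp_converges[of "l * s"] by (intro sums_mult) (simp add: divide_inverse mult.commute)
  qed (use assms in auto)
  also have "exp (-l) * exp (l * s) = exp (- (l * (1 - s)))"
    by (simp add: mult_exp_exp algebra_simps)
  finally have "has_bochner_integral (poisson_pmf l) (\<lambda>k. s ^ k) (exp (- (l * (1 - s))))"
    using assms by (intro has_bochner_integral_nn_integral) auto
  then show "(\<integral>k. s ^ k \<partial>poisson_pmf l) = exp (- (l * (1 - s)))" "integrable (poisson_pmf l) (\<lambda>k. s ^ k)"
    by (simp_all add: has_bochner_integral_iff)
qed

text \<open>The values 2^(-n) leave a gap between 2^(-(m+1)) and 2^(-m), across which
  \<open>g\<close> interpolates linearly from 0 to 1. So the indicator of N \<le> m becomes a
  continuous function of u = 2^(-N), which Stone-Weierstrass approximates uniformly. The mean of u^i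
  is the generating function at \<theta> = 1 - 2^(-i).\<close>

lemma poisson_convergence:
  fixes N :: "real \<Rightarrow> 'w \<Rightarrow> nat"
  assumes P: "prob_space P" and N: "\<And>t. N t \<in> measurable P (count_space UNIV)" and l: "l > 0"
    and pgf: "\<And>\<theta>. 0 \<le> \<theta> \<Longrightarrow> \<theta> \<le> 1 \<Longrightarrow> ((\<lambda>t. \<integral>\<omega>. (1 - \<theta>) ^ N t \<omega> \<partial>P) \<longlongrightarrow> exp (- (l * \<theta>))) at_top"
  shows "((\<lambda>t. measure P {\<omega> \<in> space P. N t \<omega> \<le> m}) \<longlongrightarrow> (\<Sum>k\<le>m. l ^ k / fact k * exp (- l))) at_top"
proof -
  interpret prob_space P by fact
  let ?u = "\<lambda>n :: nat. (1 / 2 :: real) ^ n"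
  define g where "g u = min 1 (max 0 ((u - ?u (Suc m)) / (?u m - ?u (Suc m))))" for u :: real
  have cont: "continuous_on {0..1} g" unfolding g_def by (intro continuous_intros) auto
  have g: "g (?u n) = of_bool (n \<le> m)" for n
  proof (cases "n \<le> m")
    case True
    then have "?u n \<ge> ?u m" by (intro power_decreasing) auto
    then have "1 \<le> (?u n - ?u (Suc m)) / (?u m - ?u (Suc m))" by (subst le_divide_eq_1_pos) auto
    moreover have "min 1 (max 0 r) = 1" if "1 \<le> r" for r :: real using that by auto
    ultimately show ?thesis using True by (simp only: g_def of_bool_eq)
  next
    case False
    then have "?u n \<le> ?u (Suc m)" by (intro power_decreasing) auto
    then have "(?u n - ?u (Suc m)) / (?u m - ?u (Suc m)) \<le> 0" by (intro divide_nonpos_pos) auto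
    then show ?thesis using False by (simp add: g_def)
  qed
  let ?Q = "measure_pmf.prob (poisson_pmf l) {..m}"
  have Q: "?Q = (\<Sum>k\<le>m. l ^ k / fact k * exp (- l))"
    using l by (simp add: measure_measure_pmf_finite)
  have Nm: "{\<omega> \<in> space P. N t \<omega> \<le> m} \<in> sets P" for t
    using N[of t] by measurable
  have "((\<lambda>t. measure P {\<omega> \<in> space P. N t \<omega> \<le> m}) \<longlongrightarrow> ?Q) at_top"
  proof (rule tendstoI)
    fix \<epsilon> :: real assume \<epsilon>: "\<epsilon> > 0"
    obtain p where p: "real_polynomial_function p" "\<And>u. u \<in> {0..1} \<Longrightarrow> \<bar>g u - p u\<bar> < \<epsilon> / 4"
      using Stone_Weierstrass_real_polynomial_function[OF compact_Icc cont, of "\<epsilon> / 4"] \<epsilon> by auto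
    obtain a d where p_eq: "p = (\<lambda>u. \<Sum>i\<le>d. a i * u ^ i)"
      using iffD1[OF real_polynomial_function_iff_sum p(1)] by (elim exE) (rule that)
    have u01: "?u n \<in> {0..1}" for n unfolding atLeastAtMost_iff
      by (intro conjI zero_le_power power_le_one) simp_all
    have meas_pow: "(\<lambda>\<omega>. c ^ N t \<omega>) \<in> borel_measurable P" for c :: real and t
      by (rule measurable_compose[OF N[of t]]) (simp only: measurable_count_space_eq1 space_borel, simp)
    have int_pow: "integrable P (\<lambda>\<omega>. (?u i) ^ N t \<omega>)" for i t
    proof (rule integrable_const_bound[where B = 1])
      have "norm (?u i ^ k) \<le> 1" for k
        unfolding norm_power using u01[of i] by (intro power_le_one) (simp_all only: atLeastAtMost_iff real_norm_def abs_of_nonneg abs_ge_zero)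
      then show "AE \<omega> in P. norm (?u i ^ N t \<omega>) \<le> 1" by simp
    qed (rule meas_pow)
    have pu: "p (?u n) = (\<Sum>i\<le>d. a i * (?u i) ^ n)" for n
      unfolding p_eq power_mult[symmetric] mult.commute[of n] ..
    have int_p: "integrable P (\<lambda>\<omega>. p (?u (N t \<omega>)))" for t
      unfolding pu by (rule Bochner_Integration.integrable_sum, rule integrable_mult_right, rule int_pow)
    have int_pQ: "integrable (poisson_pmf l) (\<lambda>k. p (?u k))"
      unfolding pu
      by (rule Bochner_Integration.integrable_sum, rule integrable_mult_right, rule poisson_pgf(2)[OF l]) simp
    have int_Q: "integrable (poisson_pmf l) (indicator {..m} :: _ \<Rightarrow> real)"
      by (rule measure_pmf.integrable_const_bound[where B = 1]) (auto simp: indicator_def)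
    have "((\<lambda>t. \<Sum>i\<le>d. a i * (\<integral>\<omega>. (?u i) ^ N t \<omega> \<partial>P)) \<longlongrightarrow> (\<Sum>i\<le>d. a i * exp (- (l * (1 - ?u i))))) at_top"
    proof (intro tendsto_sum tendsto_mult tendsto_const)
      fix i
      show "((\<lambda>t. \<integral>\<omega>. (?u i) ^ N t \<omega> \<partial>P) \<longlongrightarrow> exp (- (l * (1 - ?u i)))) at_top"
        using pgf[of "1 - ?u i"] by (simp add: power_le_one)
    qed
    moreover have "(\<Sum>i\<le>d. a i * (\<integral>\<omega>. (?u i) ^ N t \<omega> \<partial>P)) = (\<integral>\<omega>. p (?u (N t \<omega>)) \<partial>P)" for t
      unfolding pu using int_pow
      by (subst Bochner_Integration.integral_sum) (simp_all only: integrable_mult_right integral_mult_right_zero)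
    moreover have "(\<Sum>i\<le>d. a i * exp (- (l * (1 - ?u i)))) = (\<integral>k. p (?u k) \<partial>poisson_pmf l)"
    proof -
      have i: "integrable (poisson_pmf l) (\<lambda>k. ?u i ^ k)" for i by (rule poisson_pgf(2)[OF l]) simp
      have "(\<integral>k. ?u i ^ k \<partial>poisson_pmf l) = exp (- (l * (1 - ?u i)))" for i by (rule poisson_pgf(1)[OF l]) simp
      then show ?thesis unfolding pu using i
        by (subst Bochner_Integration.integral_sum) (simp_all only: integrable_mult_right integral_mult_right_zero)
    qed
    ultimately have lim: "((\<lambda>t. \<integral>\<omega>. p (?u (N t \<omega>)) \<partial>P) \<longlongrightarrow> (\<integral>k. p (?u k) \<partial>poisson_pmf l)) at_top"
      by simp
    have ap: "\<bar>measure P {\<omega> \<in> space P. N t \<omega> \<le> m} - (\<integral>\<omega>. p (?u (N t \<omega>)) \<partial>P)\<bar> \<le> \<epsilon> / 4" for t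
    proof -
      have ind: "(\<integral>\<omega>. indicator {\<omega> \<in> space P. N t \<omega> \<le> m} \<omega> \<partial>P) = measure P {\<omega> \<in> space P. N t \<omega> \<le> m}"
        using Nm[of t] by simp
      have int_i: "integrable P (indicator {\<omega> \<in> space P. N t \<omega> \<le> m} :: _ \<Rightarrow> real)"
        using Nm[of t] by (simp add: emeasure_eq_measure)
      have "\<bar>\<integral>\<omega>. indicator {\<omega> \<in> space P. N t \<omega> \<le> m} \<omega> - p (?u (N t \<omega>)) \<partial>P\<bar> \<le> (\<integral>\<omega>. \<bar>indicator {\<omega> \<in> space P. N t \<omega> \<le> m} \<omega> - p (?u (N t \<omega>))\<bar> \<partial>P)"
        by (rule integral_abs_bound)
      also have "\<dots> \<le> (\<integral>\<omega>. \<epsilon> / 4 \<partial>P)"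
      proof (rule integral_mono)
        fix \<omega> assume "\<omega> \<in> space P"
        then have "indicator {\<omega> \<in> space P. N t \<omega> \<le> m} \<omega> = g (?u (N t \<omega>))" by (simp add: g indicator_def)
        then show "\<bar>indicator {\<omega> \<in> space P. N t \<omega> \<le> m} \<omega> - p (?u (N t \<omega>))\<bar> \<le> \<epsilon> / 4"
          using p(2)[OF u01[of "N t \<omega>"]] by (simp only:)
      qed (intro integrable_abs Bochner_Integration.integrable_diff int_i int_p, simp)
      finally show ?thesis
        unfolding Bochner_Integration.integral_diff[OF int_i int_p] ind by (simp add: prob_space)
    qed
    have ap': "\<bar>?Q - (\<integral>k. p (?u k) \<partial>poisson_pmf l)\<bar> \<le> \<epsilon> / 4"
    proof -
      have "\<bar>\<integral>k. indicator {..m} k - p (?u k) \<partial>poisson_pmf l\<bar> \<le> (\<integral>k. \<bar>indicator {..m} k - p (?u k)\<bar> \<partial>poisson_pmf l)"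
        by (rule integral_abs_bound)
      also have "\<dots> \<le> (\<integral>k. \<epsilon> / 4 \<partial>poisson_pmf l)"
      proof (rule integral_mono)
        fix k
        have "indicator {..m} k = g (?u k)" by (simp add: g indicator_def)
        then show "\<bar>indicator {..m} k - p (?u k)\<bar> \<le> \<epsilon> / 4"
          using p(2)[OF u01[of k]] by (simp only:)
      qed (intro integrable_abs Bochner_Integration.integrable_diff int_Q int_pQ, simp)
      finally show ?thesis
        unfolding Bochner_Integration.integral_diff[OF int_Q int_pQ] by simp
    qed
    have "\<forall>\<^sub>F t in at_top. dist (\<integral>\<omega>. p (?u (N t \<omega>)) \<partial>P) (\<integral>k. p (?u k) \<partial>poisson_pmf l) < \<epsilon> / 4"
      using tendstoD[OF lim, of "\<epsilon> / 4"] \<epsilon> by simp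
    then show "\<forall>\<^sub>F t in at_top. dist (measure P {\<omega> \<in> space P. N t \<omega> \<le> m}) ?Q < \<epsilon>"
    proof eventually_elim
      case (elim t)
      then show ?case using ap[of t] ap' \<epsilon> unfolding dist_real_def by linarith
    qed
  qed
  then show ?thesis by (simp only: Q)
qed

section \<open>Finite boxes in the half-space\<close>

definition half_space :: "'n::finite \<Rightarrow> int \<Rightarrow> (int ^ 'n) set" where
  "half_space j n = {v. v $ j > n}"

text \<open>A finite piece of the half-space, on which \<open>Phi\<close> is a local
  function.\<close>

definition half_box :: "'n::finite \<Rightarrow> int \<Rightarrow> nat \<Rightarrow> (int ^ 'n) set" where
  "half_box j n L = {v. v $ j > n \<and> (\<forall>i. \<bar>v $ i\<bar> \<le> int L)}"

text \<open>The weak inequality lets the tail overlap the outermost sites of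
  \<open>half_box\<close>: a bond that leaves the box other than through the hyperplane has both
  ends in the tail, as \<open>bdry_half_box\<close> needs.\<close>

definition half_tail :: "'n::finite \<Rightarrow> int \<Rightarrow> nat \<Rightarrow> (int ^ 'n) set" where
  "half_tail j n L = {v. v $ j > n \<and> (\<exists>i. \<bar>v $ i\<bar> \<ge> int L)}"

lemma finite_half_box: "finite (half_box j n L)"
proof -
  have "half_box j n L \<subseteq> (\<lambda>f. \<chi> i. f i) ` (Pi\<^sub>E UNIV (\<lambda>_. {- int L..int L}))"
  proof
    fix x assume "x \<in> half_box j n L"
    then have "(\<lambda>i. x $ i) \<in> Pi\<^sub>E UNIV (\<lambda>_. {- int L..int L})" by (auto simp: half_box_def abs_le_iff minus_le_iff)
    moreover have "x = (\<chi> i. x $ i)" by simp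
    ultimately show "x \<in> (\<lambda>f. \<chi> i. f i) ` (Pi\<^sub>E UNIV (\<lambda>_. {- int L..int L}))" by (metis imageI)
  qed
  then show ?thesis by (rule finite_subset) (intro finite_imageI finite_PiE, auto)
qed

lemma nbrs_coord_le: "e \<in> nbrs \<Longrightarrow> \<bar>e $ i\<bar> \<le> 1"
  by (auto simp: nbrs_eq axis_def)

lemma bdry_half_box:
  "bdry (half_box j n L) \<subseteq> {v. v $ j = n} \<union> {v. v $ j = n + 1} \<union> half_tail j n L"
proof
  fix v assume "v \<in> bdry (half_box j n L)"
  then obtain e where e: "e \<in> nbrs" "(v \<in> half_box j n L) \<noteq> (v + e \<in> half_box j n L)"
    by (auto simp: bdry_def)
  have c: "\<bar>e $ i\<bar> \<le> 1" for i by (rule nbrs_coord_le[OF e(1)])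
  show "v \<in> {v. v $ j = n} \<union> {v. v $ j = n + 1} \<union> half_tail j n L"
  proof (cases "v $ j = n \<or> v $ j = n + 1")
    case False
    have vj: "v $ j > n \<and> v $ j + e $ j > n"
    proof -
      have "v $ j > n \<or> v $ j + e $ j > n" using e(2) by (auto simp: half_box_def)
      then show ?thesis using c[of j] False by linarith
    qed
    have "\<exists>i. \<bar>v $ i\<bar> \<ge> int L"
    proof (rule ccontr)
      assume "\<not> ?thesis"
      then have lt: "\<bar>v $ i\<bar> < int L" for i by (auto simp: not_le)
      have "\<bar>v $ i\<bar> \<le> int L" for i using lt[of i] by linarith
      moreover have "\<bar>v $ i + e $ i\<bar> \<le> int L" for i using lt[of i] c[of i] by linarith
      ultimately show False using e(2) vj by (auto simp: half_box_def)
    qed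
    then show ?thesis using vj by (auto simp: half_tail_def)
  qed auto
qed

lemma mass_eq_emeasure: "mass t A D = emeasure (density (count_space UNIV) (\<lambda>x. ennreal (hit t A x))) D"
  by (simp add: mass_def emeasure_density)

lemma mass_half_tail_lim:
  assumes "mass t A (half_space j n) < \<infinity>"
  shows "(\<lambda>L. mass t A (half_tail j n L)) \<longlonglongrightarrow> 0"
proof -
  let ?M = "density (count_space UNIV) (\<lambda>x. ennreal (hit t A x))"
  have empty: "(\<Inter>L. half_tail j n L) = {}"
  proof -
    have "\<exists>L. v \<notin> half_tail j n L" for v :: "int ^ 'a"
    proof -
      define L where "L = Suc (\<Sum>i\<in>UNIV. nat \<bar>v $ i\<bar>)"
      have "nat \<bar>v $ i\<bar> \<le> (\<Sum>i\<in>UNIV. nat \<bar>v $ i\<bar>)" for i by (rule member_le_sum) auto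
      then have "\<bar>v $ i\<bar> < int L" for i unfolding L_def by (metis le_imp_less_Suc nat_less_iff abs_ge_zero)
      then show ?thesis by (auto simp: half_tail_def not_le intro!: exI[of _ L])
    qed
    then show ?thesis by auto
  qed
  have "(\<lambda>L. emeasure ?M (half_tail j n L)) \<longlonglongrightarrow> emeasure ?M (\<Inter>L. half_tail j n L)"
  proof (rule Lim_emeasure_decseq)
    show "decseq (half_tail j n)" by (auto simp: decseq_def half_tail_def) (meson of_nat_mono order_trans)
    have "mass t A (half_tail j n L) \<le> mass t A (half_space j n)" for L
      by (rule mass_mono) (auto simp: half_tail_def half_space_def)
    then have "mass t A (half_tail j n L) < \<infinity>" for L
      using assms by (rule le_less_trans)
    then show "emeasure ?M (half_tail j n L) \<noteq> \<infinity>" for L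
      unfolding mass_eq_emeasure by (rule less_imp_neq)
  qed auto
  then show ?thesis by (simp add: empty mass_eq_emeasure)
qed

lemma mass_half_box:
  assumes "mass t A (half_space j n) < \<infinity>"
  shows "(\<Sum>b\<in>half_box j n L. hit t A b) \<le> enn2real (mass t A (half_space j n))"
    and "enn2real (mass t A (half_space j n)) \<le> (\<Sum>b\<in>half_box j n L. hit t A b) + enn2real (mass t A (half_tail j n L))"
proof -
  let ?W = "\<Sum>b\<in>half_box j n L. hit t A b"
  have W: "ennreal ?W = mass t A (half_box j n L)" by (rule mass_finite[OF finite_half_box, symmetric])
  have W0: "?W \<ge> 0" by (simp add: sum_nonneg)
  have "mass t A (half_box j n L) \<le> mass t A (half_space j n)"
    by (rule mass_mono) (auto simp: half_box_def half_space_def)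
  then have "enn2real (ennreal ?W) \<le> enn2real (mass t A (half_space j n))"
    using assms unfolding W by (intro enn2real_mono) auto
  then show "?W \<le> enn2real (mass t A (half_space j n))" using W0 by simp
  have "mass t A (half_tail j n L) \<le> mass t A (half_space j n)"
    by (rule mass_mono) (auto simp: half_tail_def half_space_def)
  then have fin: "mass t A (half_tail j n L) < \<infinity>" using assms by (rule le_less_trans)
  have "mass t A (half_space j n) \<le> mass t A (half_box j n L \<union> half_tail j n L)"
    by (rule mass_mono) (auto simp: half_box_def half_tail_def half_space_def not_le intro: less_imp_le)
  also have "\<dots> \<le> mass t A (half_box j n L) + mass t A (half_tail j n L)"
    unfolding mass_eq_emeasure by (rule emeasure_subadditive) auto
  finally have "enn2real (mass t A (half_space j n)) \<le> enn2real (ennreal ?W + mass t A (half_tail j n L))"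
    unfolding W[symmetric] using fin by (intro enn2real_mono) (auto simp: less_top[symmetric])
  also have "\<dots> = ?W + enn2real (mass t A (half_tail j n L))"
    using fin W0 by (subst enn2real_plus) auto
  finally show "enn2real (mass t A (half_space j n)) \<le> ?W + enn2real (mass t A (half_tail j n L))" .
qed

locale exclusion_front = scaling_layers d \<beta> x j K C + ssep_process S \<eta>0
  for d \<beta> x :: real and j :: "'n::finite" and K :: "nat \<Rightarrow> real" and C :: real
    and S :: "real \<Rightarrow> ('n config \<Rightarrow>\<^sub>C real) \<Rightarrow> ('n config \<Rightarrow>\<^sub>C real)" and \<eta>0 :: "'n config" +
  fixes g :: "'n \<Rightarrow> real \<Rightarrow> real"
  assumes \<eta>0_def: "\<eta>0 = init_config j g" and g_nonneg: "\<And>i k. i \<noteq> j \<Longrightarrow> 0 \<le> g i (real k)"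
    and K_def: "K = layer_card j g"
begin

lemma init_eq: "init = {x. init_config j g x}"
  unfolding init_def by (simp only: \<eta>0_def)

lemma mass_half_space_lim: "((\<lambda>t. mass t init (half_space j (Z t))) \<longlongrightarrow> ennreal limit_mass) at_top"
proof -
  have "\<forall>\<^sub>F t in at_top. (\<Sum>i. ennreal (hsum (Suc i) * k1 j t (Z t + int (Suc i)))) = mass t init (half_space j (Z t))"
    using eventually_ge_at_top[of 0]
  proof eventually_elim
    case (elim t)
    have "mass t {x. init_config j g x} {v. v $ j > Z t}
        = (\<Sum>i. ennreal ((\<Sum>k<Suc i. layer_card j g k) * k1 j t (Z t + int (Suc i))))"
      using g_nonneg elim by (intro mass_halfspace)
    then have "mass t {x. init_config j g x} {v. v $ j > Z t} = (\<Sum>i. ennreal (hsum (Suc i) * k1 j t (Z t + int (Suc i))))"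
      unfolding hsum_def unfolding K_def .
    then show ?case unfolding init_eq half_space_def by (rule sym)
  qed
  with halfspace_sum_lim show ?thesis by (rule Lim_transform_eventually)
qed

lemma mass_layers_le:
  obtains C3 where "C3 \<ge> 0"
    "\<forall>\<^sub>F t in at_top. \<forall>n \<ge> Z t. mass t init {v. v $ j = n} \<le> ennreal (C3 * Q t * \<rho> t powr (- \<beta>) / sqrt (T t))"
proof -
  obtain C3 where C3: "C3 \<ge> 0" "\<forall>\<^sub>F t in at_top. \<forall>n \<ge> Z t. (\<Sum>k. ennreal (K k * k1 j t (n + int k))) \<le> ennreal (C3 * Q t * \<rho> t powr (- \<beta>) / sqrt (T t))"
    by (rule layer_sum_le)
  from C3(2) eventually_ge_at_top[of 0]
  have "\<forall>\<^sub>F t in at_top. \<forall>n \<ge> Z t. mass t init {v. v $ j = n} \<le> ennreal (C3 * Q t * \<rho> t powr (- \<beta>) / sqrt (T t))"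
  proof eventually_elim
    case (elim t)
    have "mass t {x. init_config j g x} {v. v $ j = n} = (\<Sum>k. ennreal (K k * k1 j t (n + int k)))" for n
      unfolding K_def using g_nonneg elim(2) by (intro mass_layer)
    then show ?case using elim(1) unfolding init_eq by (simp only: simp_thms)
  qed
  with C3(1) show ?thesis by (rule that)
qed

text \<open>Run from v, the walk has to end in the initial configuration, hence at height at most 0:
  a Chernoff bound with the opposite tilt.\<close>

lemma hit_init_le:
  assumes "s \<ge> 0" "r \<ge> 0"
  shows "hit s init v \<le> exp (s / d * (cosh r - 1) - r * real_of_int (v $ j))"
proof -
  have "hit s init v \<le> exp (s / real CARD('n) * (cosh (- r) - 1) - (- r) * (0 - real_of_int (v $ j)))"
  proof (rule hit_chernoff[OF assms(1)])
    fix u assume "u \<in> init"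
    then have "real_of_int (u $ j) \<le> 0" by (simp add: init_eq init_config_def)
    then show "(- r) * real_of_int (u $ j) \<ge> (- r) * 0" using assms(2) by (simp add: mult_nonneg_nonpos)
  qed
  then show ?thesis unfolding d_card by simp
qed

lemma k1_le_d: "\<tau> > 0 \<Longrightarrow> k1 j \<tau> n \<le> exp (\<tau> / d * (cosh r - 1) - r * real_of_int n) / sqrt (\<tau> / d)"
  unfolding d_card by (rule k1_le)

lemma hit_half_box_le:
  assumes "t > 0" "\<rho> t > 0" "v \<in> init"
  shows "hit t (half_box j (Z t) L) v \<le> Q t"
proof -
  have "hit t (half_box j (Z t) L) v \<le> exp (t / CARD('n) * (cosh (\<rho> t) - 1) - \<rho> t * (real_of_int (Z t) - real_of_int (v $ j)))"
    by (rule hit_chernoff) (use assms in \<open>simp_all add: half_box_def mult_left_mono\<close>)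
  also have "\<dots> \<le> Q t"
  proof -
    have "v $ j \<le> 0" using assms by (simp add: init_eq init_config_def)
    then have "\<rho> t * real_of_int (v $ j) \<le> 0" using assms by (intro mult_nonneg_nonpos) auto
    then have "t / CARD('n) * (cosh (\<rho> t) - 1) - \<rho> t * (real_of_int (Z t) - real_of_int (v $ j))
        \<le> t / CARD('n) * (cosh (\<rho> t) - 1) - \<rho> t * real_of_int (Z t)"
      unfolding right_diff_distrib by linarith
    then show ?thesis unfolding Q_def T_card by (simp only: exp_le_cancel_iff)
  qed
  finally show ?thesis .
qed

text \<open>Of the square of (density times boundary probability), one factor is bounded pointwise
  by G and the other is summed by \<open>sum_hit_hit_le\<close>, which gives the layer mass at time
  t; on the tail the bound 1 takes the place of G. The constants come from (p + q + r)^2 \<le> 3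
  (p^2 + q^2 + r^2) and from the two hyperplanes in \<open>bdry_half_box\<close>.\<close>

lemma gradient_sum_le:
  assumes t: "t > 0" "\<rho> t > 0" and s: "0 < s" "s < t" and \<Lambda>: "finite \<Lambda>" and M: "M \<ge> 0"
    and m: "\<And>n. n \<ge> Z t \<Longrightarrow> mass t init {v. v $ j = n} \<le> ennreal M"
    and tail: "mass t init (half_tail j (Z t) L) \<le> ennreal \<delta>" "\<delta> \<ge> 0"
  shows "(\<Sum>v\<in>\<Lambda>. (hit s init v)\<^sup>2 * (hit (t - s) (bdry (half_box j (Z t) L)) v)\<^sup>2)
    \<le> (6 * sqrt d * Q t * M) / sqrt (t - s) + 3 * \<delta>"
proof -
  have dpos: "d > 0" using d by simp
  define a where "a i v = hit (t - s) {w. w $ j = Z t + i} v" for i v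
  define b where "b v = hit (t - s) (half_tail j (Z t) L) v" for v
  let ?q = "\<lambda>v. hit s init v"
  define G where "G = Q t * (sqrt d / sqrt (t - s))"
  have G0: "G \<ge> 0" using Q_nonneg dpos s by (simp add: G_def)
  have ab: "0 \<le> a i v" "0 \<le> b v" "b v \<le> 1" for i v by (simp_all add: a_def b_def)
  have qa: "?q v * a i v \<le> G" if "i \<ge> 0" for i v
  proof -
    have "a i v \<le> exp ((t - s) / d * (cosh (\<rho> t) - 1) - \<rho> t * real_of_int (Z t + i - v $ j)) / sqrt ((t - s) / d)"
      unfolding a_def hit_layer using s by (intro k1_le_d) auto
    from hit_init_le[of s "\<rho> t" v] this have "?q v * a i v \<le> exp (s / d * (cosh (\<rho> t) - 1) - \<rho> t * real_of_int (v $ j))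
        * (exp ((t - s) / d * (cosh (\<rho> t) - 1) - \<rho> t * real_of_int (Z t + i - v $ j)) / sqrt ((t - s) / d))"
      by (rule mult_mono) (use s t ab in auto)
    \<comment> \<open>The terms with the height of v cancel, and the times s and t - s add up to
      t.\<close>
    also have "\<dots> = exp (t / d * (cosh (\<rho> t) - 1) - \<rho> t * real_of_int (Z t) - \<rho> t * real_of_int i) / sqrt ((t - s) / d)"
    proof -
      have "s / d * (cosh (\<rho> t) - 1) + (t - s) / d * (cosh (\<rho> t) - 1) = t / d * (cosh (\<rho> t) - 1)"
        unfolding distrib_right[symmetric] add_divide_distrib[symmetric] by simp
      then have "s / d * (cosh (\<rho> t) - 1) - \<rho> t * real_of_int (v $ j) + ((t - s) / d * (cosh (\<rho> t) - 1) - \<rho> t * real_of_int (Z t + i - v $ j))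
        = t / d * (cosh (\<rho> t) - 1) - \<rho> t * real_of_int (Z t) - \<rho> t * real_of_int i"
        unfolding of_int_diff of_int_add right_diff_distrib distrib_left by linarith
      then show ?thesis unfolding times_divide_eq_right mult_exp_exp by (simp only:)
    qed
    also have "\<dots> \<le> exp (t / d * (cosh (\<rho> t) - 1) - \<rho> t * real_of_int (Z t)) / sqrt ((t - s) / d)"
      using that t s dpos by (intro divide_right_mono) (simp_all only: exp_le_cancel_iff, auto)
    also have "\<dots> = G" using dpos s by (simp add: G_def Q_def T_def real_sqrt_divide)
    finally show ?thesis .
  qed
  have sa: "(\<Sum>v\<in>\<Lambda>. ?q v * a i v) \<le> M" if "i \<ge> 0" for i
  proof -
    have "ennreal (\<Sum>v\<in>\<Lambda>. ?q v * a i v) \<le> mass (s + (t - s)) init {w. w $ j = Z t + i}"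
      unfolding a_def using s \<Lambda> by (intro sum_hit_hit_le) auto
    also have "\<dots> \<le> ennreal M" using m[of "Z t + i"] that by simp
    finally show ?thesis using M by simp
  qed
  have sb: "(\<Sum>v\<in>\<Lambda>. ?q v * b v) \<le> \<delta>"
  proof -
    have "ennreal (\<Sum>v\<in>\<Lambda>. ?q v * b v) \<le> mass (s + (t - s)) init (half_tail j (Z t) L)"
      unfolding b_def using s \<Lambda> by (intro sum_hit_hit_le) auto
    also have "\<dots> \<le> ennreal \<delta>" using tail by simp
    finally show ?thesis using tail(2) by simp
  qed
  have "(\<Sum>v\<in>\<Lambda>. (?q v)\<^sup>2 * (hit (t - s) (bdry (half_box j (Z t) L)) v)\<^sup>2)
      \<le> (\<Sum>v\<in>\<Lambda>. 3 * G * (?q v * a 0 v) + 3 * G * (?q v * a 1 v) + 3 * (?q v * b v))"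
  proof (rule sum_mono)
    fix v
    have "hit (t - s) (bdry (half_box j (Z t) L)) v \<le> hit (t - s) ({w. w $ j = Z t} \<union> {w. w $ j = Z t + 1} \<union> half_tail j (Z t) L) v"
      by (rule hit_mono[OF bdry_half_box])
    also have "\<dots> \<le> a 0 v + a 1 v + b v"
      unfolding a_def b_def
      using hit_Un_le[of "t - s" "{w. w $ j = Z t} \<union> {w. w $ j = Z t + 1}" "half_tail j (Z t) L" v]
        hit_Un_le[of "t - s" "{w. w $ j = Z t}" "{w. w $ j = Z t + 1}" v]
      unfolding add_0_right by linarith
    finally have "(hit (t - s) (bdry (half_box j (Z t) L)) v)\<^sup>2 \<le> (a 0 v + a 1 v + b v)\<^sup>2"
      by (intro power_mono) auto
    also have "\<dots> \<le> 3 * (a 0 v)\<^sup>2 + 3 * (a 1 v)\<^sup>2 + 3 * (b v)\<^sup>2"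
    proof -
      have "3 * (p\<^sup>2) + 3 * q\<^sup>2 + 3 * r\<^sup>2 - (p + q + r)\<^sup>2 = (p - q)\<^sup>2 + (q - r)\<^sup>2 + (p - r)\<^sup>2" for p q r :: real
        by (simp add: power2_eq_square algebra_simps)
      from this[of "a 0 v" "a 1 v" "b v"] show ?thesis
        using zero_le_power2[of "a 0 v - a 1 v"] zero_le_power2[of "a 1 v - b v"] zero_le_power2[of "a 0 v - b v"] by linarith
    qed
    finally have "(?q v)\<^sup>2 * (hit (t - s) (bdry (half_box j (Z t) L)) v)\<^sup>2 \<le> (?q v)\<^sup>2 * (3 * (a 0 v)\<^sup>2 + 3 * (a 1 v)\<^sup>2 + 3 * (b v)\<^sup>2)"
      by (rule mult_left_mono) simp
    also have "\<dots> = 3 * ((?q v * a 0 v) * (?q v * a 0 v)) + 3 * ((?q v * a 1 v) * (?q v * a 1 v)) + 3 * ((?q v * b v) * (?q v * b v))"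
      by (simp add: power2_eq_square algebra_simps)
    also have "\<dots> \<le> 3 * (G * (?q v * a 0 v)) + 3 * (G * (?q v * a 1 v)) + 3 * (1 * (?q v * b v))"
    proof (intro add_mono mult_left_mono mult_right_mono qa)
      show "?q v * b v \<le> 1" using ab by (intro mult_le_one) auto
    qed (use ab in auto)
    finally show "(?q v)\<^sup>2 * (hit (t - s) (bdry (half_box j (Z t) L)) v)\<^sup>2
        \<le> 3 * G * (?q v * a 0 v) + 3 * G * (?q v * a 1 v) + 3 * (?q v * b v)" by simp
  qed
  also have "\<dots> = 3 * G * (\<Sum>v\<in>\<Lambda>. ?q v * a 0 v) + 3 * G * (\<Sum>v\<in>\<Lambda>. ?q v * a 1 v) + 3 * (\<Sum>v\<in>\<Lambda>. ?q v * b v)"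
    by (simp only: sum.distrib sum_distrib_left)
  also have "\<dots> \<le> 3 * G * M + 3 * G * M + 3 * \<delta>"
    using G0 by (intro add_mono mult_left_mono sa sb) auto
  also have "\<dots> = (6 * sqrt d * Q t * M) / sqrt (t - s) + 3 * \<delta>" by (simp add: G_def)
  finally show ?thesis .
qed

text \<open>The tail of the box is allowed mass 1 / t^2 because its share of the error is multiplied
  by the length t of the time interval and still has to vanish. \<open>Q t\<close> plays the part of
  m in \<open>mean_Phi_ge\<close>.\<close>

lemma pgf_limit:
  assumes \<theta>: "0 \<le> \<theta>" "\<theta> \<le> 1"
    and L: "\<forall>\<^sub>F t in at_top. mass t init (half_tail j (Z t) (L t)) \<le> ennreal (1 / t\<^sup>2)"
  shows "((\<lambda>t. mean t (Phi (half_box j (Z t) (L t)) (\<lambda>_. \<theta>))) \<longlongrightarrow> exp (- (limit_mass * \<theta>))) at_top"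
proof -
  obtain C3 where C3: "C3 \<ge> 0"
    "\<forall>\<^sub>F t in at_top. \<forall>n \<ge> Z t. mass t init {v. v $ j = n} \<le> ennreal (C3 * Q t * \<rho> t powr (- \<beta>) / sqrt (T t))"
    by (rule mass_layers_le)
  define W where "W t = (\<Sum>b\<in>half_box j (Z t) (L t). hit t init b)" for t
  define EN where "EN t = enn2real (mass t init (half_space j (Z t)))" for t
  have "limit_mass \<ge> 0"
  proof -
    have "C \<ge> 0" by (rule LIMSEQ_le_const[OF K_lim]) (use K_nonneg in \<open>auto intro!: exI[of _ 0]\<close>)
    then show ?thesis using \<beta> d by (simp add: limit_mass_def Gamma_real_nonneg)
  qed
  then have EN: "(EN \<longlongrightarrow> limit_mass) at_top"
    using tendsto_enn2real[OF mass_half_space_lim] by (simp add: EN_def[abs_def])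
  have fin: "\<forall>\<^sub>F t in at_top. mass t init (half_space j (Z t)) < \<infinity>"
    by (rule order_tendstoD(2)[OF mass_half_space_lim]) simp
  have W_bounds: "\<forall>\<^sub>F t in at_top. EN t - 1 / t\<^sup>2 \<le> W t \<and> W t \<le> EN t"
    using fin L eventually_gt_at_top[of 0]
  proof eventually_elim
    case (elim t)
    have "enn2real (mass t init (half_tail j (Z t) (L t))) \<le> 1 / t\<^sup>2"
      using elim by (intro enn2real_leI) auto
    then show ?case using mass_half_box[OF elim(1), of "L t"] unfolding W_def EN_def by linarith
  qed
  have W: "(W \<longlongrightarrow> limit_mass) at_top"
  proof (rule tendsto_sandwich[OF _ _ _ EN])
    have "((\<lambda>t :: real. 1 / t\<^sup>2) \<longlongrightarrow> 0) at_top" by real_asymp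
    from tendsto_diff[OF EN this] show "((\<lambda>t. EN t - 1 / t\<^sup>2) \<longlongrightarrow> limit_mass) at_top" by simp
  qed (use W_bounds in \<open>auto elim: eventually_mono\<close>)
  define M where "M t = C3 * Q t * \<rho> t powr (- \<beta>) / sqrt (T t)" for t
  define Ke where "Ke t = 6 * sqrt d * Q t * M t" for t
  have Ke0: "((\<lambda>t. 2 * Ke t * sqrt t) \<longlongrightarrow> 0) at_top"
  proof -
    \<comment> \<open>The sqrt t from integrating 1 / sqrt (t - s) cancels the 1 / sqrt T of the
      layer mass and leaves the quantity of \<open>Q_\<rho>_lim\<close>.\<close>
    have "((\<lambda>t. 12 * d * C3 * ((Q t)\<^sup>2 * \<rho> t powr (- \<beta>))) \<longlongrightarrow> 0) at_top"
      using tendsto_mult_left[OF Q_\<rho>_lim, of "12 * d * C3"] by simp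
    moreover have "\<forall>\<^sub>F t in at_top. 12 * d * C3 * ((Q t)\<^sup>2 * \<rho> t powr (- \<beta>)) = 2 * Ke t * sqrt t"
      using eventually_gt_at_top[of 0]
    proof eventually_elim
      case (elim t)
      have "sqrt d * sqrt t / sqrt (T t) = d"
        using d elim by (simp add: T_def real_sqrt_divide)
      then have "12 * C3 * ((Q t)\<^sup>2 * \<rho> t powr (- \<beta>)) * (sqrt d * sqrt t / sqrt (T t)) = 12 * d * C3 * ((Q t)\<^sup>2 * \<rho> t powr (- \<beta>))"
        by simp
      then show ?case by (simp add: Ke_def M_def power2_eq_square mult_ac)
    qed
    ultimately show ?thesis by (rule Lim_transform_eventually)
  qed
  have "\<forall>\<^sub>F t in at_top. Q t < 1 / 2" using Q_lim by (rule order_tendstoD) simp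
  then have bounds: "\<forall>\<^sub>F t in at_top.
      exp (- ((1 + 2 * Q t) * (\<theta> * W t))) - 2 * Ke t * sqrt t - 3 / t \<le> mean t (Phi (half_box j (Z t) (L t)) (\<lambda>_. \<theta>)) \<and>
      mean t (Phi (half_box j (Z t) (L t)) (\<lambda>_. \<theta>)) \<le> exp (- (\<theta> * W t))"
    using C3(2) L \<rho>_pos eventually_gt_at_top[of 0]
  proof eventually_elim
    case (elim t)
    have M0: "M t \<ge> 0" using C3(1) Q_nonneg T_pos[of t] elim by (simp add: M_def)
    have K0: "Ke t \<ge> 0" using M0 Q_nonneg d by (simp add: Ke_def)
    have "mean t (Phi (half_box j (Z t) (L t)) (\<lambda>_. \<theta>)) \<ge> exp (- ((1 + 2 * Q t) * (\<theta> * W t))) - 2 * Ke t * sqrt t - (3 * (1 / t\<^sup>2)) * t"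
      unfolding W_def
    proof (rule mean_Phi_ge[OF _ finite_half_box \<theta> K0])
      show "hit t (half_box j (Z t) (L t)) v \<le> Q t" if "v \<in> init" for v
        using elim that by (intro hit_half_box_le) auto
      fix s and \<Lambda> :: "(int ^ 'n) set"
      assume "0 < s" "s < t" "finite \<Lambda>"
      then show "(\<Sum>v\<in>\<Lambda>. (hit s init v)\<^sup>2 * (hit (t - s) (bdry (half_box j (Z t) (L t))) v)\<^sup>2) \<le> Ke t / sqrt (t - s) + 3 * (1 / t\<^sup>2)"
        unfolding Ke_def using elim M0 by (intro gradient_sum_le) (auto simp: M_def)
    qed (use elim in auto)
    moreover have "(3 * (1 / t\<^sup>2)) * t = 3 / t" using elim by (simp add: power2_eq_square)
    moreover have "mean t (Phi (half_box j (Z t) (L t)) (\<lambda>_. \<theta>)) \<le> exp (- (\<theta> * W t))"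
      unfolding W_def using elim by (intro mean_Phi_le finite_half_box \<theta>) auto
    ultimately show ?case by simp
  qed
  have lower: "((\<lambda>t. exp (- ((1 + 2 * Q t) * (\<theta> * W t))) - 2 * Ke t * sqrt t - 3 / t) \<longlongrightarrow> exp (- (limit_mass * \<theta>))) at_top"
  proof -
    have "((\<lambda>t :: real. 3 / t) \<longlongrightarrow> 0) at_top" by real_asymp
    then have "((\<lambda>t. exp (- ((1 + 2 * Q t) * (\<theta> * W t))) - 2 * Ke t * sqrt t - 3 / t) \<longlongrightarrow> exp (- ((1 + 2 * 0) * (\<theta> * limit_mass))) - 0 - 0) at_top"
      by (intro tendsto_diff tendsto_exp tendsto_minus tendsto_mult tendsto_add tendsto_const W Ke0 Q_lim)
    then show ?thesis by (simp add: mult.commute)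
  qed
  have upper: "((\<lambda>t. exp (- (\<theta> * W t))) \<longlongrightarrow> exp (- (limit_mass * \<theta>))) at_top"
  proof -
    have "((\<lambda>t. exp (- (\<theta> * W t))) \<longlongrightarrow> exp (- (\<theta> * limit_mass))) at_top"
      by (intro tendsto_intros W)
    then show ?thesis by (simp add: mult.commute)
  qed
  show ?thesis
    by (rule tendsto_sandwich[OF _ _ lower upper]) (use bounds in \<open>auto elim: eventually_mono\<close>)
qed

end

section \<open>From generating functions to order statistics\<close>

lemma Phi_const: "finite B \<Longrightarrow> Phi B (\<lambda>_. \<theta>) \<zeta> = (1 - \<theta>) ^ card {v \<in> B. \<zeta> v}"
  by (simp add: Phi_eq_prod Collect_conj_eq)

lemma ereal_affine_le_iff: "b > 0 \<Longrightarrow> y / ereal b - ereal a \<le> ereal x \<longleftrightarrow> y \<le> ereal (b * (x + a))"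
  by (cases y) (auto simp: field_simps)

lemma half_box_mono: "L \<le> L' \<Longrightarrow> half_box j n L \<subseteq> half_box j n L'"
  by (auto simp: half_box_def) (meson of_nat_mono order_trans)

text \<open>Every finite set of particles in the half-space lies in some box. Finiteness is stated
  along with the bound because \<open>card\<close> of an infinite set is 0.\<close>

lemma count_half_space_le_iff:
  "finite {v. \<zeta> v \<and> n < v $ j} \<and> card {v. \<zeta> v \<and> n < v $ j} \<le> m
    \<longleftrightarrow> (\<forall>L. card {v \<in> half_box j n L. \<zeta> v} \<le> m)" (is "finite ?N \<and> _ \<longleftrightarrow> ?R")
proof
  assume fin: "finite ?N \<and> card ?N \<le> m"
  show ?R
  proof
    fix L
    have "card {v \<in> half_box j n L. \<zeta> v} \<le> card ?N"
      using fin by (intro card_mono) (auto simp: half_box_def)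
    then show "card {v \<in> half_box j n L. \<zeta> v} \<le> m" using fin by simp
  qed
next
  assume R: ?R
  have small: "card A \<le> m" if A: "A \<subseteq> ?N" "finite A" for A
  proof -
    define L where "L = (\<Sum>v\<in>A. \<Sum>i\<in>UNIV. nat \<bar>v $ i\<bar>)"
    have "\<bar>v $ i\<bar> \<le> int L" if "v \<in> A" for v i
    proof -
      have "nat \<bar>v $ i\<bar> \<le> (\<Sum>i\<in>UNIV. nat \<bar>v $ i\<bar>)" by (rule member_le_sum) auto
      also have "\<dots> \<le> L" unfolding L_def using A(2) that by (intro member_le_sum) auto
      finally show ?thesis by linarith
    qed
    then have "A \<subseteq> {v \<in> half_box j n L. \<zeta> v}" using A(1) by (auto simp: half_box_def)
    then have "card A \<le> card {v \<in> half_box j n L. \<zeta> v}"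
      using finite_half_box[of j n L] by (intro card_mono) auto
    then show ?thesis using R order_trans by blast
  qed
  have "finite ?N"
  proof (rule ccontr)
    assume "infinite ?N"
    from infinite_arbitrarily_large[OF this, of "Suc m"]
    obtain A where "finite A" "card A = Suc m" "A \<subseteq> ?N" by auto
    then show False using small[of A] by simp
  qed
  then show "finite ?N \<and> card ?N \<le> m" using small by simp
qed

lemma measurable_count:
  fixes X :: "'w \<Rightarrow> 'n::finite config"
  assumes "finite B" "X \<in> borel_measurable P"
  shows "(\<lambda>\<omega>. card {v \<in> B. X \<omega> v}) \<in> measurable P (count_space UNIV)"
proof -
  have "(\<lambda>\<omega>. \<Sum>v\<in>B. if X \<omega> v then 1 else 0 :: nat) \<in> measurable P (count_space UNIV)"
    using assms(1)
  proof (induction B rule: finite_induct)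
    case (insert b B)
    have "(\<lambda>\<omega>. (if X \<omega> b then 1 else 0) + (\<Sum>v\<in>B. if X \<omega> v then 1 else 0 :: nat)) \<in> measurable P (count_space UNIV)"
      using insert.IH measurable_site[OF assms(2), of b] by measurable
    then show ?case using insert.hyps by simp
  qed simp
  moreover have "(\<Sum>v\<in>B. if X \<omega> v then 1 else 0) = card {v \<in> B. X \<omega> v}" for \<omega>
    using assms(1) by (simp add: sum.If_cases Collect_conj_eq)
  ultimately show ?thesis by simp
qed

context exclusion_front
begin

text \<open>The event concerns an infinite half-space while the estimates are for boxes. For each t
  a box is chosen so large that cutting to it changes the probability by at most 1 / t and leaves
  out mass at most 1 / t^2; then t tends to infinity along these boxes.\<close>

lemma order_stat_limit:
  fixes P :: "'w measure" and \<eta> :: "real \<Rightarrow> 'w \<Rightarrow> 'n config"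
  assumes P: "prob_space P" and meas: "\<And>t. t \<ge> 0 \<Longrightarrow> \<eta> t \<in> borel_measurable P"
    and law: "\<And>t f. t \<ge> 0 \<Longrightarrow> (\<integral>\<omega>. apply_bcontfun f (\<eta> t \<omega>) \<partial>P) = apply_bcontfun (S t f) \<eta>0"
    and pos: "limit_mass > 0"
  shows "((\<lambda>t. measure P {\<omega> \<in> space P. order_stat j m (\<eta> t \<omega>) / ereal (bb t) - ereal (aa t) \<le> ereal x})
    \<longlongrightarrow> (\<Sum>k\<le>m. limit_mass ^ k / fact k * exp (- limit_mass))) at_top"
proof -
  interpret prob_space P by fact
  \<comment> \<open>\<open>poisson_convergence\<close> asks for measurability at every real t, while
    \<open>\<eta> t\<close> is known to be measurable for t \<ge> 0 only; the maximum changes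
    nothing at the times that decide the limit.\<close>
  define N where "N t L \<omega> = card {v \<in> half_box j (Z t) L. \<eta> (max 0 t) \<omega> v}" for t L \<omega>
  define A where "A t L = {\<omega> \<in> space P. N t L \<omega> \<le> m}" for t L
  define F where "F t = {\<omega> \<in> space P. order_stat j m (\<eta> t \<omega>) / ereal (bb t) - ereal (aa t) \<le> ereal x}" for t
  have N_meas: "N t L \<in> measurable P (count_space UNIV)" for t L
    unfolding N_def[abs_def] by (rule measurable_count[OF finite_half_box meas]) simp
  have A_sets: "A t L \<in> events" for t L
    unfolding A_def using N_meas[of t L] by measurable
  have F_eq: "F t = (\<Inter>L. A t L)" if t: "t > 1" for t
  proof -
    have "order_stat j m (\<eta> t \<omega>) / ereal (bb t) - ereal (aa t) \<le> ereal x \<longleftrightarrow> (\<forall>L. N t L \<omega> \<le> m)" for \<omega>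
    proof -
      have "zz t < real_of_int n \<longleftrightarrow> Z t < n" for n by (simp add: Z_def floor_less_iff)
      then show ?thesis
        using t unfolding ereal_affine_le_iff[OF bb_pos[OF t]] zz_def[symmetric] order_stat_le_iff N_def
        by (simp add: count_half_space_le_iff)
    qed
    then show ?thesis unfolding F_def A_def by auto
  qed
  have approx: "(\<lambda>L. prob (A t L)) \<longlonglongrightarrow> prob (F t)" if t: "t > 1" for t
    unfolding F_eq[OF t]
  proof (rule finite_Lim_measure_decseq)
    have "N t L \<omega> \<le> N t L' \<omega>" if "L \<le> L'" for L L' \<omega>
      unfolding N_def using half_box_mono[OF that, of j "Z t"] finite_half_box[of j "Z t" L'] by (intro card_mono) auto
    then show "decseq (A t)" unfolding decseq_def A_def by (blast intro: order_trans)
  qed (use A_sets in auto)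
  define good where "good t L \<longleftrightarrow> \<bar>prob (A t L) - prob (F t)\<bar> \<le> 1 / t \<and> mass t init (half_tail j (Z t) L) \<le> ennreal (1 / t\<^sup>2)" for t L
  have "\<forall>\<^sub>F t in at_top. mass t init (half_space j (Z t)) < \<infinity>"
    by (rule order_tendstoD(2)[OF mass_half_space_lim]) simp
  then have "\<forall>\<^sub>F t in at_top. good t (SOME L. good t L)"
    using eventually_gt_at_top[of 1]
  proof eventually_elim
    case (elim t)
    have "\<forall>\<^sub>F L in sequentially. dist (prob (A t L)) (prob (F t)) < 1 / t"
      using elim(2) by (intro tendstoD[OF approx]) auto
    moreover have "\<forall>\<^sub>F L in sequentially. mass t init (half_tail j (Z t) L) < ennreal (1 / t\<^sup>2)"
      using elim(2) by (intro order_tendstoD(2)[OF mass_half_tail_lim[OF elim(1)]]) simp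
    ultimately have "\<forall>\<^sub>F L in sequentially. good t L"
      by eventually_elim (simp add: good_def dist_real_def)
    then have "\<exists>L. good t L" using eventually_happens' sequentially_bot by blast
    then show ?case by (rule someI_ex)
  qed
  then obtain L where L: "\<forall>\<^sub>F t in at_top. good t (L t)" by (rule that)
  have "((\<lambda>t. prob (A t (L t))) \<longlongrightarrow> (\<Sum>k\<le>m. limit_mass ^ k / fact k * exp (- limit_mass))) at_top"
    unfolding A_def
  proof (rule poisson_convergence[OF P N_meas pos])
    fix \<theta> :: real assume \<theta>: "0 \<le> \<theta>" "\<theta> \<le> 1"
    have "((\<lambda>t. mean t (Phi (half_box j (Z t) (L t)) (\<lambda>_. \<theta>))) \<longlongrightarrow> exp (- (limit_mass * \<theta>))) at_top"
      using L by (intro pgf_limit \<theta>) (auto simp: good_def elim: eventually_mono)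
    moreover have "\<forall>\<^sub>F t in at_top. mean t (Phi (half_box j (Z t) (L t)) (\<lambda>_. \<theta>)) = (\<integral>\<omega>. (1 - \<theta>) ^ N t (L t) \<omega> \<partial>P)"
      using eventually_ge_at_top[of 0]
    proof eventually_elim
      case (elim t)
      have "max 0 t = t" using elim by simp
      then show ?case
        unfolding mean_def law[OF elim, symmetric] apply_local_fun[OF local_fun_Phi[OF finite_half_box]]
          Phi_const[OF finite_half_box] N_def by (simp only:)
    qed
    ultimately show "((\<lambda>t. \<integral>\<omega>. (1 - \<theta>) ^ N t (L t) \<omega> \<partial>P) \<longlongrightarrow> exp (- (limit_mass * \<theta>))) at_top"
      by (rule Lim_transform_eventually)
  qed
  moreover have "((\<lambda>t. prob (A t (L t)) - prob (F t)) \<longlongrightarrow> 0) at_top"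
  proof (rule Lim_null_comparison)
    show "\<forall>\<^sub>F t in at_top. norm (prob (A t (L t)) - prob (F t)) \<le> 1 / t"
      using L by (auto simp: good_def elim: eventually_mono)
    show "((\<lambda>t :: real. 1 / t) \<longlongrightarrow> 0) at_top" by real_asymp
  qed
  ultimately have "((\<lambda>t. prob (A t (L t)) - (prob (A t (L t)) - prob (F t))) \<longlongrightarrow> (\<Sum>k\<le>m. limit_mass ^ k / fact k * exp (- limit_mass)) - 0) at_top"
    by (rule tendsto_diff)
  then show ?thesis by (simp add: F_def)
qed

end

theorem theorem5p1:
  fixes j1 :: "'n::finite"
    and c \<alpha> r :: "'n \<Rightarrow> real"
    and P :: "'w measure"
    and \<eta> :: "real \<Rightarrow> 'w \<Rightarrow> 'n config"
    and m :: nat and x :: real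
  assumes "CARD('n) \<ge> 2"
    and "\<And>i. i \<noteq> j1 \<Longrightarrow> c i > 0"
    and "\<And>i. i \<noteq> j1 \<Longrightarrow> \<alpha> i \<ge> 0"
    and "\<And>i. i \<noteq> j1 \<Longrightarrow> r i \<ge> 0"
    and "ssep_from (init_config j1 (\<lambda>i. profile (c i) (\<alpha> i) (r i))) P \<eta>"
  shows
    "let d = real CARD('n);
         \<beta> = 1 + (\<Sum>i | i \<noteq> j1. \<alpha> i);
         a = (\<lambda>t. ln (t / ((2 * pi) powr (1 / (2 * \<beta>)) * ln t powr ((\<beta> + 1) / (2 * \<beta>)))));
         b = (\<lambda>t. (\<beta> * t / (d * ln t)) powr (1 / 2));
         M = Gamma \<beta> / (d powr (\<beta> / 2) * \<beta> powr ((\<beta> + 1) / 2)) *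
               (\<Prod>i | i \<noteq> j1 \<and> \<alpha> i = 0. 2 * real_of_int \<lfloor>c i + r i\<rfloor> + 1) *
               (\<Prod>i | i \<noteq> j1 \<and> \<alpha> i > 0. 2 * c i)
     in ((\<lambda>t. measure P {\<omega> \<in> space P.
                order_stat j1 m (\<eta> t \<omega>) / ereal (b t) - ereal (a t) \<le> ereal x})
          \<longlongrightarrow> (\<Sum>k\<le>m. (M * exp (- \<beta> * x)) ^ k / fact k * exp (- (M * exp (- \<beta> * x))))) at_top"
proof -
  define d where "d = real CARD('n)"
  define \<beta> where "\<beta> = 1 + (\<Sum>i | i \<noteq> j1. \<alpha> i)"
  define g where "g = (\<lambda>i. profile (c i) (\<alpha> i) (r i))"
  define \<eta>0 where "\<eta>0 = init_config j1 g"
  define K where "K = layer_card j1 g"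
  define C where "C = (\<Prod>i | i \<noteq> j1 \<and> \<alpha> i = 0. 2 * real_of_int \<lfloor>c i + r i\<rfloor> + 1) * (\<Prod>i | i \<noteq> j1 \<and> \<alpha> i > 0. 2 * c i)"
  have from_\<eta>0: "ssep_from \<eta>0 P \<eta>" using assms(5) unfolding \<eta>0_def g_def .
  then obtain S where S: "ssep_semigroup S"
    "\<And>t f. t \<ge> 0 \<Longrightarrow> (\<integral>\<omega>. apply_bcontfun f (\<eta> t \<omega>) \<partial>P) = apply_bcontfun (S t f) \<eta>0"
    by (rule ssep_from_expectation) (rule that, assumption, blast)
  have g0: "0 \<le> g i u" if "i \<noteq> j1" for i u
    unfolding g_def using assms(2)[OF that] assms(4)[OF that] by (intro profile_nonneg) auto
  have \<beta>1: "\<beta> \<ge> 1"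
  proof -
    have "(\<Sum>i | i \<noteq> j1. \<alpha> i) \<ge> 0" by (rule sum_nonneg) (use assms(3) in auto)
    then show ?thesis unfolding \<beta>_def by simp
  qed
  have d1: "d \<ge> 1" unfolding d_def using assms(1) by simp
  \<comment> \<open>Makes \<open>limit_mass\<close> positive, as the parameter of
    \<open>poisson_pmf\<close> has to be.\<close>
  have C0: "C > 0"
  proof -
    have "2 * real_of_int \<lfloor>c i + r i\<rfloor> + 1 > 0" if "i \<noteq> j1" for i
    proof -
      have "0 \<le> \<lfloor>c i + r i\<rfloor>" using assms(2)[OF that] assms(4)[OF that] by simp
      then show ?thesis by linarith
    qed
    then show ?thesis unfolding C_def using assms(2) by (intro mult_pos_pos prod_pos) auto
  qed
  interpret exclusion_front d \<beta> x j1 K C S \<eta>0 g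
  proof unfold_locales
    show "(\<lambda>k. K k / real k powr (\<beta> - 1)) \<longlonglongrightarrow> C"
      unfolding K_def g_def C_def \<beta>_def using layer_card_asymp[of j1 c \<alpha> r] assms(2,3) by simp
    show "0 \<le> K k" for k unfolding K_def by (rule layer_card_nonneg) (rule g0)
  qed (use d1 \<beta>1 d_def \<eta>0_def K_def S(1) g0 in auto)
  have pos: "limit_mass > 0"
    unfolding limit_mass_def using C0 d1 \<beta>1 by (simp add: Gamma_real_pos)
  have "limit_mass = Gamma \<beta> / (d powr (\<beta> / 2) * \<beta> powr ((\<beta> + 1) / 2)) *
               (\<Prod>i | i \<noteq> j1 \<and> \<alpha> i = 0. 2 * real_of_int \<lfloor>c i + r i\<rfloor> + 1) *
               (\<Prod>i | i \<noteq> j1 \<and> \<alpha> i > 0. 2 * c i) * exp (- \<beta> * x)"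
    unfolding limit_mass_def unfolding C_def by simp
  moreover have "prob_space P" "\<And>t. t \<ge> 0 \<Longrightarrow> \<eta> t \<in> borel_measurable P"
    using from_\<eta>0 by (simp_all add: ssep_from_def)
  note order_stat_limit[OF this S(2) pos, of m]
  ultimately show ?thesis
    unfolding Let_def d_def[symmetric] \<beta>_def[symmetric] by (simp only: bb_def aa_def)
qed

end
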